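(* Let $D$ be a bounded domain in $\mathbb{R}^m$, $m \geq 2$, and let a real-valued $u$ belong to the Sobolev space $W^{k,p}_{loc}(D)$, where $p \in [1,\infty)$ and an integer $k \geq 2$ are such that $1 < k - m/p$. If for some $\lambda > 0$ the equality $$F(u,x,r) = - \lambda \, \Gamma\left( \frac{m}{2} \right) \frac{J_{m/2}(\lambda r)}{(\lambda r/2)^{(m-2)/2}} \, u(x)$$ holds for every $x \in D$ and all $r \in (0, r(x))$, where $r(x) > 0$ is such that the ball $B_{r(x)}(x)$ is admissible, then $u$ is metaharmonic in $D$, that is, $u$ satisfies $\nabla^2 u + \lambda^2 u = 0$ in $D$.
   Context: A domain is an open connected subset of $\mathbb{R}^m$. $B_r(x) = \{ y : |y-x| < r\}$; the ball is called admissible if $\overline{B_r(x)} \subset D$. The mean flux is $$F(u,x,r) = \frac{1}{|\partial B_r|} \int_{\partial B_r(x)} \frac{\partial u}{\partial n_y} \, dS_y,$$ where $n$ is the exterior unit normal, $dS$ is the surface measure and $|\partial B_r| = 2\pi^{m/2} r^{m-1}/\Gamma(m/2)$ is the area of the sphere of radius $r$. $J_\nu$ is the Bessel function of the first kind of order $\nu$. Under the stated conditions on $k,p$, functions in $W^{k,p}_{loc}(D)$ are (identified with) $C^1$-functions on $D$, so $u(x)$ and $F(u,x,r)$ are well defined. *)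

theory Defs
  imports "HOL-Analysis.Analysis"
begin

section \<open>Partial derivatives and classes of differentiable functions\<close>

definition partial_deriv :: "'a::euclidean_space \<Rightarrow> ('a \<Rightarrow> real) \<Rightarrow> 'a \<Rightarrow> real" where
  "partial_deriv b f x = frechet_derivative f (at x) b"

text \<open>A multi-index \<open>\<alpha>\<close> is represented by a list of basis vectors of length \<open>|\<alpha>|\<close>;
  the order of the entries is immaterial for smooth functions.\<close>

definition iter_partial :: "'a::euclidean_space list \<Rightarrow> ('a \<Rightarrow> real) \<Rightarrow> 'a \<Rightarrow> real" where
  "iter_partial bs f = foldr partial_deriv bs f"

text \<open>Intended for open sets only, because derivatives are taken with respect to the whole space.\<close>

primrec Ck_on :: "nat \<Rightarrow> 'a::euclidean_space set \<Rightarrow> ('a \<Rightarrow> real) \<Rightarrow> bool" where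
  "Ck_on 0 S f \<longleftrightarrow> continuous_on S f"
| "Ck_on (Suc k) S f \<longleftrightarrow>
     (\<forall>x\<in>S. f differentiable at x) \<and> (\<forall>b\<in>Basis. Ck_on k S (partial_deriv b f))"

definition laplacian :: "('a::euclidean_space \<Rightarrow> real) \<Rightarrow> 'a \<Rightarrow> real" where
  "laplacian f x = (\<Sum>b\<in>Basis. partial_deriv b (partial_deriv b f) x)"

definition metaharmonic_on :: "real \<Rightarrow> 'a::euclidean_space set \<Rightarrow> ('a \<Rightarrow> real) \<Rightarrow> bool" where
  "metaharmonic_on \<mu> S f \<longleftrightarrow> Ck_on 2 S f \<and> (\<forall>x\<in>S. laplacian f x + \<mu>\<^sup>2 * f x = 0)"

section \<open>Sobolev spaces\<close>

definition test_function_on :: "'a::euclidean_space set \<Rightarrow> ('a \<Rightarrow> real) \<Rightarrow> bool" where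
  "test_function_on U \<phi> \<longleftrightarrow>
     (\<forall>k. Ck_on k UNIV \<phi>) \<and> compact (closure {x. \<phi> x \<noteq> 0}) \<and> closure {x. \<phi> x \<noteq> 0} \<subseteq> U"

definition Lp_on :: "real \<Rightarrow> 'a::euclidean_space set \<Rightarrow> ('a \<Rightarrow> real) \<Rightarrow> bool" where
  "Lp_on p U f \<longleftrightarrow>
     set_borel_measurable lebesgue U f \<and> set_integrable lebesgue U (\<lambda>x. \<bar>f x\<bar> powr p)"

text \<open>Only meaningful for functions that are locally integrable on the open set \<open>U\<close>; this is
  guaranteed by \<open>Lp_on\<close> (with exponent at least 1) wherever the notion is used below.\<close>

definition weak_deriv_on ::
    "'a::euclidean_space set \<Rightarrow> 'a list \<Rightarrow> ('a \<Rightarrow> real) \<Rightarrow> ('a \<Rightarrow> real) \<Rightarrow> bool" where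
  "weak_deriv_on U bs f g \<longleftrightarrow>
     (\<forall>\<phi>. test_function_on U \<phi> \<longrightarrow>
        (LINT x:U|lebesgue. f x * iter_partial bs \<phi> x)
          = (-1) ^ length bs * (LINT x:U|lebesgue. g x * \<phi> x))"

definition sobolev :: "nat \<Rightarrow> real \<Rightarrow> 'a::euclidean_space set \<Rightarrow> ('a \<Rightarrow> real) set" where
  "sobolev k p U = {f. Lp_on p U f \<and>
     (\<forall>bs. set bs \<subseteq> Basis \<and> length bs \<le> k \<longrightarrow> (\<exists>g. Lp_on p U g \<and> weak_deriv_on U bs f g))}"

definition sobolev_loc :: "nat \<Rightarrow> real \<Rightarrow> 'a::euclidean_space set \<Rightarrow> ('a \<Rightarrow> real) set" where
  "sobolev_loc k p D =
     {f. \<forall>U. open U \<and> compact (closure U) \<and> closure U \<subseteq> D \<longrightarrow> f \<in> sobolev k p U}"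

section \<open>Surface measure and mean flux\<close>

text \<open>The surface measure on the sphere of radius \<open>r > 0\<close> about \<open>x\<close> is the usual one defined
  through polar coordinates: \<open>S(A) = (m / r) * |{x + t (y - x) | y \<in> A, 0 < t < 1}|\<close>, where \<open>m\<close>
  is the dimension of the space and \<open>|.|\<close> is Lebesgue measure. In other words, \<open>S\<close> is \<open>m / r\<close>
  times the image of Lebesgue measure on the punctured ball under the radial projection.
  The target is the Borel algebra of the sphere, so that the values of an integrand off the
  sphere are irrelevant.\<close>

definition sphere_measure :: "'a::euclidean_space \<Rightarrow> real \<Rightarrow> 'a measure" where
  "sphere_measure x r =
     distr (density (restrict_space lborel (ball x r - {x})) (\<lambda>_. ennreal (real DIM('a) / r)))
       (restrict_space borel (sphere x r)) (\<lambda>y. x + (r / norm (y - x)) *\<^sub>R (y - x))"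

definition sphere_area :: "nat \<Rightarrow> real \<Rightarrow> real" where
  "sphere_area m r = 2 * pi powr (real m / 2) * r ^ (m - 1) / Gamma (real m / 2)"

text \<open>The exterior unit normal at \<open>y\<close> is \<open>(y - x) / r\<close>.\<close>

definition mean_flux :: "('a::euclidean_space \<Rightarrow> real) \<Rightarrow> 'a \<Rightarrow> real \<Rightarrow> real" where
  "mean_flux u x r = 1 / sphere_area DIM('a) r *
     (LINT y|sphere_measure x r. frechet_derivative u (at y) ((1 / r) *\<^sub>R (y - x)))"

lemma measurable_radial_projection:
  fixes x :: "'a::euclidean_space"
  assumes "r > 0"
  shows "(\<lambda>y. x + (r / norm (y - x)) *\<^sub>R (y - x))
    \<in> restrict_space lborel (ball x r - {x}) \<rightarrow>\<^sub>M restrict_space borel (sphere x r)"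
proof (rule measurable_restrict_space2)
  show "(\<lambda>y. x + (r / norm (y - x)) *\<^sub>R (y - x))
      \<in> space (restrict_space lborel (ball x r - {x})) \<rightarrow> sphere x r"
    using assms by (auto simp: space_restrict_space dist_norm)
  show "(\<lambda>y. x + (r / norm (y - x)) *\<^sub>R (y - x))
      \<in> borel_measurable (restrict_space lborel (ball x r - {x}))"
    by (intro measurable_restrict_space1) measurable
qed

lemma measure_sphere_measure:
  fixes x :: "'a::euclidean_space"
  assumes "r > 0"
  shows "measure (sphere_measure x r) (sphere x r) = sphere_area DIM('a) r"
proof -
  let ?B = "ball x r - {x}"
  let ?M = "restrict_space lborel ?B"
  let ?g = "\<lambda>y. x + (r / norm (y - x)) *\<^sub>R (y - x)"
  let ?d = "real DIM('a)"
  have g: "?g \<in> ?M \<rightarrow>\<^sub>M restrict_space borel (sphere x r)"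
    by (rule measurable_radial_projection[OF assms])
  have vimage: "?g -` sphere x r \<inter> space ?M = ?B"
    using assms by (auto simp: space_restrict_space dist_norm)
  have B: "?B \<in> sets ?M" "?B \<in> sets lborel"
    by (auto simp: sets_restrict_space image_iff)
  have "emeasure lborel ?B = emeasure lborel (ball x r)"
    using assms by (subst emeasure_Diff) auto
  also have "\<dots> = ennreal (unit_ball_vol ?d * r ^ DIM('a))"
    using assms by (simp add: emeasure_ball)
  finally have volB: "emeasure lborel ?B = ennreal (unit_ball_vol ?d * r ^ DIM('a))" .
  have "emeasure (sphere_measure x r) (sphere x r)
      = emeasure (density ?M (\<lambda>_. ennreal (?d / r))) ?B"
  proof -
    have "?g \<in> density ?M (\<lambda>_. ennreal (?d / r)) \<rightarrow>\<^sub>M restrict_space borel (sphere x r)"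
      using g by simp
    moreover have "sphere x r \<in> sets (restrict_space borel (sphere x r))"
      by (auto simp: sets_restrict_space)
    ultimately show ?thesis
      unfolding sphere_measure_def using vimage by (subst emeasure_distr) simp_all
  qed
  also have "\<dots> = ennreal (?d / r) * emeasure ?M ?B"
    using B by (subst emeasure_density_const) auto
  also have "emeasure ?M ?B = ennreal (unit_ball_vol ?d * r ^ DIM('a))"
    using B volB by (subst emeasure_restrict_space) auto
  also have "ennreal (?d / r) * \<dots> = ennreal (?d / r * (unit_ball_vol ?d * r ^ DIM('a)))"
    by (subst ennreal_mult[symmetric]) (use assms in simp_all)
  also have "?d / r * (unit_ball_vol ?d * r ^ DIM('a)) = sphere_area DIM('a) r"
  proof -
    have Gam: "Gamma (?d / 2 + 1) = ?d / 2 * Gamma (?d / 2)"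
      by (rule Gamma_plus1) (auto dest: nonpos_Ints_nonpos)
    have pow: "r ^ DIM('a) = r * r ^ (DIM('a) - 1)"
      by (simp flip: power_Suc)
    have cancel: "d / r * (P / (d / 2 * G) * (r * R)) = 2 * P * R / G"
      if "d > 0" "G > 0" for d P G R :: real
      using that assms by (simp add: divide_simps)
    show ?thesis
      unfolding unit_ball_vol_def sphere_area_def Gam pow
      by (rule cancel) (simp_all add: Gamma_real_pos)
  qed
  finally show ?thesis
    using assms by (simp add: measure_def sphere_area_def Gamma_real_pos)
qed

section \<open>Bessel functions\<close>

text \<open>Intended for \<open>z > 0\<close>. The reciprocal Gamma function vanishes at the poles of Gamma, as
  required by the convention for the terms of the series when \<open>\<nu>\<close> is a negative integer.\<close>

definition bessel_J :: "real \<Rightarrow> real \<Rightarrow> real" where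
  "bessel_J \<nu> z = (\<Sum>n. (-1) ^ n * rGamma (real n + \<nu> + 1) / fact n * (z / 2) powr (2 * real n + \<nu>))"

end

theory Submission
  imports Defs
begin

text \<open>Let \<open>m\<close> be the dimension and let \<open>g\<close> be the weak Laplacian of \<open>v\<close>, which is locally integrable.
  For a radial bump \<open>\<psi>\<close> of radius \<open>r\<close> about \<open>x\<close>, integration by parts and polar coordinates express
  \<open>\<integral> g \<psi> = \<integral> v \<Delta>\<psi>\<close> through the mean fluxes of \<open>v\<close> at \<open>x\<close> with radii below \<open>r\<close>. The flux identity
  and the expansion of the Bessel function at \<open>0\<close> show that the means of \<open>g\<close> weighted by \<open>\<psi>\<close>
  converge to \<open>- \<mu>\<^sup>2 v(x)\<close> for every \<open>x\<close> as \<open>r\<close> tends to \<open>0\<close>, without any uniformity in \<open>x\<close>. They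
  also converge to \<open>g\<close> in \<open>L\<^sup>1\<close>, hence \<open>g = - \<mu>\<^sup>2 v\<close> almost everywhere by Fatou's lemma, and \<open>v\<close> is a weak
  solution of the Helmholtz equation. Testing with a regularised and cut off radial fundamental
  solution represents \<open>v\<close> locally as its own convolution with a smooth kernel, so \<open>v\<close> is smooth; the
  same means now converge to the classical Laplacian as well.\<close>

section \<open>Differentiable functions\<close>

text \<open>The radii \<open>\<rho> x\<close> may shrink arbitrarily fast as \<open>x\<close>
  varies, so no mean value formula at a common radius is available. What is kept of the flux
  identity is its behaviour as \<open>r\<close> tends to 0 at each single point:
  \<open>mean_flux v x r / r\<close> tends to \<open>- (\<mu>\<^sup>2 / m) * v x\<close>. Pointwise
  limits alone would not determine a distribution; the Sobolev hypothesis makes the weak Laplacian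
  an integrable function, with which they can be compared. The factor \<open>1 / m\<close> comes
  from \<open>Gamma (m / 2) / Gamma (m / 2 + 1) = 2 / m\<close>. It is undone by the radial weight
  attached to a bump, whose mass is \<open>m\<close> times the integral of the bump; this mass is
  found by testing with the squared distance, of Laplacian \<open>2 * m\<close> and flux
  \<open>2 * s\<close>. The fundamental solution arises by reduction of order from the regular
  radial solution \<open>j\<close>. In the variable \<open>t\<close>, the squared distance, smooth
  profiles give functions smooth at the centre, and \<open>t + e\<close> in place of
  \<open>t\<close> removes the singularity. Radius and kernel of the resulting formula do not depend
  on the centre, which is what turns it into a convolution.\<close>

lemma partial_deriv_eq:
  assumes "(f has_derivative f') (at x)"
  shows "partial_deriv b f x = f' b"
  using frechet_derivative_at[OF assms] by (simp add: partial_deriv_def)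

lemma has_derivative_partial_deriv:
  assumes "f differentiable at x"
  shows "(f has_derivative (\<lambda>h. \<Sum>b\<in>Basis. (h \<bullet> b) * partial_deriv b f x)) (at x)"
proof -
  let ?D = "frechet_derivative f (at x)"
  have D: "(f has_derivative ?D) (at x)"
    using assms by (simp add: frechet_derivative_works)
  have "?D h = (\<Sum>b\<in>Basis. (h \<bullet> b) * partial_deriv b f x)" for h
  proof -
    interpret linear ?D by (rule has_derivative_linear[OF D])
    have "?D h = ?D (\<Sum>b\<in>Basis. (h \<bullet> b) *\<^sub>R b)" by (simp add: euclidean_representation)
    then show ?thesis by (simp add: sum scale partial_deriv_def)
  qed
  then show ?thesis using D by (metis (no_types, lifting) ext)
qed

lemma partial_deriv_cong:
  assumes "open S" "x \<in> S" "\<And>y. y \<in> S \<Longrightarrow> f y = g y"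
  shows "partial_deriv b f x = partial_deriv b g x"
proof -
  have "(f has_derivative f') (at x) \<longleftrightarrow> (g has_derivative f') (at x)" for f'
    using has_derivative_transform_within_open[OF _ assms(1,2)] assms(3) by metis
  then show ?thesis by (simp add: partial_deriv_def frechet_derivative_def)
qed

section \<open>Calculus of C^k functions on open sets\<close>

lemma Ck_on_cong:
  assumes "open S" "\<And>x. x \<in> S \<Longrightarrow> f x = g x" "Ck_on k S f"
  shows "Ck_on k S g"
  using assms(2,3)
proof (induction k arbitrary: f g)
  case 0
  then show ?case by (simp cong: continuous_on_cong)
next
  case (Suc k)
  have "g differentiable at x" if "x \<in> S" for x
    using Suc.prems that has_derivative_transform_within_open[OF _ assms(1) that]
    by (simp add: differentiable_def) blast
  moreover have "Ck_on k S (partial_deriv b g)" if "b \<in> Basis" for b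
    by (rule Suc.IH[of "partial_deriv b f"]) (use Suc.prems that in \<open>auto intro: partial_deriv_cong[OF assms(1)]\<close>)
  ultimately show ?case by simp
qed

lemma Ck_on_subset: "Ck_on k S f \<Longrightarrow> T \<subseteq> S \<Longrightarrow> Ck_on k T f"
  by (induction k arbitrary: f) (auto intro: continuous_on_subset)

lemma Ck_on_local:
  assumes "\<And>x. x \<in> S \<Longrightarrow> \<exists>T. open T \<and> x \<in> T \<and> Ck_on k T f"
  shows "Ck_on k S f"
  using assms
proof (induction k arbitrary: f)
  case 0
  then show ?case
    by (metis Ck_on.simps(1) continuous_at_imp_continuous_on continuous_on_eq_continuous_at)
next
  case (Suc k)
  then show ?case by (simp, meson)
qed

lemma Ck_on_SucD: "Ck_on (Suc k) S f \<Longrightarrow> Ck_on k S f"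
proof (induction k arbitrary: f)
  case 0
  then show ?case
    by (auto intro: continuous_at_imp_continuous_on differentiable_imp_continuous_within)
qed auto

lemma Ck_on_le: "Ck_on k S f \<Longrightarrow> l \<le> k \<Longrightarrow> Ck_on l S f"
  by (induction k) (auto simp: le_Suc_eq simp del: Ck_on.simps dest: Ck_on_SucD)

lemma Ck_on_imp_continuous_on: "Ck_on k S f \<Longrightarrow> continuous_on S f"
  using Ck_on_le[of k S f 0] by simp

text \<open>Lets an explicit derivative stand in for \<open>frechet_derivative\<close>. Openness of
  \<open>S\<close> is what carries agreement on \<open>S\<close> over to the iterated
  derivatives.\<close>

lemma Ck_on_SucI:
  assumes "open S" "\<And>x. x \<in> S \<Longrightarrow> (f has_derivative f' x) (at x)"
    and "\<And>b. b \<in> Basis \<Longrightarrow> Ck_on k S (\<lambda>x. f' x b)"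
  shows "Ck_on (Suc k) S f"
proof -
  have "Ck_on k S (partial_deriv b f)" if "b \<in> Basis" for b
    by (rule Ck_on_cong[OF assms(1) _ assms(3)[OF that]]) (simp add: partial_deriv_eq[OF assms(2)])
  then show ?thesis using assms(2) by (auto simp: differentiable_def)
qed

lemma Ck_on_SucI_real:
  assumes "open S" "\<And>x. x \<in> S \<Longrightarrow> (f has_real_derivative f' x) (at x)" "Ck_on k S f'"
  shows "Ck_on (Suc k) S f"
proof (rule Ck_on_SucI[OF assms(1)])
  show "(f has_derivative (*) (f' x)) (at x)" if "x \<in> S" for x
    using assms(2)[OF that] by (simp add: has_field_derivative_def)
qed (use assms(3) in simp)

lemma Ck_on_const: "open S \<Longrightarrow> Ck_on k S (\<lambda>x. c)"
  by (induction k arbitrary: c) (auto intro!: Ck_on_SucI[where f'="\<lambda>_ _. 0"] simp del: Ck_on.simps(2))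

lemma Ck_on_bounded_linear:
  assumes "open S" "bounded_linear f"
  shows "Ck_on k S f"
proof (cases k)
  case 0
  then show ?thesis using assms(2) by (simp add: linear_continuous_on)
next
  case (Suc l)
  show ?thesis unfolding Suc
    by (rule Ck_on_SucI[OF assms(1) bounded_linear_imp_has_derivative[OF assms(2)]])
      (rule Ck_on_const[OF assms(1)])
qed

lemma Ck_on_add:
  assumes "open S" "Ck_on k S f" "Ck_on k S g"
  shows "Ck_on k S (\<lambda>x. f x + g x)"
  using assms(2,3)
proof (induction k arbitrary: f g)
  case 0
  then show ?case by (simp add: continuous_on_add)
next
  case (Suc k)
  show ?case
  proof (rule Ck_on_SucI[OF assms(1)])
    show "((\<lambda>x. f x + g x) has_derivative
        (\<lambda>h. frechet_derivative f (at x) h + frechet_derivative g (at x) h)) (at x)" if "x \<in> S" for x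
      using Suc.prems that by (auto intro!: has_derivative_add simp: frechet_derivative_works[symmetric])
    show "Ck_on k S (\<lambda>x. frechet_derivative f (at x) b + frechet_derivative g (at x) b)"
      if "b \<in> Basis" for b
      using Suc.IH[of "partial_deriv b f" "partial_deriv b g"] Suc.prems that
      by (simp add: partial_deriv_def[abs_def])
  qed
qed

lemma Ck_on_mult:
  assumes "open S" "Ck_on k S f" "Ck_on k S g"
  shows "Ck_on k S (\<lambda>x. f x * g x)"
  using assms(2,3)
proof (induction k arbitrary: f g)
  case 0
  then show ?case by (simp add: continuous_on_mult)
next
  case (Suc k)
  have l: "Ck_on k S f" "Ck_on k S g" using Suc.prems Ck_on_SucD by blast+
  show ?case
  proof (rule Ck_on_SucI[OF assms(1)])
    show "((\<lambda>x. f x * g x) has_derivative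
        (\<lambda>h. f x * frechet_derivative g (at x) h + frechet_derivative f (at x) h * g x)) (at x)"
      if "x \<in> S" for x
      using Suc.prems that by (auto intro!: has_derivative_mult simp: frechet_derivative_works[symmetric])
    show "Ck_on k S (\<lambda>x. f x * frechet_derivative g (at x) b + frechet_derivative f (at x) b * g x)"
      if "b \<in> Basis" for b
    proof -
      have "Ck_on k S (\<lambda>x. f x * partial_deriv b g x)" "Ck_on k S (\<lambda>x. partial_deriv b f x * g x)"
        using Suc.prems l that by (auto intro: Suc.IH)
      then show ?thesis
        unfolding partial_deriv_def by (rule Ck_on_add[OF assms(1)])
    qed
  qed
qed

lemma Ck_on_diff:
  assumes "open S" "Ck_on k S f" "Ck_on k S g"
  shows "Ck_on k S (\<lambda>x. f x - g x)"
  using Ck_on_add[OF assms(1,2) Ck_on_mult[OF assms(1) Ck_on_const[OF assms(1), of k "-1"] assms(3)]]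
  by simp

lemma Ck_on_compose:
  fixes f :: "real \<Rightarrow> real"
  assumes "open S" "Ck_on k T f" "Ck_on k S g" "g ` S \<subseteq> T"
  shows "Ck_on k S (\<lambda>x. f (g x))"
  using assms(2,3)
proof (induction k arbitrary: f)
  case 0
  then show ?case using continuous_on_compose2[of T f S g] assms(4) by simp
next
  case (Suc k)
  show ?case
  proof (rule Ck_on_SucI[OF assms(1)])
    show "((\<lambda>x. f (g x)) has_derivative
        (\<lambda>h. frechet_derivative g (at x) h * partial_deriv 1 f (g x))) (at x)" if "x \<in> S" for x
    proof -
      have "(f has_derivative (\<lambda>h. h * partial_deriv 1 f (g x))) (at (g x))"
        using has_derivative_partial_deriv[of f "g x"] Suc.prems(1) that assms(4) by auto
      then show ?thesis using Suc.prems(2) that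
        by (intro has_derivative_compose[of g, where g=f]) (auto simp: frechet_derivative_works[symmetric])
    qed
    show "Ck_on k S (\<lambda>x. frechet_derivative g (at x) b * partial_deriv 1 f (g x))"
      if "b \<in> Basis" for b
    proof -
      have "Ck_on k S (partial_deriv b g)" "Ck_on k S (\<lambda>x. partial_deriv 1 f (g x))"
        using Suc.prems that Ck_on_SucD[OF Suc.prems(2)] by (auto intro: Suc.IH)
      then show ?thesis
        unfolding partial_deriv_def by (rule Ck_on_mult[OF assms(1)])
    qed
  qed
qed

text \<open>The derivative is a product of copies of \<open>inverse\<close> itself, so the product
  rule of order \<open>k\<close> yields order \<open>Suc k\<close>.\<close>

lemma Ck_on_inverse: "Ck_on k (-{0}) (inverse :: real \<Rightarrow> real)"
proof (induction k)
  case 0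
  then show ?case by (auto intro: continuous_on_inverse)
next
  case (Suc k)
  show ?case
  proof (rule Ck_on_SucI_real)
    show "(inverse has_real_derivative (-1) * (inverse x * inverse x)) (at x)" if "x \<in> -{0}" for x :: real
      using DERIV_inverse[of x] that by (simp add: numeral_2_eq_2)
    show "Ck_on k (-{0}) (\<lambda>x::real. (-1) * (inverse x * inverse x))"
      using Suc by (intro Ck_on_mult Ck_on_const) auto
  qed auto
qed

lemma Ck_on_powr: "Ck_on k {0<..} (\<lambda>x::real. x powr a)"
proof (induction k arbitrary: a)
  case 0
  then show ?case by (auto intro!: continuous_intros)
next
  case (Suc k)
  show ?case
    by (rule Ck_on_SucI_real[where f'="\<lambda>x. a * x powr (a - 1)"])
      (auto intro!: Ck_on_mult Ck_on_const Suc derivative_eq_intros)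
qed

lemma Ck_on_divide:
  assumes "open S" "Ck_on k S f" "Ck_on k S g" "\<And>x. x \<in> S \<Longrightarrow> g x \<noteq> 0"
  shows "Ck_on k S (\<lambda>x. f x / g x)"
  unfolding divide_inverse
  by (intro Ck_on_mult assms Ck_on_compose[OF assms(1) Ck_on_inverse]) (use assms in auto)

text \<open>The coefficients stay arbitrary in the induction because the derivative is again an
  everywhere convergent power series, with coefficients \<open>diffs c\<close>.\<close>

lemma Ck_on_powser:
  fixes c :: "nat \<Rightarrow> real"
  assumes "\<And>x. summable (\<lambda>n. c n * x ^ n)"
  shows "Ck_on k UNIV (\<lambda>x. \<Sum>n. c n * x ^ n)"
  using assms
proof (induction k arbitrary: c)
  case 0
  then show ?case
    using DERIV_isCont[OF termdiffs_strong_converges_everywhere[OF 0]]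
    by (auto intro: continuous_at_imp_continuous_on)
next
  case (Suc k)
  show ?case
    by (rule Ck_on_SucI_real[OF _ termdiffs_strong_converges_everywhere])
      (use Suc termdiff_converges_all in auto)
qed

text \<open>The classical smooth function exp(-1/t), extended by 0. The divisors
  \<open>t ^ n\<close> make the span of the family closed under differentiation, so smoothness
  follows by induction on the order with \<open>n\<close> arbitrary.\<close>

definition flat :: "nat \<Rightarrow> real \<Rightarrow> real" where
  "flat n t = (if t > 0 then exp (- 1 / t) / t ^ n else 0)"

lemma flat_has_real_derivative:
  "(flat n has_real_derivative flat (n + 2) t - n * flat (n + 1) t) (at t)"
proof -
  consider "t > 0" | "t < 0" | "t = 0" by linarith
  then show ?thesis
  proof cases
    case 1
    have "((\<lambda>t. exp (- 1 / t) / t ^ n) has_real_derivative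
        (exp (- 1 / t) * (1 / t\<^sup>2) * t ^ n - exp (- 1 / t) * (n * t ^ (n - 1))) / (t ^ n * t ^ n)) (at t)"
      using 1 by (auto intro!: derivative_eq_intros simp: power2_eq_square)
    also have "(exp (- 1 / t) * (1 / t\<^sup>2) * t ^ n - exp (- 1 / t) * (n * t ^ (n - 1))) / (t ^ n * t ^ n)
       = flat (n + 2) t - n * flat (n + 1) t"
      using 1 by (cases n) (auto simp: flat_def field_simps power2_eq_square)
    finally show ?thesis
      by (rule has_field_derivative_transform_within_open[where S="{0<..}"])
        (use 1 in \<open>auto simp: flat_def\<close>)
  next
    case 2
    have "((\<lambda>_. 0) has_real_derivative flat (n + 2) t - n * flat (n + 1) t) (at t)"
      using 2 by (simp add: flat_def)
    then show ?thesis
      by (rule has_field_derivative_transform_within_open[where S="{..<0}"])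
        (use 2 in \<open>auto simp: flat_def\<close>)
  next
    case 3
    \<comment> \<open>The exponential beats every power at infinity; the substitution of
      \<open>inverse t\<close> carries this to the right of 0.\<close>
    have "((\<lambda>t::real. exp (- t) * t ^ (n + 1)) \<longlongrightarrow> 0) at_top"
      using tendsto_power_div_exp_0[of "n + 1"] by (simp add: exp_minus divide_inverse mult_ac)
    then have "((\<lambda>t. exp (- inverse t) * inverse t ^ (n + 1)) \<longlongrightarrow> 0) (at_right (0::real))"
      by (rule filterlim_compose[OF _ filterlim_inverse_at_top_right])
    then have "(flat (n + 1) \<longlongrightarrow> 0) (at_right 0)"
      by (rule Lim_transform_eventually)
        (auto simp: eventually_at_filter flat_def field_simps intro!: always_eventually)
    moreover have "(flat (n + 1) \<longlongrightarrow> 0) (at_left 0)"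
      by (rule Lim_transform_eventually[OF tendsto_const])
        (auto simp: eventually_at_filter flat_def intro!: always_eventually)
    ultimately have "(flat (n + 1) \<longlongrightarrow> 0) (at 0)" by (simp add: filterlim_at_split)
    \<comment> \<open>The difference quotient of \<open>flat n\<close> at 0 is exactly
      \<open>flat (n + 1)\<close>.\<close>
    then have "((\<lambda>t. (flat n t - flat n 0) / (t - 0)) \<longlongrightarrow> 0) (at 0)"
      by (rule Lim_transform_eventually)
        (auto simp: eventually_at_filter flat_def intro!: always_eventually)
    then show ?thesis using 3 by (simp add: has_field_derivative_iff flat_def)
  qed
qed

lemma Ck_on_flat: "Ck_on k UNIV (flat n)"
proof (induction k arbitrary: n)
  case 0
  then show ?case
    using DERIV_isCont[OF flat_has_real_derivative] by (auto intro: continuous_at_imp_continuous_on)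
next
  case (Suc k)
  show ?case
    by (rule Ck_on_SucI_real[OF _ flat_has_real_derivative])
      (auto intro!: Ck_on_diff Ck_on_mult Ck_on_const Suc)
qed

lemma flat_nonneg: "flat n t \<ge> 0"
  by (simp add: flat_def)

lemma flat_pos: "t > 0 \<Longrightarrow> flat n t > 0"
  by (simp add: flat_def)

lemma flat_eq_0: "t \<le> 0 \<Longrightarrow> flat n t = 0"
  by (simp add: flat_def)

section \<open>Radial functions as profiles of the squared distance\<close>

lemma has_derivative_norm_square:
  fixes x :: "'a::euclidean_space"
  shows "((\<lambda>y. (norm (y - x))\<^sup>2) has_derivative (\<lambda>h. 2 * ((y - x) \<bullet> h))) (at y)"
  unfolding power2_norm_eq_inner
  by (auto intro!: derivative_eq_intros simp: inner_commute)

text \<open>This is why profiles are composed with the squared distance: it is a polynomial, whereas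
  the distance itself is not differentiable at the centre.\<close>

lemma Ck_on_norm_square: "Ck_on k UNIV (\<lambda>y::'a::euclidean_space. (norm (y - x))\<^sup>2)"
proof (cases k)
  case 0
  then show ?thesis by (auto intro!: continuous_intros)
next
  case (Suc l)
  have "Ck_on l UNIV (\<lambda>y::'a. 2 * ((y - x) \<bullet> b))" for b
    unfolding inner_diff_left
    by (intro Ck_on_mult Ck_on_diff Ck_on_const Ck_on_bounded_linear open_UNIV bounded_linear_inner_left)
  then show ?thesis unfolding Suc by (intro Ck_on_SucI[OF _ has_derivative_norm_square]) auto
qed

lemma partial_deriv_radial:
  fixes x :: "'a::euclidean_space"
  assumes "(f has_real_derivative d) (at ((norm (y - x))\<^sup>2))"
  shows "((\<lambda>y. f ((norm (y - x))\<^sup>2)) has_derivative (\<lambda>h. 2 * ((y - x) \<bullet> h) * d)) (at y)"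
    and "partial_deriv b (\<lambda>y. f ((norm (y - x))\<^sup>2)) y = 2 * ((y - x) \<bullet> b) * d"
proof -
  show "((\<lambda>y. f ((norm (y - x))\<^sup>2)) has_derivative (\<lambda>h. 2 * ((y - x) \<bullet> h) * d)) (at y)"
    using has_derivative_compose[OF has_derivative_norm_square, of f "\<lambda>h. h * d" y x] assms
    by (simp add: has_field_derivative_def mult_commute_abs)
  from partial_deriv_eq[OF this]
  show "partial_deriv b (\<lambda>y. f ((norm (y - x))\<^sup>2)) y = 2 * ((y - x) \<bullet> b) * d" .
qed

text \<open>Chain rule: the squared distance has gradient \<open>2 *\<^sub>R (y - x)\<close>, of
  squared length 4t, and Laplacian \<open>2 * DIM('a)\<close>. The set \<open>T\<close> need only
  cover the half-line from 0, so a profile may be singular at negative arguments, as powers of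
  \<open>t + e\<close> are.\<close>

lemma laplacian_radial:
  fixes x :: "'a::euclidean_space" and f f' f'' :: "real \<Rightarrow> real"
  assumes T: "open T" "{0..} \<subseteq> T"
    and f: "\<And>t. t \<in> T \<Longrightarrow> (f has_real_derivative f' t) (at t)"
    and f': "\<And>t. t \<in> T \<Longrightarrow> (f' has_real_derivative f'' t) (at t)"
  shows "laplacian (\<lambda>y. f ((norm (y - x))\<^sup>2)) y
    = 4 * (norm (y - x))\<^sup>2 * f'' ((norm (y - x))\<^sup>2) + 2 * DIM('a) * f' ((norm (y - x))\<^sup>2)"
proof -
  let ?t = "\<lambda>y. (norm (y - x))\<^sup>2"
  have t: "?t y \<in> T" for y using T(2) by auto
  have 1: "partial_deriv b (\<lambda>y. f (?t y)) = (\<lambda>y. 2 * ((y - x) \<bullet> b) * f' (?t y))" for b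
    using partial_deriv_radial(2)[OF f[OF t]] by blast
  have "partial_deriv b (partial_deriv b (\<lambda>y. f (?t y))) y
      = 4 * ((y - x) \<bullet> b)\<^sup>2 * f'' (?t y) + 2 * f' (?t y)" if "b \<in> Basis" for b
  proof -
    have "((\<lambda>y. (2 * ((y - x) \<bullet> b)) * f' (?t y)) has_derivative
      (\<lambda>h. (2 * ((y - x) \<bullet> b)) * (2 * ((y - x) \<bullet> h) * f'' (?t y)) + (2 * (h \<bullet> b)) * f' (?t y))) (at y)"
      by (rule has_derivative_mult[OF _ partial_deriv_radial(1)[OF f'[OF t]]])
        (auto intro!: derivative_eq_intros)
    from partial_deriv_eq[OF this, of b] show ?thesis
      using that unfolding 1 by (simp add: power2_eq_square)
  qed
  then have "laplacian (\<lambda>y. f (?t y)) y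
      = (\<Sum>b\<in>Basis. 4 * f'' (?t y) * (((y - x) \<bullet> b) * ((y - x) \<bullet> b)) + 2 * f' (?t y))"
    unfolding laplacian_def by (intro sum.cong refl) (simp add: power2_eq_square)
  also have "\<dots> = 4 * f'' (?t y) * ((y - x) \<bullet> (y - x)) + 2 * DIM('a) * f' (?t y)"
    unfolding euclidean_inner[of "y - x" "y - x"] by (simp add: sum.distrib sum_distrib_left)
  finally show ?thesis by (simp add: power2_norm_eq_inner)
qed

lemma test_function_on_radial:
  fixes x :: "'a::euclidean_space"
  assumes T: "open T" "{0..} \<subseteq> T" and f: "\<And>k. Ck_on k T f"
    and zero: "\<And>t. t \<ge> r\<^sup>2 \<Longrightarrow> f t = 0" and r: "r > 0" and sub: "cball x r \<subseteq> U"
  shows "test_function_on U (\<lambda>y. f ((norm (y - x))\<^sup>2))"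
proof -
  have "f ((norm (y - x))\<^sup>2) = 0" if "y \<notin> cball x r" for y
    using that r by (intro zero power_mono) (auto simp: dist_norm norm_minus_commute)
  then have c: "closure {y. f ((norm (y - x))\<^sup>2) \<noteq> 0} \<subseteq> cball x r"
    by (intro closure_minimal) (blast, simp)
  moreover have "compact (closure {y. f ((norm (y - x))\<^sup>2) \<noteq> 0})"
    using c compact_cball by (meson bounded_subset closed_closure compact_eq_bounded_closed)
  moreover have "Ck_on k UNIV (\<lambda>y. f ((norm (y - x))\<^sup>2))" for k
    by (rule Ck_on_compose[OF open_UNIV f Ck_on_norm_square]) (use T in auto)
  ultimately show ?thesis using sub by (auto simp: test_function_on_def)
qed

section \<open>Integration by parts and convolution\<close>

definition grad :: "('a::euclidean_space \<Rightarrow> real) \<Rightarrow> 'a \<Rightarrow> 'a" where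
  "grad f x = (\<Sum>b\<in>Basis. partial_deriv b f x *\<^sub>R b)"

lemma has_derivative_grad:
  assumes "f differentiable at x"
  shows "(f has_derivative (\<lambda>h. h \<bullet> grad f x)) (at x)"
  using has_derivative_partial_deriv[OF assms]
  by (simp add: grad_def inner_sum_right mult.commute)

lemma inner_grad_Basis: "b \<in> Basis \<Longrightarrow> b \<bullet> grad f x = partial_deriv b f x"
  by (simp add: grad_def inner_sum_right inner_Basis if_distrib cong: if_cong)

lemma continuous_on_grad:
  assumes "Ck_on 1 S f"
  shows "continuous_on S (grad f)"
  using assms unfolding grad_def[abs_def] One_nat_def by (auto intro!: continuous_intros)

lemma partial_deriv_eq_0:
  assumes "closed K" "\<And>y. y \<notin> K \<Longrightarrow> f y = 0" "x \<notin> K"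
  shows "partial_deriv b f x = 0"
proof -
  have "partial_deriv b f x = partial_deriv b (\<lambda>_. 0) x"
    by (rule partial_deriv_cong[of "- K"]) (use assms in auto)
  also have "\<dots> = 0" by (rule partial_deriv_eq) simp
  finally show ?thesis .
qed

lemma grad_eq_0:
  assumes "closed K" "\<And>y. y \<notin> K \<Longrightarrow> f y = 0" "x \<notin> K"
  shows "grad f x = 0"
  using partial_deriv_eq_0[OF assms] by (simp add: grad_def)

lemma uniformly_continuous_compact_support:
  fixes f :: "'a::euclidean_space \<Rightarrow> 'b::real_normed_vector"
  assumes f: "continuous_on UNIV f" and K: "compact K" "\<And>x. x \<notin> K \<Longrightarrow> f x = 0" and e: "e > 0"
  obtains d where "d > 0" "\<And>x h. norm h < d \<Longrightarrow> norm (f (x + h) - f x) < e"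
proof -
  obtain R where R: "K \<subseteq> cball 0 R"
    using bounded_subset_ballD[OF compact_imp_bounded[OF K(1)], of 0] ball_subset_cball by blast
  \<comment> \<open>The radius is enlarged by 1 and shifts are kept below 1: as soon as one of
    \<open>x\<close>, \<open>x + h\<close> leaves the larger ball, both lie outside
    \<open>K\<close>.\<close>
  have "uniformly_continuous_on (cball 0 (R + 1)) f"
    using f by (intro compact_uniformly_continuous compact_cball) (blast intro: continuous_on_subset)
  then obtain d where d: "d > 0"
    "\<And>x y. x \<in> cball 0 (R + 1) \<Longrightarrow> y \<in> cball 0 (R + 1) \<Longrightarrow> dist y x < d \<Longrightarrow> dist (f y) (f x) < e"
    using e unfolding uniformly_continuous_on_def by metis
  have "norm (f (x + h) - f x) < e" if h: "norm h < min d 1" for x h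
  proof (cases "x \<in> cball 0 (R + 1) \<and> x + h \<in> cball 0 (R + 1)")
    case True
    then show ?thesis using d(2)[of x "x + h"] h by (simp add: dist_norm)
  next
    case False
    then have "x \<notin> cball 0 R" "x + h \<notin> cball 0 R"
      using h norm_triangle_ineq[of x h] norm_triangle_ineq4[of "x + h" h] by (auto simp: not_le)
    then show ?thesis using K(2) R e by (metis diff_self norm_zero subsetD)
  qed
  then show ?thesis using that[of "min d 1"] d(1) by auto
qed

text \<open>Mean value theorem along the segment, with the gradient uniformly continuous because of
  the compact support. The same \<open>d\<close> serves all \<open>x\<close>, so the expansion may
  be integrated.\<close>

lemma C1_uniform_derivative:
  fixes f :: "'a::euclidean_space \<Rightarrow> real"
  assumes f: "Ck_on 1 UNIV f" and K: "compact K" "\<And>x. x \<notin> K \<Longrightarrow> f x = 0" and e: "e > 0"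
  obtains d where "d > 0" "\<And>x h. norm h < d \<Longrightarrow> \<bar>f (x + h) - f x - h \<bullet> grad f x\<bar> \<le> e * norm h"
proof -
  obtain d where d: "d > 0" "\<And>x h. norm h < d \<Longrightarrow> norm (grad f (x + h) - grad f x) < e"
    using uniformly_continuous_compact_support[OF continuous_on_grad[OF f] K(1)
      grad_eq_0[OF compact_imp_closed[OF K(1)] K(2)] e] by blast
  have diff: "f differentiable at x" for x using f by (simp add: One_nat_def)
  have "\<bar>f (x + h) - f x - h \<bullet> grad f x\<bar> \<le> e * norm h" if h: "norm h < d" for x h
  proof -
    have "((\<lambda>t. f (x + t *\<^sub>R h)) has_derivative (\<lambda>s. (s *\<^sub>R h) \<bullet> grad f (x + t *\<^sub>R h))) (at t within {0..1})" for t
      by (rule has_derivative_compose[OF _ has_derivative_grad[OF diff]])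
        (auto intro!: derivative_eq_intros)
    then obtain t where t: "t \<in> {0<..<1}" "f (x + h) - f x = h \<bullet> grad f (x + t *\<^sub>R h)"
      using mvt_simple[of 0 1 "\<lambda>t. f (x + t *\<^sub>R h)" "\<lambda>t s. (s *\<^sub>R h) \<bullet> grad f (x + t *\<^sub>R h)"] by auto
    have "\<bar>f (x + h) - f x - h \<bullet> grad f x\<bar> = \<bar>h \<bullet> (grad f (x + t *\<^sub>R h) - grad f x)\<bar>"
      by (simp add: t inner_diff_right)
    also have "\<dots> \<le> norm h * norm (grad f (x + t *\<^sub>R h) - grad f x)"
      by (rule Cauchy_Schwarz_ineq2)
    also have "\<dots> \<le> norm h * e"
    proof -
      have "norm (t *\<^sub>R h) \<le> norm h" using t(1) by (simp add: mult_left_le_one_le)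
      then show ?thesis using d(2)[of "t *\<^sub>R h" x] h by (intro mult_left_mono) auto
    qed
    finally show ?thesis by (simp add: mult.commute)
  qed
  then show ?thesis using that d(1) by blast
qed

lemma integrable_compact_support:
  fixes f :: "'a::euclidean_space \<Rightarrow> real"
  assumes "continuous_on UNIV f" "compact K" "\<And>x. x \<notin> K \<Longrightarrow> f x = 0"
  shows "integrable lborel f"
proof -
  have "integrable lborel (\<lambda>x. indicator K x *\<^sub>R f x)"
    using assms by (intro borel_integrable_compact) (auto intro: continuous_on_subset)
  also have "(\<lambda>x. indicator K x *\<^sub>R f x) = f" using assms(3) by (intro ext) (auto simp: indicator_def)
  finally show ?thesis .
qed

lemma bounded_compact_support:
  fixes f :: "'a::euclidean_space \<Rightarrow> real"
  assumes f: "continuous_on UNIV f" and K: "compact K" "\<And>x. x \<notin> K \<Longrightarrow> f x = 0"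
  obtains B where "\<And>x. \<bar>f x\<bar> \<le> B"
proof -
  have "bounded (f ` K)"
    by (intro compact_imp_bounded compact_continuous_image continuous_on_subset[OF f] K) simp
  then obtain B where "\<forall>y\<in>f ` K. \<bar>y\<bar> \<le> B" by (auto simp: bounded_iff)
  then have "\<bar>f x\<bar> \<le> max B 0" for x
    using K(2)[of x] by (cases "x \<in> K") (auto simp: le_max_iff_disj)
  then show ?thesis using that by blast
qed

lemma lborel_translation:
  fixes f :: "'a::euclidean_space \<Rightarrow> 'b::{banach, second_countable_topology}"
  assumes "f \<in> borel_measurable borel"
  shows "(\<integral>x. f (c + x) \<partial>lborel) = (\<integral>x. f x \<partial>lborel)"
    and "integrable lborel (\<lambda>x. f (c + x)) \<longleftrightarrow> integrable lborel f"
  using integral_distr[of "(+) c" lborel borel f] integrable_distr_eq[of "(+) c" lborel borel f] assms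
  by (simp_all add: lborel_distr_plus)

lemma mult_div_plus_1_less:
  fixes e I :: real
  assumes "e > 0" "I \<ge> 0"
  shows "e / (I + 1) * I < e"
proof -
  have "e * (I / (I + 1)) < e * 1"
    by (intro mult_strict_left_mono) (use assms in \<open>auto simp: divide_less_eq\<close>)
  then show ?thesis by simp
qed

text \<open>By translation invariance every difference quotient has integral 0, and the quotients
  converge uniformly to the partial derivative while their supports stay in one fixed ball.\<close>

lemma integral_partial_deriv_eq_0:
  fixes f :: "'a::euclidean_space \<Rightarrow> real"
  assumes f: "Ck_on 1 UNIV f" and K: "compact K" "\<And>x. x \<notin> K \<Longrightarrow> f x = 0" and b: "b \<in> Basis"
  shows "(\<integral>x. partial_deriv b f x \<partial>lborel) = 0"
proof -
  have cf: "continuous_on UNIV f" by (rule Ck_on_imp_continuous_on[OF f])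
  have [measurable]: "f \<in> borel_measurable borel" by (rule borel_measurable_continuous_onI[OF cf])
  have intf: "integrable lborel f" by (rule integrable_compact_support[OF cf K])
  have K0: "partial_deriv b f x = 0" if "x \<notin> K" for x
    by (rule partial_deriv_eq_0[OF compact_imp_closed[OF K(1)] K(2) that])
  have intp: "integrable lborel (partial_deriv b f)"
    using f b by (intro integrable_compact_support[OF _ K(1)] K0) (auto simp: One_nat_def)
  obtain R where R: "K \<subseteq> cball 0 R"
    using bounded_subset_ballD[OF compact_imp_bounded[OF K(1)], of 0] ball_subset_cball by blast
  let ?V = "measure lborel (cball (0::'a) (R + 1))"
  have bound: "\<bar>\<integral>x. partial_deriv b f x \<partial>lborel\<bar> \<le> e * ?V" if e: "e > 0" for e
  proof -
    obtain d where d: "d > 0" "\<And>x h. norm h < d \<Longrightarrow> \<bar>f (x + h) - f x - h \<bullet> grad f x\<bar> \<le> e * norm h"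
      using C1_uniform_derivative[OF f K e] by blast
    \<comment> \<open>The bound by 1 keeps the support of the shifted function inside
      \<open>cball 0 (R + 1)\<close>.\<close>
    define s where "s = min (d / 2) 1"
    have s: "s > 0" "s < d" "s \<le> 1" using d(1) by (auto simp: s_def)
    let ?q = "\<lambda>x. (f (s *\<^sub>R b + x) - f x) / s"
    have intq: "integrable lborel ?q" using intf lborel_translation(2)[of f "s *\<^sub>R b"] by auto
    have q0: "(\<integral>x. ?q x \<partial>lborel) = 0"
      using intf lborel_translation[of f "s *\<^sub>R b"] by simp
    have "\<bar>\<integral>x. partial_deriv b f x \<partial>lborel\<bar> = \<bar>\<integral>x. ?q x - partial_deriv b f x \<partial>lborel\<bar>"
      unfolding Bochner_Integration.integral_diff[OF intq intp] q0 by simp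
    also have "\<dots> \<le> (\<integral>x. \<bar>?q x - partial_deriv b f x\<bar> \<partial>lborel)" by (rule integral_abs_bound)
    also have "\<dots> \<le> (\<integral>x. indicator (cball (0::'a) (R + 1)) x *\<^sub>R e \<partial>lborel)"
    proof (rule integral_mono)
      show "integrable lborel (\<lambda>x. indicator (cball (0::'a) (R + 1)) x *\<^sub>R e)"
        by (intro borel_integrable_compact) auto
      show "\<bar>?q x - partial_deriv b f x\<bar> \<le> indicator (cball (0::'a) (R + 1)) x *\<^sub>R e" for x
      proof (cases "x \<in> cball 0 (R + 1)")
        case True
        have "\<bar>f (x + s *\<^sub>R b) - f x - s * partial_deriv b f x\<bar> \<le> e * s"
          using d(2)[of "s *\<^sub>R b" x] s b by (simp add: inner_grad_Basis)
        then have "\<bar>(f (x + s *\<^sub>R b) - f x - s * partial_deriv b f x) / s\<bar> \<le> e"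
          using s by (simp add: field_simps)
        moreover have "(f (x + s *\<^sub>R b) - f x - s * partial_deriv b f x) / s = ?q x - partial_deriv b f x"
          using s by (simp add: field_simps add.commute)
        ultimately show ?thesis using True by simp
      next
        case False
        then have "x \<notin> cball 0 R" "s *\<^sub>R b + x \<notin> cball 0 R"
          using s b norm_triangle_ineq4[of "s *\<^sub>R b + x" "s *\<^sub>R b"] by (auto simp: not_le)
        then have "x \<notin> K" "s *\<^sub>R b + x \<notin> K" using R by auto
        then show ?thesis using K K0 False by simp
      qed
    qed (use intq intp in auto)
    also have "\<dots> = e * ?V" by simp
    finally show ?thesis .
  qed
  show ?thesis
  proof (rule ccontr)
    assume n: "\<not> ?thesis"
    let ?I = "\<bar>\<integral>x. partial_deriv b f x \<partial>lborel\<bar>"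
    \<comment> \<open>With \<open>e = ?I / (?V + 1)\<close> the bound \<open>e * ?V\<close> drops
      strictly below \<open>?I\<close>; the added 1 keeps the denominator positive.\<close>
    have "?I \<le> ?I / (?V + 1) * ?V" using n by (intro bound) (auto intro!: divide_pos_pos add_nonneg_pos)
    moreover have "?I / (?V + 1) * ?V < ?I" by (rule mult_div_plus_1_less) (use n in auto)
    ultimately show False by linarith
  qed
qed

text \<open>The open sets \<open>D\<close> and \<open>- K\<close> cover the space. The product is of
  class C^k on the first and identically 0 on the second, whatever values \<open>v\<close> takes
  outside \<open>D\<close>.\<close>

lemma Ck_on_mult_compact_support:
  fixes v \<phi> :: "'a::euclidean_space \<Rightarrow> real"
  assumes D: "open D" and v: "Ck_on k D v" and \<phi>: "Ck_on k UNIV \<phi>"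
    and K: "closed K" "K \<subseteq> D" "\<And>x. x \<notin> K \<Longrightarrow> \<phi> x = 0"
  shows "Ck_on k UNIV (\<lambda>x. v x * \<phi> x)"
proof (rule Ck_on_local)
  fix x
  have "Ck_on k D (\<lambda>x. v x * \<phi> x)"
    by (intro Ck_on_mult D v Ck_on_subset[OF \<phi>]) auto
  moreover have "Ck_on k (-K) (\<lambda>x. v x * \<phi> x)"
    by (rule Ck_on_cong[OF _ _ Ck_on_const[of _ k 0]]) (use K in auto)
  ultimately show "\<exists>T. open T \<and> x \<in> T \<and> Ck_on k T (\<lambda>x. v x * \<phi> x)"
    using D K by (metis ComplI open_Compl subsetD)
qed

lemma integral_by_parts:
  fixes v \<phi> :: "'a::euclidean_space \<Rightarrow> real"
  assumes D: "open D" and v: "Ck_on 1 D v" and \<phi>: "Ck_on 1 UNIV \<phi>"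
    and K: "compact K" "K \<subseteq> D" "\<And>x. x \<notin> K \<Longrightarrow> \<phi> x = 0" and b: "b \<in> Basis"
  shows "integrable lborel (\<lambda>x. v x * partial_deriv b \<phi> x)"
    and "integrable lborel (\<lambda>x. partial_deriv b v x * \<phi> x)"
    and "(\<integral>x. v x * partial_deriv b \<phi> x \<partial>lborel) = - (\<integral>x. partial_deriv b v x * \<phi> x \<partial>lborel)"
proof -
  note cl = compact_imp_closed[OF K(1)]
  have p0: "partial_deriv b \<phi> x = 0" if "x \<notin> K" for x
    by (rule partial_deriv_eq_0[OF cl K(3) that])
  have f: "Ck_on 1 UNIV (\<lambda>x. v x * \<phi> x)"
    by (rule Ck_on_mult_compact_support[OF D v \<phi> cl K(2,3)])
  have "Ck_on 0 UNIV (\<lambda>x. v x * partial_deriv b \<phi> x)"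
    using \<phi> b by (intro Ck_on_mult_compact_support[OF D _ _ cl K(2)] p0 Ck_on_le[OF v])
      (auto simp: One_nat_def)
  then show i1: "integrable lborel (\<lambda>x. v x * partial_deriv b \<phi> x)"
    by (intro integrable_compact_support[OF _ K(1)]) (auto simp: p0)
  have "Ck_on 0 UNIV (\<lambda>x. partial_deriv b v x * \<phi> x)"
    using v b by (intro Ck_on_mult_compact_support[OF D _ _ cl K(2)] K Ck_on_le[OF \<phi>])
      (auto simp: One_nat_def)
  then show i2: "integrable lborel (\<lambda>x. partial_deriv b v x * \<phi> x)"
    by (intro integrable_compact_support[OF _ K(1)]) (auto simp: K)
  have "partial_deriv b (\<lambda>x. v x * \<phi> x) x = v x * partial_deriv b \<phi> x + partial_deriv b v x * \<phi> x" for x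
  proof (cases "x \<in> D")
    case True
    have "v differentiable at x" "\<phi> differentiable at x"
      using v \<phi> True by (auto simp: One_nat_def)
    from partial_deriv_eq[OF has_derivative_mult[OF this[THEN has_derivative_grad]], of b]
    show ?thesis by (simp add: inner_grad_Basis[OF b])
  next
    case False
    then have "x \<notin> K" using K by auto
    then show ?thesis using K(3) p0 partial_deriv_eq_0[OF cl, of "\<lambda>x. v x * \<phi> x" x] by simp
  qed
  then have "0 = (\<integral>x. v x * partial_deriv b \<phi> x + partial_deriv b v x * \<phi> x \<partial>lborel)"
    using integral_partial_deriv_eq_0[OF f K(1) _ b] K(3) by simp
  then show "(\<integral>x. v x * partial_deriv b \<phi> x \<partial>lborel) = - (\<integral>x. partial_deriv b v x * \<phi> x \<partial>lborel)"
    using i1 i2 by simp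
qed

lemma integral_convolution_bound:
  fixes f k :: "'a::euclidean_space \<Rightarrow> real"
  assumes f: "integrable lborel f" and k: "k \<in> borel_measurable borel" and B: "\<And>y. \<bar>k y\<bar> \<le> B"
  shows "integrable lborel (\<lambda>y. f y * k y)" "\<bar>\<integral>y. f y * k y \<partial>lborel\<bar> \<le> B * (\<integral>y. \<bar>f y\<bar> \<partial>lborel)"
proof -
  note [measurable] = k borel_measurable_integrable[OF f, simplified]
  have i: "integrable lborel (\<lambda>y. B * \<bar>f y\<bar>)" using f by auto
  have le: "\<bar>f y * k y\<bar> \<le> B * \<bar>f y\<bar>" for y
    using mult_right_mono[OF B[of y] abs_ge_zero[of "f y"]] by (simp add: abs_mult mult.commute)
  show i2: "integrable lborel (\<lambda>y. f y * k y)"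
    by (rule Bochner_Integration.integrable_bound[OF i]) (use le in \<open>auto intro: order.trans[OF _ abs_ge_self]\<close>)
  have "\<bar>\<integral>y. f y * k y \<partial>lborel\<bar> \<le> (\<integral>y. \<bar>f y * k y\<bar> \<partial>lborel)" by (rule integral_abs_bound)
  also have "\<dots> \<le> (\<integral>y. B * \<bar>f y\<bar> \<partial>lborel)" by (rule integral_mono) (use i i2 le in auto)
  finally show "\<bar>\<integral>y. f y * k y \<partial>lborel\<bar> \<le> B * (\<integral>y. \<bar>f y\<bar> \<partial>lborel)" by simp
qed

text \<open>All derivatives fall on the kernel, so \<open>f\<close> need only be integrable: the
  errors in \<open>K\<close> are uniform and get multiplied by the integral of
  \<open>\<bar>f\<bar>\<close>.\<close>

lemma Ck_on_convolution:
  fixes f K :: "'a::euclidean_space \<Rightarrow> real"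
  assumes f: "integrable lborel f" and "Ck_on k UNIV K" and C: "compact C" "\<And>x. x \<notin> C \<Longrightarrow> K x = 0"
  shows "Ck_on k UNIV (\<lambda>x. \<integral>y. f y * K (y - x) \<partial>lborel)"
  using assms(2) C(2)
proof (induction k arbitrary: K)
  case 0
  then have cK: "continuous_on UNIV K" by simp
  have [measurable]: "K \<in> borel_measurable borel" by (rule borel_measurable_continuous_onI[OF cK])
  obtain B where B: "\<And>y. \<bar>K y\<bar> \<le> B"
    using bounded_compact_support[OF cK C(1) 0(2)] by blast
  let ?I = "\<integral>y. \<bar>f y\<bar> \<partial>lborel"
  have I: "?I \<ge> 0" by simp
  have i: "integrable lborel (\<lambda>y. f y * K (y - x))" for x
    by (rule integral_convolution_bound[OF f _ B]) auto
  show ?case unfolding Ck_on.simps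
  proof (rule continuous_at_imp_continuous_on, intro ballI)
    fix x
    show "isCont (\<lambda>x. \<integral>y. f y * K (y - x) \<partial>lborel) x"
      unfolding continuous_at_eps_delta
    proof (intro allI impI)
      fix e :: real assume e: "e > 0"
      then obtain d where d: "d > 0" "\<And>x h. norm h < d \<Longrightarrow> norm (K (x + h) - K x) < e / (?I + 1)"
        using uniformly_continuous_compact_support[OF cK C(1) 0(2), of "e / (?I + 1)"] I by auto
      have "dist (\<integral>y. f y * K (y - x') \<partial>lborel) (\<integral>y. f y * K (y - x) \<partial>lborel) < e" if "dist x' x < d" for x'
      proof -
        have "\<bar>K (y - x') - K (y - x)\<bar> \<le> e / (?I + 1)" for y
          using d(2)[of "x - x'" "y - x"] that by (simp add: dist_norm norm_minus_commute)
        then have "\<bar>\<integral>y. f y * (K (y - x') - K (y - x)) \<partial>lborel\<bar> \<le> e / (?I + 1) * ?I"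
          by (intro integral_convolution_bound(2)[OF f]) auto
        also have "\<dots> < e" by (rule mult_div_plus_1_less[OF e I])
        finally show ?thesis using i by (simp add: dist_real_def right_diff_distrib)
      qed
      then show "\<exists>d>0. \<forall>x'. dist x' x < d \<longrightarrow>
        dist (\<integral>y. f y * K (y - x') \<partial>lborel) (\<integral>y. f y * K (y - x) \<partial>lborel) < e"
        using d(1) by blast
    qed
  qed
next
  case (Suc k)
  have K1: "Ck_on 1 UNIV K" by (rule Ck_on_le[OF Suc.prems(1)]) simp
  have cK: "continuous_on UNIV K" by (rule Ck_on_imp_continuous_on[OF K1])
  have p0: "partial_deriv b K x = 0" if "x \<notin> C" for x b
    by (rule partial_deriv_eq_0[OF compact_imp_closed[OF C(1)] Suc.prems(2) that])
  have i0: "integrable lborel (\<lambda>y. f y * g (y - x))"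
    if g: "continuous_on UNIV g" "\<And>x. x \<notin> C \<Longrightarrow> g x = 0" for g x
  proof -
    have [measurable]: "g \<in> borel_measurable borel" by (rule borel_measurable_continuous_onI[OF g(1)])
    obtain B where B: "\<And>y. \<bar>g y\<bar> \<le> B" using bounded_compact_support[OF g(1) C(1) g(2)] by blast
    show ?thesis by (rule integral_convolution_bound(1)[OF f _ B]) auto
  qed
  have cp: "continuous_on UNIV (partial_deriv b K)" if "b \<in> Basis" for b
    using K1 that by (simp add: One_nat_def)
  let ?I = "\<integral>y. \<bar>f y\<bar> \<partial>lborel"
  have I: "?I \<ge> 0" by simp
  \<comment> \<open>The minus sign arises because \<open>x\<close> enters the kernel through
    \<open>y - x\<close>.\<close>
  let ?D = "\<lambda>x b. - (\<integral>y. f y * partial_deriv b K (y - x) \<partial>lborel)"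
  have ig: "integrable lborel (\<lambda>y. f y * (h \<bullet> grad K (y - x)))"
    and eg: "(\<integral>y. f y * (h \<bullet> grad K (y - x)) \<partial>lborel) = - (\<Sum>b\<in>Basis. (h \<bullet> b) * ?D x b)" for x h
  proof -
    have "f y * (h \<bullet> grad K (y - x)) = (\<Sum>b\<in>Basis. (h \<bullet> b) * (f y * partial_deriv b K (y - x)))" for y
      by (simp add: grad_def inner_sum_right sum_distrib_left mult_ac)
    then show "integrable lborel (\<lambda>y. f y * (h \<bullet> grad K (y - x)))"
      "(\<integral>y. f y * (h \<bullet> grad K (y - x)) \<partial>lborel) = - (\<Sum>b\<in>Basis. (h \<bullet> b) * ?D x b)"
      using i0[OF cp p0] by (simp_all add: sum_negf)
  qed
  have mg: "(\<lambda>y. grad K (y - x)) \<in> borel_measurable borel" for x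
    by (intro borel_measurable_continuous_onI continuous_on_compose2[OF continuous_on_grad[OF K1]])
      (auto intro!: continuous_intros)
  have mK[measurable]: "K \<in> borel_measurable borel" by (rule borel_measurable_continuous_onI[OF cK])
  show ?case
  proof (rule Ck_on_SucI)
    fix x :: 'a
    show "((\<lambda>x. \<integral>y. f y * K (y - x) \<partial>lborel) has_derivative (\<lambda>h. \<Sum>b\<in>Basis. (h \<bullet> b) * ?D x b)) (at x)"
      unfolding has_derivative_at_alt
    proof (intro conjI allI impI)
      show "bounded_linear (\<lambda>h. \<Sum>b\<in>Basis. (h \<bullet> b) * ?D x b)"
        by (intro bounded_linear_sum bounded_linear_mult_left bounded_linear_compose[OF bounded_linear_mult_left] bounded_linear_inner_left)
      fix e :: real assume e: "e > 0"
      then obtain d where d: "d > 0"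
        "\<And>x h. norm h < d \<Longrightarrow> \<bar>K (x + h) - K x - h \<bullet> grad K x\<bar> \<le> e / (?I + 1) * norm h"
        using C1_uniform_derivative[OF K1 C(1) Suc.prems(2), of "e / (?I + 1)"] I by auto
      have "norm ((\<integral>y. f y * K (y - x') \<partial>lborel) - (\<integral>y. f y * K (y - x) \<partial>lborel)
          - (\<Sum>b\<in>Basis. ((x' - x) \<bullet> b) * ?D x b)) \<le> e * norm (x' - x)"
        if x': "norm (x' - x) < d" for x'
      proof -
        \<comment> \<open>The remainder of the first-order expansion of \<open>K\<close> at
          \<open>y - x\<close> with increment \<open>x - x'\<close>.\<close>
        let ?k = "\<lambda>y. K (y - x') - K (y - x) - (x - x') \<bullet> grad K (y - x)"
        have k: "\<bar>?k y\<bar> \<le> e / (?I + 1) * norm (x' - x)" for y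
          using d(2)[of "x - x'" "y - x"] x' by (simp add: norm_minus_commute)
        have e1: "(\<Sum>b\<in>Basis. ((x' - x) \<bullet> b) * ?D x b) = (\<integral>y. f y * ((x - x') \<bullet> grad K (y - x)) \<partial>lborel)"
          unfolding eg by (simp add: inner_diff_left sum_negf[symmetric] algebra_simps sum_subtractf)
        have "(\<integral>y. f y * ?k y \<partial>lborel) = (\<integral>y. f y * K (y - x') \<partial>lborel) - (\<integral>y. f y * K (y - x) \<partial>lborel)
          - (\<Sum>b\<in>Basis. ((x' - x) \<bullet> b) * ?D x b)"
          unfolding e1 right_diff_distrib using i0[OF cK Suc.prems(2)] ig by simp
        moreover have "\<bar>\<integral>y. f y * ?k y \<partial>lborel\<bar> \<le> e / (?I + 1) * norm (x' - x) * ?I"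
          by (rule integral_convolution_bound(2)[OF f _ k]) (use mg in measurable)
        moreover have "e / (?I + 1) * norm (x' - x) * ?I \<le> e * norm (x' - x)"
        proof -
          from mult_right_mono[OF less_imp_le[OF mult_div_plus_1_less[OF e I]] norm_ge_zero[of "x' - x"]] show ?thesis by (simp add: mult_ac)
        qed
        ultimately show ?thesis by simp
      qed
      then show "\<exists>d>0. \<forall>x'. norm (x' - x) < d \<longrightarrow>
        norm ((\<integral>y. f y * K (y - x') \<partial>lborel) - (\<integral>y. f y * K (y - x) \<partial>lborel)
          - (\<Sum>b\<in>Basis. ((x' - x) \<bullet> b) * ?D x b)) \<le> e * norm (x' - x)"
        using d(1) by blast
    qed
  next
    fix b :: 'a assume b: "b \<in> Basis"
    have "Ck_on k UNIV (\<lambda>x. \<integral>y. f y * partial_deriv b K (y - x) \<partial>lborel)"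
      using Suc.prems b by (intro Suc.IH p0) auto
    then have "Ck_on k UNIV (\<lambda>x. (-1) * (\<integral>y. f y * partial_deriv b K (y - x) \<partial>lborel))"
      by (intro Ck_on_mult Ck_on_const) auto
    moreover have "(\<Sum>b'\<in>Basis. (b \<bullet> b') * ?D x b') = (-1) * (\<integral>y. f y * partial_deriv b K (y - x) \<partial>lborel)" for x
    proof -
      have "(\<Sum>b'\<in>Basis. (b \<bullet> b') * ?D x b') = (\<Sum>b'\<in>Basis. if b' = b then ?D x b else 0)"
        using b by (intro sum.cong) (auto simp: inner_Basis)
      then show ?thesis using b by simp
    qed
    ultimately show "Ck_on k UNIV (\<lambda>x. \<Sum>b'\<in>Basis. (b \<bullet> b') * ?D x b')" by simp
  qed auto
qed

section \<open>Polar coordinates and the mean flux\<close>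

lemma lborel_scale:
  fixes f :: "'a::euclidean_space \<Rightarrow> real"
  assumes [measurable]: "f \<in> borel_measurable borel" and r: "r > 0"
  shows "(\<integral>y. f y \<partial>lborel) = r ^ DIM('a) * (\<integral>w. f (x + r *\<^sub>R w) \<partial>lborel)"
  by (subst lborel_affine[of r x]) (use r in \<open>simp_all add: integral_density integral_distr\<close>)

lemma nn_integral_lborel_scale:
  fixes f :: "'a::euclidean_space \<Rightarrow> ennreal"
  assumes [measurable]: "f \<in> borel_measurable borel" and r: "r > 0"
  shows "(\<integral>\<^sup>+y. f y \<partial>lborel) = (\<integral>\<^sup>+w. ennreal (r ^ DIM('a)) * f (r *\<^sub>R w) \<partial>lborel)"
  by (subst lborel_affine[of r 0]) (use r in \<open>simp_all add: nn_integral_density nn_integral_distr\<close>)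

lemma borel_measurable_sgn_vector [measurable]:
  "(sgn :: 'a::euclidean_space \<Rightarrow> 'a) \<in> borel_measurable borel"
  unfolding sgn_div_norm[abs_def] by measurable

lemma measurable_mem_greaterThan [measurable (raw)]:
  fixes f g :: "'a \<Rightarrow> real"
  assumes [measurable]: "f \<in> borel_measurable M" "g \<in> borel_measurable M"
  shows "Measurable.pred M (\<lambda>x. f x \<in> {g x<..})"
  unfolding greaterThan_iff by measurable

text \<open>The integrand has the antiderivative -(a/t)^m on the half-line. It is a probability
  density, used to integrate out an auxiliary radius in the polar coordinate formula.\<close>

lemma nn_integral_radial_tail:
  assumes a: "a > 0" and m: "m > 0"
  shows "(\<integral>\<^sup>+t. indicator {a<..} t * ennreal (m * a ^ m / t ^ Suc m) \<partial>lborel) = 1"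
proof -
  have "(\<integral>\<^sup>+t. indicator {a<..} t * ennreal (m * a ^ m / t ^ Suc m) \<partial>lborel)
      = (\<integral>\<^sup>+t. ennreal (m * a ^ m / t ^ Suc m) * indicator {a..} t \<partial>lborel)"
    by (rule nn_integral_cong_AE, rule AE_mp[OF AE_lborel_singleton[of a]])
      (auto simp: indicator_def)
  also have "\<dots> = ennreal (0 - (- (a ^ m / a ^ m)))"
  proof (rule nn_integral_FTC_atLeast[where F="\<lambda>t. - (a ^ m / t ^ m)"])
    show "((\<lambda>t. - (a ^ m / t ^ m)) has_real_derivative m * a ^ m / t ^ Suc m) (at t)" if "a \<le> t" for t
    proof -
      have "t > 0" using a that by simp
      then have "((\<lambda>t. - (a ^ m / t ^ m)) has_real_derivative a ^ m * (m * t ^ (m - 1)) / (t ^ m * t ^ m)) (at t)"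
        by (auto intro!: derivative_eq_intros)
      moreover have "a ^ m * (m * t ^ (m - 1)) / (t ^ m * t ^ m) = m * a ^ m / t ^ Suc m"
        using \<open>t > 0\<close> m by (cases m) (auto simp: field_simps)
      ultimately show ?thesis by simp
    qed
    have "((\<lambda>t. a ^ m * inverse t ^ m) \<longlongrightarrow> a ^ m * 0 ^ m) at_top"
      by (intro tendsto_intros tendsto_inverse_0_at_top filterlim_ident)
    then have "((\<lambda>t. a ^ m / t ^ m) \<longlongrightarrow> 0) at_top"
      using m by (simp add: power_inverse divide_inverse zero_power)
    from tendsto_minus[OF this] show "((\<lambda>t. - (a ^ m / t ^ m)) \<longlongrightarrow> 0) at_top" by simp
  qed (use a in auto)
  finally show ?thesis using a by simp
qed

text \<open>The direction is taken as \<open>sgn w\<close> with \<open>w\<close> in the unit ball,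
  which is how \<open>sphere_measure\<close> encodes the surface measure. Tonelli's theorem and
  linear substitutions in one variable at a time suffice.\<close>

lemma nn_integral_polar:
  fixes f :: "'a::euclidean_space \<Rightarrow> ennreal"
  assumes [measurable]: "f \<in> borel_measurable borel"
  shows "(\<integral>\<^sup>+z. f z \<partial>lborel) = (\<integral>\<^sup>+s. \<integral>\<^sup>+w. indicator {0<..} s * indicator (ball 0 1) w
      * ennreal (DIM('a) * s ^ (DIM('a) - 1)) * f (s *\<^sub>R sgn w) \<partial>lborel \<partial>lborel)" (is "_ = ?R")
proof -
  let ?m = "DIM('a)"
  have [measurable]: "ball (0::'a) 1 \<in> sets borel" by simp
  have "?R = (\<integral>\<^sup>+w. \<integral>\<^sup>+s. indicator {0<..} s * indicator (ball 0 1) (w::'a)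
      * ennreal (?m * s ^ (?m - 1)) * f (s *\<^sub>R sgn w) \<partial>lborel \<partial>lborel)"
    by (rule lborel_pair.Fubini') measurable
  \<comment> \<open>For fixed \<open>w\<close> the radius \<open>s\<close> is replaced by
    \<open>norm w * s\<close>, so that the argument \<open>s *\<^sub>R sgn w\<close> becomes
    \<open>s *\<^sub>R w\<close>, linear in \<open>w\<close>.\<close>
  also have "\<dots> = (\<integral>\<^sup>+w. \<integral>\<^sup>+s. indicator {0<..} s * indicator (ball 0 1) (w::'a)
      * ennreal (?m * norm w ^ ?m * s ^ (?m - 1)) * f (s *\<^sub>R w) \<partial>lborel \<partial>lborel)"
  proof (rule nn_integral_cong_AE, rule AE_mp[OF AE_lborel_singleton[of 0]], rule AE_I2, rule impI)
    fix w :: 'a assume w: "w \<noteq> 0"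
    have "(\<integral>\<^sup>+s. indicator {0<..} s * indicator (ball 0 1) w
        * ennreal (?m * s ^ (?m - 1)) * f (s *\<^sub>R sgn w) \<partial>lborel)
      = ennreal (norm w) * (\<integral>\<^sup>+s. indicator {0<..} (0 + norm w * s) * indicator (ball 0 1) w
        * ennreal (?m * (0 + norm w * s) ^ (?m - 1)) * f ((0 + norm w * s) *\<^sub>R sgn w) \<partial>lborel)"
      using w by (subst nn_integral_real_affine[where c="norm w" and t=0]) auto
    also have "\<dots> = (\<integral>\<^sup>+s. ennreal (norm w) * (indicator {0<..} (0 + norm w * s) * indicator (ball 0 1) w
        * ennreal (?m * (0 + norm w * s) ^ (?m - 1)) * f ((0 + norm w * s) *\<^sub>R sgn w)) \<partial>lborel)"
      by (rule nn_integral_cmult[symmetric]) measurable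
    also have "\<dots> = (\<integral>\<^sup>+s. indicator {0<..} s * indicator (ball 0 1) w
      * ennreal (?m * norm w ^ ?m * s ^ (?m - 1)) * f (s *\<^sub>R w) \<partial>lborel)"
    proof (rule nn_integral_cong)
      fix s :: real
      have p: "norm w ^ ?m = norm w * norm w ^ (?m - 1)" by (simp flip: power_Suc)
      have "ennreal (norm w) * ennreal (?m * (norm w * s) ^ (?m - 1)) = ennreal (?m * norm w ^ ?m * s ^ (?m - 1))" if "s > 0"
        using that by (subst ennreal_mult[symmetric]) (auto simp: p power_mult_distrib algebra_simps)
      moreover have "(norm w * s) *\<^sub>R sgn w = s *\<^sub>R w"
        using w by (simp add: sgn_div_norm)
      moreover have "0 < norm w * s \<longleftrightarrow> 0 < s" using w by (simp add: zero_less_mult_iff)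
      ultimately show "ennreal (norm w) * (indicator {0<..} (0 + norm w * s) * indicator (ball 0 1) w
        * ennreal (?m * (0 + norm w * s) ^ (?m - 1)) * f ((0 + norm w * s) *\<^sub>R sgn w))
        = indicator {0<..} s * indicator (ball 0 1) w * ennreal (?m * norm w ^ ?m * s ^ (?m - 1)) * f (s *\<^sub>R w)"
        by (auto simp: indicator_def mult.assoc[symmetric])
    qed
    finally show "(\<integral>\<^sup>+s. indicator {0<..} s * indicator (ball 0 1) w
        * ennreal (?m * s ^ (?m - 1)) * f (s *\<^sub>R sgn w) \<partial>lborel)
      = (\<integral>\<^sup>+s. indicator {0<..} s * indicator (ball 0 1) w
      * ennreal (?m * norm w ^ ?m * s ^ (?m - 1)) * f (s *\<^sub>R w) \<partial>lborel)" .
  qed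
  also have "\<dots> = (\<integral>\<^sup>+s. \<integral>\<^sup>+w. indicator {0<..} s * indicator (ball 0 1) (w::'a)
      * ennreal (?m * norm w ^ ?m * s ^ (?m - 1)) * f (s *\<^sub>R w) \<partial>lborel \<partial>lborel)"
    by (rule lborel_pair.Fubini'[symmetric]) measurable
  \<comment> \<open>For fixed \<open>s\<close> the substitution \<open>z = s *\<^sub>R w\<close>;
    the condition \<open>norm w < 1\<close> becomes \<open>norm z < s\<close>.\<close>
  also have "\<dots> = (\<integral>\<^sup>+s. \<integral>\<^sup>+z. indicator {norm z<..} s * ennreal (?m * norm z ^ ?m / s ^ Suc ?m) * f (z::'a) \<partial>lborel \<partial>lborel)"
  proof (rule nn_integral_cong)
    fix s :: real
    show "(\<integral>\<^sup>+w. indicator {0<..} s * indicator (ball 0 1) (w::'a)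
      * ennreal (?m * norm w ^ ?m * s ^ (?m - 1)) * f (s *\<^sub>R w) \<partial>lborel)
      = (\<integral>\<^sup>+z. indicator {norm z<..} s * ennreal (?m * norm z ^ ?m / s ^ Suc ?m) * f (z::'a) \<partial>lborel)"
    proof (cases "s > 0")
      case True
      have p: "s ^ ?m = s * s ^ (?m - 1)" by (simp flip: power_Suc)
      have q: "s ^ ?m * (?m * norm (s *\<^sub>R w) ^ ?m / s ^ Suc ?m) = ?m * norm w ^ ?m * s ^ (?m - 1)" for w :: 'a
        using True unfolding power_Suc p by (simp add: power_mult_distrib p)
      have "(\<integral>\<^sup>+z. indicator {norm z<..} s * ennreal (?m * norm z ^ ?m / s ^ Suc ?m) * f (z::'a) \<partial>lborel)
        = (\<integral>\<^sup>+w. ennreal (s ^ ?m) * (indicator {norm (s *\<^sub>R w)<..} s * ennreal (?m * norm (s *\<^sub>R w) ^ ?m / s ^ Suc ?m) * f (s *\<^sub>R w :: 'a)) \<partial>lborel)"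
        by (rule nn_integral_lborel_scale[OF _ True]) measurable
      also have "\<dots> = (\<integral>\<^sup>+w. indicator {0<..} s * indicator (ball 0 1) (w::'a)
        * ennreal (?m * norm w ^ ?m * s ^ (?m - 1)) * f (s *\<^sub>R w) \<partial>lborel)"
      proof (rule nn_integral_cong)
        fix w :: 'a
        have i: "indicator {norm (s *\<^sub>R w)<..} s = (indicator (ball 0 1) w :: ennreal)"
          using True by (auto simp: indicator_def)
        have e: "ennreal (s ^ ?m) * ennreal (?m * norm (s *\<^sub>R w) ^ ?m / s ^ Suc ?m)
            = ennreal (?m * norm w ^ ?m * s ^ (?m - 1))"
          using True by (subst ennreal_mult[symmetric]) (simp_all only: q, auto)
        have "ennreal (s ^ ?m) * (indicator {norm (s *\<^sub>R w)<..} s * ennreal (?m * norm (s *\<^sub>R w) ^ ?m / s ^ Suc ?m) * f (s *\<^sub>R w))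
          = indicator {norm (s *\<^sub>R w)<..} s * (ennreal (s ^ ?m) * ennreal (?m * norm (s *\<^sub>R w) ^ ?m / s ^ Suc ?m)) * f (s *\<^sub>R w)"
          by (simp only: mult_ac)
        then show "ennreal (s ^ ?m) * (indicator {norm (s *\<^sub>R w)<..} s * ennreal (?m * norm (s *\<^sub>R w) ^ ?m / s ^ Suc ?m) * f (s *\<^sub>R w))
          = indicator {0<..} s * indicator (ball 0 1) w * ennreal (?m * norm w ^ ?m * s ^ (?m - 1)) * f (s *\<^sub>R w)"
          unfolding i e using True by simp
      qed
      finally show ?thesis by simp
    next
      case False
      then have "\<not> norm z < s" for z :: 'a using norm_ge_zero[of z] by linarith
      then show ?thesis using False by (simp add: indicator_def)
    qed
  qed
  also have "\<dots> = (\<integral>\<^sup>+z. \<integral>\<^sup>+s. indicator {norm z<..} s * ennreal (?m * norm z ^ ?m / s ^ Suc ?m) * f (z::'a) \<partial>lborel \<partial>lborel)"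
    by (rule lborel_pair.Fubini') measurable
  \<comment> \<open>For fixed nonzero \<open>z\<close> the remaining weight in \<open>s\<close> is
    the density of \<open>nn_integral_radial_tail\<close> with \<open>a = norm z\<close>.\<close>
  also have "\<dots> = (\<integral>\<^sup>+z. f z \<partial>lborel)"
  proof (rule nn_integral_cong_AE, rule AE_mp[OF AE_lborel_singleton[of 0]], rule AE_I2, rule impI)
    fix z :: 'a assume z: "z \<noteq> 0"
    have "(\<integral>\<^sup>+s. indicator {norm z<..} s * ennreal (?m * norm z ^ ?m / s ^ Suc ?m) * f z \<partial>lborel)
      = (\<integral>\<^sup>+s. indicator {norm z<..} s * ennreal (?m * norm z ^ ?m / s ^ Suc ?m) \<partial>lborel) * f z"
      by (rule nn_integral_multc) measurable
    then show "(\<integral>\<^sup>+s. indicator {norm z<..} s * ennreal (?m * norm z ^ ?m / s ^ Suc ?m) * f z \<partial>lborel) = f z"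
      using nn_integral_radial_tail[of "norm z" ?m] z by simp
  qed
  finally show ?thesis by simp
qed

text \<open>As an identity of measures the polar formula passes to integrals of signed functions
  through \<open>distr\<close> and \<open>density\<close>.\<close>

lemma lborel_polar:
  "(lborel :: 'a::euclidean_space measure)
    = distr (density (lborel \<Otimes>\<^sub>M lborel) (\<lambda>(s::real, w::'a). indicator {0<..} s * indicator (ball 0 1) w
      * ennreal (DIM('a) * s ^ (DIM('a) - 1)))) borel (\<lambda>(s::real, w::'a). s *\<^sub>R sgn w)" (is "_ = ?M")
proof (rule measure_eqI)
  fix A :: "'a set" assume "A \<in> sets lborel"
  then have [measurable]: "A \<in> sets borel" by simp
  have [measurable]: "ball (0::'a) 1 \<in> sets borel" by simp
  let ?T = "\<lambda>(s::real, w::'a). s *\<^sub>R sgn w"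
  let ?\<rho> = "\<lambda>(s::real, w::'a). indicator {0<..} s * indicator (ball 0 1) w * ennreal (DIM('a) * s ^ (DIM('a) - 1))"
  have [measurable]: "?\<rho> \<in> borel_measurable (lborel \<Otimes>\<^sub>M lborel)" by measurable
  have T[measurable]: "?T \<in> lborel \<Otimes>\<^sub>M lborel \<rightarrow>\<^sub>M borel" by measurable
  have TA: "?T -` A \<inter> space (lborel \<Otimes>\<^sub>M lborel) \<in> sets (lborel \<Otimes>\<^sub>M lborel)"
    by (rule measurable_sets[OF T]) simp
  have "emeasure ?M A = emeasure (density (lborel \<Otimes>\<^sub>M lborel) ?\<rho>) (?T -` A \<inter> space (lborel \<Otimes>\<^sub>M lborel))"
    using T by (subst emeasure_distr) auto
  also have "\<dots> = (\<integral>\<^sup>+p. ?\<rho> p * indicator (?T -` A \<inter> space (lborel \<Otimes>\<^sub>M lborel)) p \<partial>(lborel \<Otimes>\<^sub>M lborel))"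
    by (rule emeasure_density[OF _ TA]) measurable
  also have "\<dots> = (\<integral>\<^sup>+p. ?\<rho> p * indicator A (?T p) \<partial>(lborel \<Otimes>\<^sub>M lborel))"
    by (rule nn_integral_cong) (auto simp: indicator_def)
  also have "\<dots> = (\<integral>\<^sup>+s. \<integral>\<^sup>+w. ?\<rho> (s, w) * indicator A (?T (s, w)) \<partial>lborel \<partial>lborel)"
    by (rule lborel.nn_integral_fst[symmetric]) measurable
  also have "\<dots> = (\<integral>\<^sup>+z. indicator A z \<partial>lborel)"
    by (subst nn_integral_polar) auto
  finally show "emeasure lborel A = emeasure ?M A" by simp
qed simp

lemma integral_polar:
  fixes f :: "'a::euclidean_space \<Rightarrow> real"
  assumes f: "integrable lborel f"
  shows "integrable lborel (\<lambda>s. indicator {0<..} s * (DIM('a) * s ^ (DIM('a) - 1))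
      * (\<integral>w. indicator (ball 0 1) w * f (s *\<^sub>R sgn w) \<partial>lborel))" (is "integrable _ ?h")
    and "(\<integral>z. f z \<partial>lborel) = (\<integral>s. indicator {0<..} s * (DIM('a) * s ^ (DIM('a) - 1))
      * (\<integral>w. indicator (ball 0 1) w * f (s *\<^sub>R sgn w) \<partial>lborel) \<partial>lborel)"
proof -
  have [measurable]: "f \<in> borel_measurable borel" using borel_measurable_integrable[OF f] by simp
  have [measurable]: "ball (0::'a) 1 \<in> sets borel" by simp
  let ?P = "lborel \<Otimes>\<^sub>M lborel :: (real \<times> 'a) measure"
  let ?\<rho> = "\<lambda>p :: real \<times> 'a. indicator {0<..} (fst p) * indicator (ball 0 1) (snd p) * (DIM('a) * fst p ^ (DIM('a) - 1)) :: real"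
  have \<rho>0: "?\<rho> p \<ge> 0" for p by (auto simp: indicator_def)
  have "(\<lambda>(s::real, w::'a). indicator {0<..} s * indicator (ball 0 1) w * ennreal (DIM('a) * s ^ (DIM('a) - 1)))
      = (\<lambda>p. ennreal (?\<rho> p))"
    by (auto simp: indicator_def)
  then have L: "lborel = distr (density ?P (\<lambda>p. ennreal (?\<rho> p))) borel (\<lambda>p. fst p *\<^sub>R sgn (snd p))"
    using lborel_polar[where 'a='a] by (simp add: case_prod_beta')
  have m1: "(\<lambda>p. fst p *\<^sub>R sgn (snd p)) \<in> density ?P (\<lambda>p. ennreal (?\<rho> p)) \<rightarrow>\<^sub>M borel" by measurable
  have "integrable (distr (density ?P (\<lambda>p. ennreal (?\<rho> p))) borel (\<lambda>p. fst p *\<^sub>R sgn (snd p))) f"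
    using f L by simp
  then have "integrable (density ?P (\<lambda>p. ennreal (?\<rho> p))) (\<lambda>p. f (fst p *\<^sub>R sgn (snd p)))"
    by (subst (asm) integrable_distr_eq) (use m1 in auto)
  then have i: "integrable ?P (\<lambda>p. ?\<rho> p * f (fst p *\<^sub>R sgn (snd p)))"
    by (subst (asm) integrable_density) (use \<rho>0 in auto)
  have h: "(\<integral>w. ?\<rho> (s, w) * f (fst (s, w) *\<^sub>R sgn (snd (s, w))) \<partial>lborel) = ?h s" for s
  proof -
    have "(\<integral>w. ?\<rho> (s, w) * f (fst (s, w) *\<^sub>R sgn (snd (s, w))) \<partial>lborel)
      = (\<integral>w. (indicator {0<..} s * (DIM('a) * s ^ (DIM('a) - 1))) * (indicator (ball 0 1) w * f (s *\<^sub>R sgn w)) \<partial>lborel)"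
      by (rule Bochner_Integration.integral_cong) (auto simp: mult_ac)
    then show ?thesis by simp
  qed
  have "(\<integral>z. f z \<partial>lborel) = (\<integral>p. ?\<rho> p * f (fst p *\<^sub>R sgn (snd p)) \<partial>?P)"
    by (subst L, subst integral_distr, use m1 in simp, simp, subst integral_density) (use \<rho>0 in auto)
  also have "\<dots> = (\<integral>s. \<integral>w. ?\<rho> (s, w) * f (fst (s, w) *\<^sub>R sgn (snd (s, w))) \<partial>lborel \<partial>lborel)"
    by (rule lborel_pair.integral_fst'[OF i, symmetric])
  finally show "(\<integral>z. f z \<partial>lborel) = (\<integral>s. ?h s \<partial>lborel)" unfolding h .
  show "integrable lborel ?h" using lborel_pair.integrable_fst'[OF i] unfolding h .
qed

text \<open>Scaling the ball to the unit ball produces r^m times the density m/r of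
  \<open>sphere_measure\<close>; dividing by the sphere area leaves the mean, over the unit ball, of
  the radial derivative at distance \<open>r\<close> in direction \<open>sgn w\<close>.\<close>

lemma mean_flux_eq:
  fixes v :: "'a::euclidean_space \<Rightarrow> real"
  assumes D: "open D" and v: "Ck_on 1 D v" and r: "r > 0" and sub: "sphere x r \<subseteq> D"
  shows "mean_flux v x r
    = (\<integral>w. indicator (ball 0 1) w * (sgn w \<bullet> grad v (x + r *\<^sub>R sgn w)) \<partial>lborel) / unit_ball_vol DIM('a)"
proof -
  let ?m = "DIM('a)"
  let ?g = "\<lambda>y. ((1 / r) *\<^sub>R (y - x)) \<bullet> grad v y"
  let ?B = "ball x r - {x}"
  let ?p = "\<lambda>y. x + (r / norm (y - x)) *\<^sub>R (y - x)"
  have "continuous_on (sphere x r) ?g"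
    by (intro continuous_intros continuous_on_subset[OF continuous_on_grad[OF v] sub])
  then have g[measurable]: "?g \<in> borel_measurable (restrict_space borel (sphere x r))"
    by (rule borel_measurable_continuous_on_restrict)
  have p[measurable]: "?p \<in> restrict_space lborel ?B \<rightarrow>\<^sub>M restrict_space borel (sphere x r)"
    by (rule measurable_radial_projection[OF r])
  have eq: "frechet_derivative v (at y) ((1 / r) *\<^sub>R (y - x)) = ?g y" if "y \<in> sphere x r" for y
  proof -
    have "v differentiable at y" using v sub that by (auto simp: One_nat_def)
    from frechet_derivative_at[OF has_derivative_grad[OF this]] show ?thesis by metis
  qed
  have "(LINT y|sphere_measure x r. frechet_derivative v (at y) ((1 / r) *\<^sub>R (y - x)))
      = (LINT y|sphere_measure x r. ?g y)"
    by (rule Bochner_Integration.integral_cong)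
      (use eq in \<open>auto simp: sphere_measure_def space_restrict_space\<close>)
  also have "\<dots> = (LINT y|density (restrict_space lborel ?B) (\<lambda>_. ennreal (real ?m / r)). ?g (?p y))"
    unfolding sphere_measure_def by (rule integral_distr) (use p g in auto)
  also have "\<dots> = (LINT y|restrict_space lborel ?B. (?m / r) *\<^sub>R ?g (?p y))"
    by (rule integral_density) (use r measurable_compose[OF p g] in auto)
  also have "\<dots> = (\<integral>y. indicator ?B y *\<^sub>R ((?m / r) *\<^sub>R ?g (?p y)) \<partial>lborel)"
    by (rule integral_restrict_space) auto
  also have "\<dots> = r ^ ?m * (\<integral>w. indicator ?B (x + r *\<^sub>R w) *\<^sub>R ((?m / r) *\<^sub>R ?g (?p (x + r *\<^sub>R w))) \<partial>lborel)"
  proof (rule lborel_scale[OF _ r])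
    have "(\<lambda>y. (?m / r) *\<^sub>R ?g (?p y)) \<in> borel_measurable (restrict_space lborel ?B)"
      using measurable_compose[OF p g] by measurable
    then show "(\<lambda>y. indicator ?B y *\<^sub>R ((?m / r) *\<^sub>R ?g (?p y))) \<in> borel_measurable borel"
      by (subst (asm) borel_measurable_restrict_space_iff) (auto simp: mult.commute)
  qed
  also have "(\<integral>w. indicator ?B (x + r *\<^sub>R w) *\<^sub>R ((?m / r) *\<^sub>R ?g (?p (x + r *\<^sub>R w))) \<partial>lborel)
      = (\<integral>w. (?m / r) * (indicator (ball 0 1) w * (sgn w \<bullet> grad v (x + r *\<^sub>R sgn w))) \<partial>lborel)"
  proof (rule Bochner_Integration.integral_cong[OF refl])
    fix w :: 'a
    show "indicator ?B (x + r *\<^sub>R w) *\<^sub>R ((?m / r) *\<^sub>R ?g (?p (x + r *\<^sub>R w)))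
      = (?m / r) * (indicator (ball 0 1) w * (sgn w \<bullet> grad v (x + r *\<^sub>R sgn w)))"
    \<comment> \<open>The centre is removed from the ball on the left; on the right
      \<open>sgn 0 = 0\<close> makes the integrand vanish there as well.\<close>
    proof (cases "w = 0")
      case False
      then have "?p (x + r *\<^sub>R w) = x + r *\<^sub>R sgn w"
        using r by (simp add: sgn_div_norm divide_inverse)
      moreover have "indicator ?B (x + r *\<^sub>R w) = (indicator (ball 0 1) w :: real)"
        using r False by (auto simp: indicator_def dist_norm)
      ultimately show ?thesis using r by simp
    qed simp
  qed
  also have "r ^ ?m * \<dots> = (r ^ ?m * (?m / r)) * (\<integral>w. indicator (ball 0 1) w * (sgn w \<bullet> grad v (x + r *\<^sub>R sgn w)) \<partial>lborel)"
    by simp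
  finally have "mean_flux v x r = 1 / sphere_area ?m r * ((r ^ ?m * (?m / r)) * (\<integral>w. indicator (ball 0 1) w * (sgn w \<bullet> grad v (x + r *\<^sub>R sgn w)) \<partial>lborel))"
    unfolding mean_flux_def by simp
  \<comment> \<open>The area is m/r times the volume of the ball, by the functional equation of
    \<open>Gamma\<close> at m/2.\<close>
  also have "sphere_area ?m r = r ^ ?m * (?m / r) * unit_ball_vol ?m"
  proof -
    have Gam: "Gamma (?m / 2 + 1) = ?m / 2 * Gamma (?m / 2)"
      by (rule Gamma_plus1) (auto dest: nonpos_Ints_nonpos)
    have pow: "r ^ ?m = r * r ^ (?m - 1)" by (simp flip: power_Suc)
    have "Gamma (?m / 2 :: real) > 0" by (rule Gamma_real_pos) simp
    then show ?thesis
      using r unfolding sphere_area_def unit_ball_vol_def Gam pow by (simp add: field_simps)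
  qed
  finally show ?thesis using r by (simp add: field_simps)
qed

section \<open>Fluxes through small spheres\<close>

text \<open>The entire factor of the Bessel function: J of order \<nu> at z is (z/2)^\<nu> times the
  value at (z/2)^2. Up to the sign of \<open>t\<close> it is the Bessel-Clifford function. For
  \<open>\<nu> = m / 2 - 1\<close> it also supplies the regular radial solution of the Helmholtz
  equation, in the squared distance.\<close>

definition bessel_entire :: "real \<Rightarrow> real \<Rightarrow> real" where
  "bessel_entire \<nu> t = (\<Sum>n. ((-1) ^ n * rGamma (real n + \<nu> + 1) / fact n) * t ^ n)"

text \<open>By its functional equation \<open>\<bar>rGamma\<bar>\<close> does not increase along
  steps of 1 from \<open>\<nu> + 1\<close>, since each step divides by a number that is at least 1.
  Hence the exponential series dominates.\<close>

lemma summable_bessel_entire: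
  assumes "\<nu> \<ge> 0"
  shows "summable (\<lambda>n. ((-1) ^ n * rGamma (real n + \<nu> + 1) / fact n) * t ^ n)"
proof (rule summable_comparison_test[OF exI[of _ 0]], intro allI impI)
  have b: "\<bar>rGamma (real n + \<nu> + 1)\<bar> \<le> \<bar>rGamma (\<nu> + 1)\<bar>" for n
  proof (induction n)
    case (Suc n)
    have "rGamma (real n + \<nu> + 1) = (real n + \<nu> + 1) * rGamma (real (Suc n) + \<nu> + 1)"
      using rGamma_plus1[of "real n + \<nu> + 1"] by (simp add: add_ac)
    then have "\<bar>rGamma (real n + \<nu> + 1)\<bar> = (real n + \<nu> + 1) * \<bar>rGamma (real (Suc n) + \<nu> + 1)\<bar>"
      using assms by (simp add: abs_mult)
    also have "\<dots> \<ge> 1 * \<bar>rGamma (real (Suc n) + \<nu> + 1)\<bar>"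
      using assms by (intro mult_right_mono) auto
    finally show ?case using Suc by simp
  qed simp
  show "norm (((-1) ^ n * rGamma (real n + \<nu> + 1) / fact n) * t ^ n)
      \<le> \<bar>rGamma (\<nu> + 1)\<bar> * (inverse (fact n) * \<bar>t\<bar> ^ n)" for n
  proof -
    have "norm (((-1) ^ n * rGamma (real n + \<nu> + 1) / fact n) * t ^ n)
      = \<bar>rGamma (real n + \<nu> + 1)\<bar> * (inverse (fact n) * \<bar>t\<bar> ^ n)"
      by (simp add: abs_mult power_abs divide_inverse)
    also have "\<dots> \<le> \<bar>rGamma (\<nu> + 1)\<bar> * (inverse (fact n) * \<bar>t\<bar> ^ n)"
      by (intro mult_right_mono b) auto
    finally show ?thesis .
  qed
  show "summable (\<lambda>n. \<bar>rGamma (\<nu> + 1)\<bar> * (inverse (fact n) * \<bar>t\<bar> ^ n))"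
    by (intro summable_mult summable_exp)
qed

lemma bessel_entire_0: "bessel_entire \<nu> 0 = rGamma (\<nu> + 1)"
  unfolding bessel_entire_def by (subst powser_zero) simp

lemma bessel_entire_has_derivative:
  assumes "\<nu> \<ge> 0"
  shows "(bessel_entire \<nu> has_real_derivative - bessel_entire (\<nu> + 1) t) (at t)"
proof -
  let ?c = "\<lambda>\<nu> n. (-1) ^ n * rGamma (real n + \<nu> + 1) / fact n"
  have "diffs (?c \<nu>) n = - ?c (\<nu> + 1) n" for n
  proof -
    have "real (Suc n) / fact (Suc n) = 1 / fact n" by simp
    then have "- ((-1) ^ n) * rGamma (real n + \<nu> + 2) * (real (Suc n) / fact (Suc n)) = - ((-1) ^ n) * rGamma (real n + \<nu> + 2) * (1 / fact n)"
      by (simp only:)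
    then show ?thesis unfolding diffs_def by (simp add: add_ac mult_ac)
  qed
  then have "(\<Sum>n. diffs (?c \<nu>) n * t ^ n) = - bessel_entire (\<nu> + 1) t"
    unfolding bessel_entire_def using suminf_minus[OF summable_bessel_entire[of "\<nu> + 1" t]] assms by simp
  then show ?thesis
    using termdiffs_strong_converges_everywhere[OF summable_bessel_entire[OF assms], of t]
    unfolding bessel_entire_def[abs_def] by simp
qed

lemma Ck_on_bessel_entire: "\<nu> \<ge> 0 \<Longrightarrow> Ck_on k UNIV (bessel_entire \<nu>)"
  unfolding bessel_entire_def[abs_def] by (intro Ck_on_powser summable_bessel_entire)

text \<open>Each differentiation raises the order by 1 and changes the sign, so this is the equation
  t y'' + (\<nu> + 1) y' + y = 0 for \<open>y = bessel_entire \<nu>\<close>. It is verified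
  coefficient by coefficient.\<close>

lemma bessel_entire_recurrence:
  assumes "\<nu> \<ge> 0"
  shows "t * bessel_entire (\<nu> + 2) t - (\<nu> + 1) * bessel_entire (\<nu> + 1) t + bessel_entire \<nu> t = 0"
proof -
  let ?c = "\<lambda>\<nu> n. (-1) ^ n * rGamma (real n + \<nu> + 1) / fact n"
  \<comment> \<open>Coefficients of \<open>t\<close> times the series of order
    \<open>\<nu> + 2\<close>: multiplication by \<open>t\<close> shifts them by one place and puts 0
    in front.\<close>
  let ?d = "\<lambda>n. case n of 0 \<Rightarrow> 0 | Suc n \<Rightarrow> ?c (\<nu> + 2) n"
  have s: "(\<lambda>n. ?c \<nu> n * t ^ n) sums bessel_entire \<nu> t" if "\<nu> \<ge> 0" for \<nu>
    unfolding bessel_entire_def by (intro summable_sums summable_bessel_entire that)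
  have "(\<lambda>n. t * (?c (\<nu> + 2) n * t ^ n)) sums (t * bessel_entire (\<nu> + 2) t)"
    by (intro sums_mult s) (use assms in simp)
  then have "(\<lambda>n. ?d (Suc n) * t ^ Suc n) sums (t * bessel_entire (\<nu> + 2) t)"
    by (simp add: mult_ac)
  then have 1: "(\<lambda>n. ?d n * t ^ n) sums (t * bessel_entire (\<nu> + 2) t)"
    by (subst (asm) sums_Suc_iff) simp
  have "(\<lambda>n. ?d n * t ^ n - (\<nu> + 1) * (?c (\<nu> + 1) n * t ^ n) + ?c \<nu> n * t ^ n)
      sums (t * bessel_entire (\<nu> + 2) t - (\<nu> + 1) * bessel_entire (\<nu> + 1) t + bessel_entire \<nu> t)"
    by (intro sums_add sums_diff sums_mult 1 s) (use assms in auto)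
  moreover have "?d n * t ^ n - (\<nu> + 1) * (?c (\<nu> + 1) n * t ^ n) + ?c \<nu> n * t ^ n = 0" for n
  proof -
    have r: "rGamma (real n + \<nu> + 1) = (real n + \<nu> + 1) * rGamma (real n + \<nu> + 2)"
      using rGamma_plus1[of "real n + \<nu> + 1"] by (simp add: add_ac)
    \<comment> \<open>Writing the shift with a factor \<open>real n\<close> covers
      \<open>n = 0\<close> too, where that factor gives the required 0.\<close>
    have d: "?d n = - ((-1) ^ n) * real n * rGamma (real n + \<nu> + 2) / fact n"
      by (cases n) (simp_all add: add_ac)
    have c: "?c (\<nu> + 1) n = (-1) ^ n * rGamma (real n + \<nu> + 2) / fact n" by (simp add: add_ac)
    show ?thesis unfolding d c r by (simp add: field_simps)
  qed
  ultimately have "(\<lambda>n. 0) sums (t * bessel_entire (\<nu> + 2) t - (\<nu> + 1) * bessel_entire (\<nu> + 1) t + bessel_entire \<nu> t)"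
    by simp
  then show ?thesis using sums_unique2 sums_zero by blast
qed

lemma bessel_J_eq:
  assumes "\<nu> \<ge> 0" "z > 0"
  shows "bessel_J \<nu> z = (z / 2) powr \<nu> * bessel_entire \<nu> ((z / 2)\<^sup>2)"
proof -
  have "(z / 2) powr (2 * real n + \<nu>) = (z / 2) powr \<nu> * ((z / 2)\<^sup>2) ^ n" for n
  proof -
    have "(z / 2) powr (2 * real n) = (z / 2) ^ (2 * n)"
      using assms powr_realpow[of "z / 2" "2 * n"] by simp
    then show ?thesis by (simp add: powr_add power_mult)
  qed
  then have "bessel_J \<nu> z = (\<Sum>n. (z / 2) powr \<nu> * (((-1) ^ n * rGamma (real n + \<nu> + 1) / fact n) * ((z / 2)\<^sup>2) ^ n))"
    unfolding bessel_J_def by (simp add: mult_ac)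
  also have "\<dots> = (z / 2) powr \<nu> * bessel_entire \<nu> ((z / 2)\<^sup>2)"
    unfolding bessel_entire_def by (rule suminf_mult[OF summable_bessel_entire[OF assms(1)]])
  finally show ?thesis .
qed

text \<open>The powers of \<mu>s/2 in numerator and denominator differ by exactly one, so after
  division by \<open>s\<close> the factor is continuous at 0. Its value there follows from
  \<open>bessel_entire_0\<close> and
  \<open>Gamma (m / 2) * rGamma (m / 2 + 1) = 2 / m\<close>.\<close>

lemma flux_factor_asymptotics:
  assumes m: "m > 0" and pos: "\<mu> > 0"
  shows "((\<lambda>s. - \<mu> * Gamma (m / 2) * (bessel_J (m / 2) (\<mu> * s) / (\<mu> * s / 2) powr ((m - 2) / 2)) / s)
    \<longlongrightarrow> - (\<mu>\<^sup>2 / m)) (at_right 0)"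
proof -
  let ?B = "\<lambda>s. bessel_entire (m / 2) ((\<mu> * s / 2)\<^sup>2)"
  have "isCont (bessel_entire (m / 2)) ((\<mu> * 0 / 2)\<^sup>2)"
    using bessel_entire_has_derivative[of "m / 2"] m DERIV_isCont by fastforce
  then have "isCont ?B 0"
    by (rule isCont_o2[rotated]) (intro continuous_intros, simp)
  then have "(?B \<longlongrightarrow> rGamma (m / 2 + 1)) (at 0)"
    by (simp add: isCont_def bessel_entire_0)
  then have "((\<lambda>s. - \<mu> * Gamma (m / 2) * (\<mu> / 2 * ?B s)) \<longlongrightarrow> - \<mu> * Gamma (m / 2) * (\<mu> / 2 * rGamma (m / 2 + 1))) (at_right 0)"
    by (intro tendsto_intros filterlim_at_split[THEN iffD1, THEN conjunct2])
  moreover have "- \<mu> * Gamma (m / 2) * (\<mu> / 2 * rGamma (m / 2 + 1)) = - (\<mu>\<^sup>2 / m)"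
  proof -
    have "m / 2 * rGamma (m / 2 + 1) = rGamma (m / 2)" by (rule rGamma_plus1)
    moreover have "Gamma (m / 2) * rGamma (m / 2) = 1"
      unfolding rGamma_inverse_Gamma
      by (rule right_inverse) (use m in \<open>metis Gamma_real_pos half_gt_zero less_irrefl\<close>)
    ultimately have "Gamma (m / 2) * (m / 2 * rGamma (m / 2 + 1)) = 1" by simp
    then have "Gamma (m / 2) * rGamma (m / 2 + 1) = 2 / m" using m by (simp add: field_simps)
    then have "- \<mu> * (\<mu> / 2) * (Gamma (m / 2) * rGamma (m / 2 + 1)) = - \<mu> * (\<mu> / 2) * (2 / m)" by simp
    then show ?thesis by (simp add: power2_eq_square mult_ac)
  qed
  ultimately have lim: "((\<lambda>s. - \<mu> * Gamma (m / 2) * (\<mu> / 2 * ?B s)) \<longlongrightarrow> - (\<mu>\<^sup>2 / m)) (at_right 0)" by simp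
  show ?thesis
  proof (rule Lim_transform_eventually[OF lim])
    show "\<forall>\<^sub>F s in at_right 0. - \<mu> * Gamma (m / 2) * (\<mu> / 2 * ?B s)
      = - \<mu> * Gamma (m / 2) * (bessel_J (m / 2) (\<mu> * s) / (\<mu> * s / 2) powr ((m - 2) / 2)) / s"
    proof (rule eventually_at_rightI[of 0 1])
      fix s :: real assume "s \<in> {0<..<1}"
      then have s: "s > 0" by simp
      then have z: "\<mu> * s / 2 > 0" using pos by simp
      have e: "(m - 2) / 2 = m / 2 - 1" by (simp add: field_simps)
      have "bessel_J (m / 2) (\<mu> * s) = (\<mu> * s / 2) powr (m / 2) * ?B s"
        using bessel_J_eq[of "m / 2" "\<mu> * s"] m pos s by simp
      then have q: "bessel_J (m / 2) (\<mu> * s) / (\<mu> * s / 2) powr ((m - 2) / 2) = \<mu> * s / 2 * ?B s"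
        unfolding e powr_diff using z by (simp add: field_simps)
      show "- \<mu> * Gamma (m / 2) * (\<mu> / 2 * ?B s)
        = - \<mu> * Gamma (m / 2) * (bessel_J (m / 2) (\<mu> * s) / (\<mu> * s / 2) powr ((m - 2) / 2)) / s"
        unfolding q using s by simp
    qed simp
  qed
qed

lemma unit_ball_vol_nonzero: "unit_ball_vol (real n) \<noteq> 0"
  using unit_ball_vol_pos[of "real n"] by (metis less_irrefl of_nat_0_le_iff)

section \<open>Green's identities and radial test functions\<close>

lemma inner_grad: "grad f x \<bullet> grad g x = (\<Sum>b\<in>Basis. partial_deriv b f x * partial_deriv b g x)"
  by (subst euclidean_inner) (simp add: inner_commute[of "grad _ _"] inner_grad_Basis)

text \<open>Only one derivative is moved onto \<open>v\<close>, which is all that a C^1 function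
  admits; this form leads to the fluxes.\<close>

lemma green_first:
  fixes v \<psi> :: "'a::euclidean_space \<Rightarrow> real"
  assumes D: "open D" and v: "Ck_on 1 D v" and \<psi>: "Ck_on 2 UNIV \<psi>"
    and K: "compact K" "K \<subseteq> D" "\<And>x. x \<notin> K \<Longrightarrow> \<psi> x = 0"
  shows "integrable lborel (\<lambda>x. v x * laplacian \<psi> x)"
    and "integrable lborel (\<lambda>x. grad v x \<bullet> grad \<psi> x)"
    and "(\<integral>x. v x * laplacian \<psi> x \<partial>lborel) = - (\<integral>x. grad v x \<bullet> grad \<psi> x \<partial>lborel)"
proof -
  have p: "Ck_on 1 UNIV (partial_deriv b \<psi>)" if "b \<in> Basis" for b
    using \<psi> that by (simp add: numeral_2_eq_2 One_nat_def)
  have p0: "partial_deriv b \<psi> x = 0" if "x \<notin> K" for x b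
    by (rule partial_deriv_eq_0[OF compact_imp_closed[OF K(1)] K(3) that])
  note ibp = integral_by_parts[OF D v p K(1,2) p0]
  show "integrable lborel (\<lambda>x. v x * laplacian \<psi> x)" "integrable lborel (\<lambda>x. grad v x \<bullet> grad \<psi> x)"
    "(\<integral>x. v x * laplacian \<psi> x \<partial>lborel) = - (\<integral>x. grad v x \<bullet> grad \<psi> x \<partial>lborel)"
    unfolding laplacian_def inner_grad sum_distrib_left
    using ibp by (simp_all add: sum_negf)
qed

lemma green_second:
  fixes v \<psi> :: "'a::euclidean_space \<Rightarrow> real"
  assumes D: "open D" and v: "Ck_on 2 D v" and \<psi>: "Ck_on 2 UNIV \<psi>"
    and K: "compact K" "K \<subseteq> D" "\<And>x. x \<notin> K \<Longrightarrow> \<psi> x = 0"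
  shows "integrable lborel (\<lambda>x. laplacian v x * \<psi> x)"
    and "(\<integral>x. v x * laplacian \<psi> x \<partial>lborel) = (\<integral>x. laplacian v x * \<psi> x \<partial>lborel)"
proof -
  have p: "Ck_on 1 D (partial_deriv b v)" if "b \<in> Basis" for b
    using v that by (simp add: numeral_2_eq_2 One_nat_def)
  have v1: "Ck_on 1 D v" by (rule Ck_on_le[OF v]) simp
  have \<psi>1: "Ck_on 1 UNIV \<psi>" by (rule Ck_on_le[OF \<psi>]) simp
  note ibp = integral_by_parts[OF D p \<psi>1 K]
  show "integrable lborel (\<lambda>x. laplacian v x * \<psi> x)"
    unfolding laplacian_def sum_distrib_right using ibp by simp
  have "(\<integral>x. grad v x \<bullet> grad \<psi> x \<partial>lborel) = - (\<integral>x. laplacian v x * \<psi> x \<partial>lborel)"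
    unfolding laplacian_def inner_grad sum_distrib_right using ibp by (simp add: sum_negf)
  then show "(\<integral>x. v x * laplacian \<psi> x \<partial>lborel) = (\<integral>x. laplacian v x * \<psi> x \<partial>lborel)"
    using green_first(3)[OF D v1 \<psi> K] by simp
qed

text \<open>The gradient of a radial function is radial: \<open>grad \<psi> y\<close> equals 2 f'(t)
  times \<open>y - x\<close>. In polar coordinates its inner product with \<open>grad v\<close> at
  distance \<open>s\<close> is therefore 2 s f'(s^2) times the normal derivative of
  \<open>v\<close>, and the angular integral is a mean flux.\<close>

lemma radial_green:
  fixes v :: "'a::euclidean_space \<Rightarrow> real"
  assumes D: "open D" and v: "Ck_on 1 D v" and r: "r > 0" and sub: "cball x r \<subseteq> D"
    and T: "open T" "{0..} \<subseteq> T" and f: "Ck_on 2 T f"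
    and f': "\<And>t. t \<in> T \<Longrightarrow> (f has_real_derivative f' t) (at t)"
    and zero: "\<And>t. t \<ge> r\<^sup>2 \<Longrightarrow> f t = 0"
  defines "\<psi> \<equiv> \<lambda>y. f ((norm (y - x))\<^sup>2)"
    and "h \<equiv> \<lambda>s::real. indicator {0<..} s * (DIM('a) * s ^ (DIM('a) - 1)) * (unit_ball_vol DIM('a) * (2 * s * f' (s\<^sup>2) * mean_flux v x s))"
  shows "integrable lborel h" and "(\<integral>y. v y * laplacian \<psi> y \<partial>lborel) = - (\<integral>s. h s \<partial>lborel)"
proof -
  have \<psi>: "Ck_on 2 UNIV \<psi>"
    unfolding \<psi>_def by (rule Ck_on_compose[OF open_UNIV f Ck_on_norm_square]) (use T in auto)
  have \<psi>0: "\<psi> y = 0" if "y \<notin> cball x r" for y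
    using that r unfolding \<psi>_def by (intro zero power_mono) (auto simp: dist_norm norm_minus_commute)
  note green = green_first[OF D v \<psi> compact_cball sub \<psi>0]
  let ?g = "\<lambda>y. grad v y \<bullet> grad \<psi> y"
  have g: "?g y = 2 * ((y - x) \<bullet> grad v y) * f' ((norm (y - x))\<^sup>2)" for y
  proof -
    have "(\<psi> has_derivative (\<lambda>h. 2 * ((y - x) \<bullet> h) * f' ((norm (y - x))\<^sup>2))) (at y)"
      unfolding \<psi>_def by (rule partial_deriv_radial(1), rule f') (use T in auto)
    moreover from this have "(\<psi> has_derivative (\<lambda>h. h \<bullet> grad \<psi> y)) (at y)"
      by (intro has_derivative_grad) (auto simp: differentiable_def)
    ultimately have "(\<lambda>h. 2 * ((y - x) \<bullet> h) * f' ((norm (y - x))\<^sup>2)) = (\<lambda>h. h \<bullet> grad \<psi> y)"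
      by (rule has_derivative_unique)
    from fun_cong[OF this, of "grad v y"] show ?thesis by simp
  qed
  have gm: "?g \<in> borel_measurable borel"
    using borel_measurable_integrable[OF green(2)] by simp
  have gi: "integrable lborel (\<lambda>z. ?g (x + z))" and ge: "(\<integral>z. ?g (x + z) \<partial>lborel) = (\<integral>y. ?g y \<partial>lborel)"
    using lborel_translation[OF gm, of x] green(2) by simp_all
  have h: "h s = indicator {0<..} s * (DIM('a) * s ^ (DIM('a) - 1)) * (\<integral>w. indicator (ball 0 1) w * ?g (x + s *\<^sub>R sgn w) \<partial>lborel)" for s :: real
  proof (cases "s > 0")
    case True
    have "(\<integral>w. indicator (ball 0 1) w * ?g (x + s *\<^sub>R sgn w) \<partial>lborel)
      = (\<integral>w. 2 * s * f' (s\<^sup>2) * (indicator (ball 0 1) w * (sgn w \<bullet> grad v (x + s *\<^sub>R sgn w))) \<partial>lborel)"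
      by (rule Bochner_Integration.integral_cong[OF refl]) (simp add: g norm_sgn power_mult_distrib)
    also have "\<dots> = 2 * s * f' (s\<^sup>2) * (\<integral>w. indicator (ball 0 1) w * (sgn w \<bullet> grad v (x + s *\<^sub>R sgn w)) \<partial>lborel)"
      by simp
    also have "\<dots> = unit_ball_vol DIM('a) * (2 * s * f' (s\<^sup>2) * mean_flux v x s)"
    proof (cases "s \<le> r")
      case sr: True
      have "sphere x s \<subseteq> D" using sub sr by (auto simp: subset_iff)
      from mean_flux_eq[OF D v True this] show ?thesis
        by (simp add: unit_ball_vol_nonzero)
    next
      \<comment> \<open>Here the sphere may leave \<open>D\<close>, and nothing is known about
        \<open>mean_flux\<close>; the factor \<open>f'\<close> vanishes because \<open>f\<close>
        does beyond \<open>r\<^sup>2\<close>.\<close>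
      case False
      then have "s\<^sup>2 > r\<^sup>2" using r by (simp add: power_strict_mono)
      then have "(f has_real_derivative 0) (at (s\<^sup>2))"
        by (intro has_field_derivative_transform_within_open[OF DERIV_const, of "{r\<^sup>2<..}"]) (auto simp: zero)
      moreover have "(f has_real_derivative f' (s\<^sup>2)) (at (s\<^sup>2))" using T by (intro f') auto
      ultimately have "f' (s\<^sup>2) = 0" using DERIV_unique by blast
      then show ?thesis by simp
    qed
    finally show ?thesis unfolding h_def by simp
  qed (simp add: h_def)
  show "integrable lborel h" using integral_polar(1)[OF gi] unfolding h[abs_def] .
  show "(\<integral>y. v y * laplacian \<psi> y \<partial>lborel) = - (\<integral>s. h s \<partial>lborel)"
    using integral_polar(2)[OF gi] green(3) ge unfolding h by simp
qed

text \<open>The standard mollifier without normalisation; where a mean is meant, the integral is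
  divided out explicitly.\<close>

definition bump :: "'a::euclidean_space \<Rightarrow> real \<Rightarrow> 'a \<Rightarrow> real" where
  "bump x r y = flat 0 (1 - (norm (y - x))\<^sup>2 / r\<^sup>2)"

lemma Ck_on_bump_profile: "Ck_on k UNIV (\<lambda>t. flat 0 (1 - t / r\<^sup>2))"
proof (rule Ck_on_compose[OF open_UNIV Ck_on_flat])
  have "Ck_on k UNIV (\<lambda>t::real. 1 - (1 / r\<^sup>2) * t)"
    by (intro Ck_on_diff Ck_on_const Ck_on_bounded_linear bounded_linear_mult_right open_UNIV)
  then show "Ck_on k UNIV (\<lambda>t::real. 1 - t / r\<^sup>2)" by simp
qed auto

lemma bump_profile_derivative:
  "((\<lambda>t. flat 0 (1 - t / r\<^sup>2)) has_real_derivative - flat 2 (1 - t / r\<^sup>2) / r\<^sup>2) (at t)"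
proof -
  have "((\<lambda>t. 1 - (1 / r\<^sup>2) * t) has_real_derivative - (1 / r\<^sup>2)) (at t)"
    using DERIV_diff[OF DERIV_const[of 1] DERIV_cmult_Id[of "1 / r\<^sup>2"]] by simp
  then have "((\<lambda>t. 1 - t / r\<^sup>2) has_real_derivative - (1 / r\<^sup>2)) (at t)" by simp
  from DERIV_chain2[OF flat_has_real_derivative[of 0] this] show ?thesis by (simp add: numeral_2_eq_2)
qed

lemma bump_nonneg: "bump x r y \<ge> 0"
  by (simp add: bump_def flat_nonneg)

lemma bump_eq_0: "r > 0 \<Longrightarrow> r \<le> norm (y - x) \<Longrightarrow> bump x r y = 0"
  unfolding bump_def by (intro flat_eq_0) (simp add: power_mono)

lemma bump_eq_0': "r > 0 \<Longrightarrow> y \<notin> cball x r \<Longrightarrow> bump x r y = 0"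
  by (intro bump_eq_0) (auto simp: dist_norm norm_minus_commute)

lemma Ck_on_bump: "Ck_on k UNIV (bump x r)"
  unfolding bump_def[abs_def] by (rule Ck_on_compose[OF open_UNIV Ck_on_bump_profile Ck_on_norm_square]) auto

lemma test_function_on_bump:
  assumes "r > 0" "cball x r \<subseteq> U"
  shows "test_function_on U (bump x r)"
  unfolding bump_def[abs_def]
  by (rule test_function_on_radial[OF open_UNIV _ Ck_on_bump_profile _ assms])
    (use assms in \<open>auto intro!: flat_eq_0\<close>)

lemma integrable_bump: "r > 0 \<Longrightarrow> integrable lborel (bump x r)"
  by (rule integrable_compact_support[OF Ck_on_imp_continuous_on[OF Ck_on_bump] compact_cball bump_eq_0'])

lemma integral_bump_scale:
  assumes "r > 0"
  shows "(\<integral>y. bump (x :: 'a::euclidean_space) r y \<partial>lborel) = r ^ DIM('a) * (\<integral>y. bump (0::'a) 1 y \<partial>lborel)"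
proof -
  have "bump x r \<in> borel_measurable borel"
    by (rule borel_measurable_continuous_onI[OF Ck_on_imp_continuous_on[OF Ck_on_bump]])
  from lborel_scale[OF this assms, of x] show ?thesis
    using assms by (simp add: bump_def power_mult_distrib)
qed

lemma integral_bump_pos:
  assumes "r > 0"
  shows "(\<integral>y. bump (x :: 'a::euclidean_space) r y \<partial>lborel) > 0"
proof -
  have "(\<integral>y. bump x r y \<partial>lborel) \<noteq> 0"
  proof
    assume "(\<integral>y. bump x r y \<partial>lborel) = 0"
    then have "AE y in lborel. bump x r y = 0"
      by (subst (asm) integral_nonneg_eq_0_iff_AE[OF integrable_bump[OF assms]]) (auto simp: bump_nonneg)
    then have "AE y in lborel. y \<in> - ball x r"
    proof eventually_elim
      fix y assume "bump x r y = 0"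
      then have "\<not> 1 - (norm (y - x))\<^sup>2 / r\<^sup>2 > 0" using flat_pos[of "1 - (norm (y - x))\<^sup>2 / r\<^sup>2" 0] by (auto simp: bump_def)
      then have "1 \<le> (norm (y - x))\<^sup>2 / r\<^sup>2" by linarith
      then have "(norm (y - x))\<^sup>2 \<ge> r\<^sup>2" using assms by (metis le_divide_eq_1_pos zero_less_power)
      then have "norm (y - x) \<ge> r" by (rule power2_le_imp_le) simp
      then show "y \<in> - ball x r" by (simp add: dist_norm norm_minus_commute)
    qed
    then have "AE y in lebesgue. y \<in> - ball x r" by (rule AE_completion)
    \<comment> \<open>A closed set of full Lebesgue measure contains every point, in particular the
      centre.\<close>
    then have "x \<in> - ball x r" by (intro mem_closed_if_AE_lebesgue) auto
    then show False using assms by simp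
  qed
  moreover have "(\<integral>y. bump x r y \<partial>lborel) \<ge> 0" by (simp add: bump_nonneg)
  ultimately show ?thesis by simp
qed

text \<open>A calibration: since flux over radius is the constant 2, testing with the squared
  distance reveals the total mass of a radial weight without evaluating it.\<close>

lemma mean_flux_norm_square:
  assumes s: "s > 0"
  shows "mean_flux (\<lambda>y. (norm (y - x))\<^sup>2) (x::'a::euclidean_space) s = 2 * s"
proof -
  let ?q = "\<lambda>y. (norm (y - x))\<^sup>2"
  have "grad ?q y = 2 *\<^sub>R (y - x)" for y
  proof -
    have "partial_deriv b ?q y = (2 *\<^sub>R (y - x)) \<bullet> b" for b
      using partial_deriv_eq[OF has_derivative_norm_square, of b x y] by simp
    then show ?thesis unfolding grad_def by (simp add: euclidean_representation del: inner_scaleR_left)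
  qed
  have [measurable]: "ball (0::'a) 1 \<in> sets borel" by simp
  have "mean_flux ?q x s = (\<integral>w. indicator (ball 0 1) w * (sgn w \<bullet> (2 *\<^sub>R (s *\<^sub>R sgn (w::'a)))) \<partial>lborel) / unit_ball_vol DIM('a)"
    using \<open>\<And>y. grad ?q y = 2 *\<^sub>R (y - x)\<close> by (subst mean_flux_eq[OF open_UNIV Ck_on_norm_square s]) auto
  also have "(\<integral>w. indicator (ball 0 1) w * (sgn w \<bullet> (2 *\<^sub>R (s *\<^sub>R sgn (w::'a)))) \<partial>lborel)
      = (\<integral>w. 2 * s * indicator (ball (0::'a) 1) w \<partial>lborel)"
  proof (rule Bochner_Integration.integral_cong_AE)
    show "AE w in lborel. indicator (ball 0 1) w * (sgn w \<bullet> (2 *\<^sub>R (s *\<^sub>R sgn (w::'a)))) = 2 * s * indicator (ball (0::'a) 1) w"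
      by (rule AE_mp[OF AE_lborel_singleton[of 0]], rule AE_I2)
        (auto simp: power2_norm_eq_inner[symmetric] norm_sgn)
  qed measurable
  also have "\<dots> = 2 * s * unit_ball_vol DIM('a)" by (simp add: content_ball)
  finally show ?thesis by (simp add: unit_ball_vol_nonzero)
qed

text \<open>The numerator is an integral of \<open>mean_flux v x s / s\<close> against a nonnegative
  weight \<open>W\<close> that vanishes outside the interval from 0 to \<open>r\<close>. The mass of
  \<open>W\<close> is \<open>DIM('a)\<close> times the integral of the bump, so the quotient is
  \<open>DIM('a)\<close> times a weighted mean of values close to \<open>a\<close>.\<close>

lemma flux_limit:
  fixes v :: "'a::euclidean_space \<Rightarrow> real" and a :: real
  assumes D: "open D" and v: "Ck_on 1 D v" and x: "x \<in> D"
    and lim: "((\<lambda>s. mean_flux v x s / s) \<longlongrightarrow> a) (at_right 0)"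
  shows "((\<lambda>r. (\<integral>y. v y * laplacian (bump x r) y \<partial>lborel) / (\<integral>y. bump x r y \<partial>lborel)) \<longlongrightarrow> DIM('a) * a) (at_right 0)"
proof (rule tendstoI)
  let ?m = "real DIM('a)"
  let ?\<omega> = "unit_ball_vol ?m"
  fix e :: real assume e: "e > 0"
  obtain R where R: "R > 0" "cball x R \<subseteq> D" using D x open_contains_cball by blast
  have "\<forall>\<^sub>F s in at_right 0. dist (mean_flux v x s / s) a < e / (2 * ?m)"
    using e by (intro tendstoD[OF lim]) auto
  then obtain d where d: "d > 0" "\<And>s. 0 < s \<Longrightarrow> s < d \<Longrightarrow> \<bar>mean_flux v x s / s - a\<bar> < e / (2 * ?m)"
    unfolding eventually_at_right_field by (auto simp: dist_real_def)
  show "\<forall>\<^sub>F r in at_right 0. dist ((\<integral>y. v y * laplacian (bump x r) y \<partial>lborel) / (\<integral>y. bump x r y \<partial>lborel)) (?m * a) < e"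
  proof (rule eventually_at_rightI[of 0 "min d R"])
    fix r assume "r \<in> {0<..<min d R}"
    then have r: "r > 0" "r < d" "r < R" by auto
    then have sub: "cball x r \<subseteq> D" using R by auto
    let ?f' = "\<lambda>t. - flat 2 (1 - t / r\<^sup>2) / r\<^sup>2"
    let ?I = "\<integral>y. bump x r y \<partial>lborel"
    have I: "?I > 0" by (rule integral_bump_pos[OF r(1)])
    have z: "flat 0 (1 - t / r\<^sup>2) = 0" if "t \<ge> r\<^sup>2" for t
      using that r by (intro flat_eq_0) simp
    \<comment> \<open>One factor \<open>s\<close> is moved from the flux into the weight, so that
      the flux appears divided by \<open>s\<close>; the sign of the profile's derivative makes
      \<open>W\<close> nonnegative.\<close>
    define W where "W s = indicator {0<..} s * (?m * s ^ (DIM('a) - 1)) * (?\<omega> * (2 * s\<^sup>2 * (flat 2 (1 - s\<^sup>2 / r\<^sup>2) / r\<^sup>2)))" for s :: real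
    have W0: "W s \<ge> 0" for s
      by (auto simp: W_def indicator_def flat_nonneg intro!: mult_nonneg_nonneg divide_nonneg_nonneg less_imp_le[OF unit_ball_vol_pos])
    have Wz: "W s = 0" if "s \<le> 0 \<or> s \<ge> r" for s
    proof -
      have "flat 2 (1 - s\<^sup>2 / r\<^sup>2) = 0" if "s \<ge> r"
        using that r by (intro flat_eq_0) (simp add: power_mono)
      then show ?thesis using that by (auto simp: W_def)
    qed
    let ?q = "\<lambda>y. (norm (y - x))\<^sup>2"
    have bx: "(\<lambda>y. flat 0 (1 - (norm (y - x))\<^sup>2 / r\<^sup>2)) = bump x r"
      by (auto simp: bump_def)
    note gv = radial_green[OF D v r(1) sub open_UNIV subset_UNIV Ck_on_bump_profile bump_profile_derivative z, unfolded bx]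
    \<comment> \<open>The same identity for the squared distance; comparing it with the second Green
      identity determines the integral of \<open>W\<close>.\<close>
    note gq = radial_green[where x=x and v="\<lambda>y. (norm (y - x))\<^sup>2", OF open_UNIV Ck_on_norm_square r(1) subset_UNIV open_UNIV subset_UNIV Ck_on_bump_profile bump_profile_derivative z, unfolded bx]
    have eq: "indicator {0<..} s * (?m * s ^ (DIM('a) - 1)) * (?\<omega> * (2 * s * ?f' (s\<^sup>2) * F)) = - (W s * (F / s))" for s F :: real
      by (cases "s > 0") (auto simp: W_def power2_eq_square)
    have iv: "integrable lborel (\<lambda>s. W s * (mean_flux v x s / s))"
      using gv(1) unfolding eq by simp
    have ev: "(\<integral>y. v y * laplacian (bump x r) y \<partial>lborel) = (\<integral>s. W s * (mean_flux v x s / s) \<partial>lborel)"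
      using gv(2) unfolding eq by simp
    have Wq: "W s * (mean_flux ?q x s / s) = 2 * W s" for s
      by (cases "s > 0") (auto simp: mean_flux_norm_square Wz)
    have iW: "integrable lborel W"
      using gq(1) unfolding eq Wq by simp
    have "(\<integral>y. ?q y * laplacian (bump x r) y \<partial>lborel) = (\<integral>s. 2 * W s \<partial>lborel)"
      using gq(2) unfolding eq Wq by simp
    moreover have "(\<integral>y. ?q y * laplacian (bump x r) y \<partial>lborel) = (\<integral>y. laplacian ?q y * bump x r y \<partial>lborel)"
      by (rule green_second(2)[OF open_UNIV Ck_on_norm_square Ck_on_bump compact_cball subset_UNIV bump_eq_0'[OF r(1)]])
    moreover have "laplacian ?q y = 2 * ?m" for y
      by (subst laplacian_radial[of UNIV "\<lambda>t. t" "\<lambda>_. 1" "\<lambda>_. 0"]) (auto intro!: derivative_eq_intros)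
    ultimately have eW: "(\<integral>s. W s \<partial>lborel) = ?m * ?I" by simp
    have "\<bar>(\<integral>y. v y * laplacian (bump x r) y \<partial>lborel) - ?m * ?I * a\<bar> = \<bar>\<integral>s. W s * (mean_flux v x s / s) - W s * a \<partial>lborel\<bar>"
      unfolding ev eW[symmetric] using iv iW by simp
    also have "\<dots> \<le> (\<integral>s. \<bar>W s * (mean_flux v x s / s) - W s * a\<bar> \<partial>lborel)" by (rule integral_abs_bound)
    also have "\<dots> \<le> (\<integral>s. W s * (e / (2 * ?m)) \<partial>lborel)"
    proof (rule integral_mono)
      show "\<bar>W s * (mean_flux v x s / s) - W s * a\<bar> \<le> W s * (e / (2 * ?m))" for s
      proof (cases "s \<le> 0 \<or> s \<ge> r")
        case False
        then have "\<bar>mean_flux v x s / s - a\<bar> \<le> e / (2 * ?m)" using d(2)[of s] r by simp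
        from mult_left_mono[OF this W0[of s]] show ?thesis
          by (simp only: right_diff_distrib[symmetric] abs_mult abs_of_nonneg[OF W0])
      qed (simp add: Wz)
    qed (use iv iW in auto)
    also have "\<dots> = e / 2 * ?I" using eW by simp
    finally have "\<bar>(\<integral>y. v y * laplacian (bump x r) y \<partial>lborel) - ?m * ?I * a\<bar> / ?I \<le> e / 2"
      using I by (simp add: pos_divide_le_eq)
    moreover have "((\<integral>y. v y * laplacian (bump x r) y \<partial>lborel) - ?m * ?I * a) / ?I
        = (\<integral>y. v y * laplacian (bump x r) y \<partial>lborel) / ?I - ?m * a"
      using I by (simp add: diff_divide_distrib)
    then have "\<bar>(\<integral>y. v y * laplacian (bump x r) y \<partial>lborel) - ?m * ?I * a\<bar> / ?I
        = dist ((\<integral>y. v y * laplacian (bump x r) y \<partial>lborel) / ?I) (?m * a)"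
      using I abs_divide[of "(\<integral>y. v y * laplacian (bump x r) y \<partial>lborel) - ?m * ?I * a" ?I] by (simp add: dist_real_def)
    ultimately show "dist ((\<integral>y. v y * laplacian (bump x r) y \<partial>lborel) / ?I) (?m * a) < e"
      using e by linarith
  qed (use d R in auto)
qed

section \<open>Approximate identities in the mean\<close>

text \<open>Continuity of translation in the L1 norm, in sequential form to match dominated
  convergence.\<close>

definition L1_continuous :: "('a::euclidean_space \<Rightarrow> real) \<Rightarrow> bool" where
  "L1_continuous f \<longleftrightarrow>
    (\<forall>z. z \<longlonglongrightarrow> 0 \<longrightarrow> (\<lambda>n::nat. \<integral>x. \<bar>f (z n + x) - f x\<bar> \<partial>lborel) \<longlonglongrightarrow> 0)"

lemma integrable_translation:
  fixes f :: "'a::euclidean_space \<Rightarrow> real"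
  assumes "integrable lborel f"
  shows "integrable lborel (\<lambda>x. f (c + x))" and "(\<integral>x. f (c + x) \<partial>lborel) = (\<integral>x. f x \<partial>lborel)"
  using lborel_translation[of f c] borel_measurable_integrable[OF assms] assms by simp_all

text \<open>Triangle inequality through \<open>g\<close>. The approximation error occurs twice, once
  translated with unchanged integral, so three terms of size at most \<open>e / 4\<close> remain
  below \<open>e\<close>.\<close>

lemma L1_continuous_limit:
  fixes f :: "'a::euclidean_space \<Rightarrow> real"
  assumes f: "integrable lborel f"
    and app: "\<And>e. e > 0 \<Longrightarrow> \<exists>g. integrable lborel g \<and> L1_continuous g \<and> (\<integral>x. \<bar>g x - f x\<bar> \<partial>lborel) \<le> e"
  shows "L1_continuous f"
  unfolding L1_continuous_def
proof (intro allI impI, rule LIMSEQ_I)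
  fix z :: "nat \<Rightarrow> 'a" and e :: real assume z: "z \<longlonglongrightarrow> 0" and e: "e > 0"
  obtain g where g: "integrable lborel g" "L1_continuous g" "(\<integral>x. \<bar>g x - f x\<bar> \<partial>lborel) \<le> e / 4"
    using app[of "e / 4"] e by auto
  obtain N where N: "\<And>n. n \<ge> N \<Longrightarrow> \<bar>\<integral>x. \<bar>g (z n + x) - g x\<bar> \<partial>lborel\<bar> < e / 4"
    using LIMSEQ_D[OF g(2)[unfolded L1_continuous_def, rule_format, OF z], of "e / 4"] e by auto
  have "norm ((\<integral>x. \<bar>f (z n + x) - f x\<bar> \<partial>lborel) - 0) < e" if n: "n \<ge> N" for n
  proof -
    have d: "integrable lborel (\<lambda>x. \<bar>g x - f x\<bar>)" using f g by auto
    note t = integrable_translation[OF d, of "z n"]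
    have fz: "integrable lborel (\<lambda>x. f (z n + x))" "integrable lborel (\<lambda>x. g (z n + x))"
      using integrable_translation f g by blast+
    have i1: "integrable lborel (\<lambda>x. \<bar>f (z n + x) - f x\<bar>)" using fz f by auto
    have i2: "integrable lborel (\<lambda>x. \<bar>g (z n + x) - g x\<bar>)" using fz g by auto
    have "(\<integral>x. \<bar>f (z n + x) - f x\<bar> \<partial>lborel)
        \<le> (\<integral>x. \<bar>g (z n + x) - f (z n + x)\<bar> + \<bar>g (z n + x) - g x\<bar> + \<bar>g x - f x\<bar> \<partial>lborel)"
      using i1 i2 d t(1) by (intro integral_mono) auto
    also have "\<dots> = (\<integral>x. \<bar>g x - f x\<bar> \<partial>lborel) + (\<integral>x. \<bar>g (z n + x) - g x\<bar> \<partial>lborel) + (\<integral>x. \<bar>g x - f x\<bar> \<partial>lborel)"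
      using i2 d t by simp
    also have "\<dots> < e" using g(3) N[OF n] e by simp
    finally show ?thesis by simp
  qed
  then show "\<exists>N. \<forall>n\<ge>N. norm ((\<integral>x. \<bar>f (z n + x) - f x\<bar> \<partial>lborel) - 0) < e" by blast
qed

lemma L1_continuous_indicator_open:
  fixes U :: "'a::euclidean_space set"
  assumes U: "open U" "emeasure lborel U < \<infinity>"
  shows "L1_continuous (indicator U)"
  unfolding L1_continuous_def
proof (intro allI impI)
  fix z :: "nat \<Rightarrow> 'a" assume z: "z \<longlonglongrightarrow> 0"
  let ?f = "indicator U :: 'a \<Rightarrow> real"
  have [measurable]: "U \<in> sets borel" using U by simp
  have f: "integrable lborel ?f" using U by (simp add: integrable_indicator_iff)
  note t = integrable_translation[OF f]
  let ?p = "\<lambda>n x. max (?f x - ?f (z n + x)) 0"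
  \<comment> \<open>The two one-sided differences have the same integral, and \<open>?p n\<close> is dominated because
    \<open>U\<close> is open.\<close>
  have ip: "integrable lborel (?p n)" for n using t f by auto
  have "(\<integral>x. \<bar>?f (z n + x) - ?f x\<bar> \<partial>lborel) = 2 * (\<integral>x. ?p n x \<partial>lborel)" for n
  proof -
    have "(\<integral>x. \<bar>?f (z n + x) - ?f x\<bar> \<partial>lborel) = (\<integral>x. 2 * ?p n x - (?f x - ?f (z n + x)) \<partial>lborel)"
      by (rule Bochner_Integration.integral_cong) (simp_all add: max_def abs_if)
    also have "\<dots> = 2 * (\<integral>x. ?p n x \<partial>lborel) - ((\<integral>x. ?f x \<partial>lborel) - (\<integral>x. ?f (z n + x) \<partial>lborel))"
      using ip f t by simp
    finally show ?thesis using t by simp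
  qed
  moreover have "(\<lambda>n. \<integral>x. ?p n x \<partial>lborel) \<longlonglongrightarrow> (\<integral>x. (0::real) \<partial>(lborel :: 'a measure))"
  proof (rule integral_dominated_convergence[where w="?f"])
    show "AE x in lborel. (\<lambda>n. ?p n x) \<longlonglongrightarrow> 0"
    proof (rule AE_I2, rule tendsto_eventually)
      fix x :: 'a
      show "\<forall>\<^sub>F n in sequentially. ?p n x = 0"
      proof (cases "x \<in> U")
        case True
        have "(\<lambda>n. z n + x) \<longlonglongrightarrow> 0 + x" by (intro tendsto_intros z)
        then have "\<forall>\<^sub>F n in sequentially. z n + x \<in> U"
          using topological_tendstoD U(1) True by fastforce
        then show ?thesis by eventually_elim (use True in auto)
      qed (auto simp: indicator_def)
    qed
    show "AE x in lborel. norm (?p n x) \<le> ?f x" for n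
      by (auto simp: indicator_def)
  qed (use f in auto)
  ultimately show "(\<lambda>n. \<integral>x. \<bar>?f (z n + x) - ?f x\<bar> \<partial>lborel) \<longlonglongrightarrow> 0"
    using tendsto_mult_right_zero[of _ sequentially 2] by simp
qed

text \<open>Outer regularity: an open superset of slightly larger measure is close in L1, and open
  sets of finite measure are already settled.\<close>

lemma L1_continuous_indicator:
  fixes A :: "'a::euclidean_space set"
  assumes A: "A \<in> sets borel" "emeasure lborel A < \<infinity>"
  shows "L1_continuous (indicator A)"
proof (rule L1_continuous_limit)
  show "integrable lborel (indicator A :: 'a \<Rightarrow> real)" using A by (simp add: integrable_indicator_iff)
  fix e :: real assume e: "e > 0"
  obtain U where U: "open U" "A \<subseteq> U" "emeasure lborel (U - A) < ennreal e"
    using outer_regular_lborel[OF A(1) e] by blast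
  have [measurable]: "A \<in> sets borel" "U \<in> sets borel" using A U by auto
  have d: "emeasure lborel (U - A) < \<infinity>" by (rule order.strict_trans[OF U(3)]) simp
  have "emeasure lborel U \<le> emeasure lborel A + emeasure lborel (U - A)"
    using emeasure_subadditive[of A lborel "U - A"] U(2) by (simp add: Un_absorb1)
  also have "\<dots> < \<infinity>" using A(2) d by (simp add: ennreal_add_less_top)
  finally have fU: "emeasure lborel U < \<infinity>" .
  have "(\<integral>x. \<bar>indicator U x - indicator A x :: real\<bar> \<partial>lborel) = (\<integral>x. indicator (U - A) x \<partial>lborel)"
    by (rule Bochner_Integration.integral_cong) (use U in \<open>auto simp: indicator_def\<close>)
  also have "\<dots> = measure lborel (U - A)" by simp
  also have "\<dots> \<le> e" using U(3) e d by (simp add: measure_def enn2real_leI)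
  finally show "\<exists>g. integrable lborel g \<and> L1_continuous g \<and> (\<integral>x. \<bar>g x - indicator A x\<bar> \<partial>lborel) \<le> e"
    using L1_continuous_indicator_open[OF U(1) fU] fU by (intro exI[of _ "indicator U"]) (auto simp: integrable_indicator_iff)
qed

lemma L1_continuous_integrable:
  fixes f :: "'a::euclidean_space \<Rightarrow> real"
  assumes "integrable lborel f"
  shows "L1_continuous f"
  using assms
proof (induct rule: integrable_induct)
  case (base A c)
  then have "L1_continuous (indicator A :: 'a \<Rightarrow> real)" by (intro L1_continuous_indicator) auto
  moreover have "(\<integral>x. \<bar>indicator A (y + x) *\<^sub>R c - indicator A x *\<^sub>R c\<bar> \<partial>lborel)
      = (\<integral>x. \<bar>indicator A (y + x) - indicator A x\<bar> \<partial>lborel) * \<bar>c\<bar>" for y :: 'a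
    by (simp add: left_diff_distrib[symmetric] abs_mult)
  ultimately show ?case
    unfolding L1_continuous_def using tendsto_mult_left_zero[of _ sequentially "\<bar>c\<bar>"] by simp
next
  case (add f g)
  show ?case unfolding L1_continuous_def
  proof (intro allI impI)
    fix z :: "nat \<Rightarrow> 'a" assume z: "z \<longlonglongrightarrow> 0"
    have f: "(\<lambda>n. \<integral>x. \<bar>f (z n + x) - f x\<bar> \<partial>lborel) \<longlonglongrightarrow> 0" and g: "(\<lambda>n. \<integral>x. \<bar>g (z n + x) - g x\<bar> \<partial>lborel) \<longlonglongrightarrow> 0"
      using add(2,4) z unfolding L1_continuous_def by blast+
    note i = integrable_translation(1)[OF add(1)] integrable_translation(1)[OF add(3)] add(1,3)
    show "(\<lambda>n. \<integral>x. \<bar>(f (z n + x) + g (z n + x)) - (f x + g x)\<bar> \<partial>lborel) \<longlonglongrightarrow> 0"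
    proof (rule tendsto_sandwich[OF _ _ tendsto_const])
      show "(\<lambda>n. (\<integral>x. \<bar>f (z n + x) - f x\<bar> \<partial>lborel) + (\<integral>x. \<bar>g (z n + x) - g x\<bar> \<partial>lborel)) \<longlonglongrightarrow> 0"
        using tendsto_add[OF f g] by simp
      have "(\<integral>x. \<bar>(f (z n + x) + g (z n + x)) - (f x + g x)\<bar> \<partial>lborel)
        \<le> (\<integral>x. \<bar>f (z n + x) - f x\<bar> + \<bar>g (z n + x) - g x\<bar> \<partial>lborel)" for n
        using i by (intro integral_mono) auto
      then show "\<forall>\<^sub>F n in sequentially. (\<integral>x. \<bar>(f (z n + x) + g (z n + x)) - (f x + g x)\<bar> \<partial>lborel)
        \<le> (\<integral>x. \<bar>f (z n + x) - f x\<bar> \<partial>lborel) + (\<integral>x. \<bar>g (z n + x) - g x\<bar> \<partial>lborel)"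
        using i by (intro always_eventually allI) simp
    qed auto
  qed
next
  case (lim f s)
  note fm = borel_measurable_integrable[OF lim(5)] and sm = borel_measurable_integrable[OF lim(1)]
  have "(\<lambda>i. \<integral>x. \<bar>s i x - f x\<bar> \<partial>lborel) \<longlonglongrightarrow> (\<integral>x. (0::real) \<partial>(lborel :: 'a measure))"
  \<comment> \<open>The induction rule bounds the approximants by
    \<open>2 * \<bar>f x\<bar>\<close>; subtracting \<open>f\<close> adds one more.\<close>
  proof (rule integral_dominated_convergence[where w="\<lambda>x. 3 * \<bar>f x\<bar>"])
    show "AE x in lborel. (\<lambda>i. \<bar>s i x - f x\<bar>) \<longlonglongrightarrow> 0"
    proof (rule AE_I2)
      fix x :: 'a
      have "(\<lambda>i. \<bar>s i x - f x\<bar>) \<longlonglongrightarrow> \<bar>f x - f x\<bar>"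
        using lim(3)[of x] by (intro tendsto_intros) auto
      then show "(\<lambda>i. \<bar>s i x - f x\<bar>) \<longlonglongrightarrow> 0" by simp
    qed
    show "AE x in lborel. norm \<bar>s i x - f x\<bar> \<le> 3 * \<bar>f x\<bar>" for i
    proof (rule AE_I2)
      fix x :: 'a
      have "\<bar>s i x\<bar> \<le> 2 * \<bar>f x\<bar>" using lim(4)[of x i] by simp
      then show "norm \<bar>s i x - f x\<bar> \<le> 3 * \<bar>f x\<bar>" by simp
    qed
  qed (use fm sm lim(5) in auto)
  then have c: "(\<lambda>i. \<integral>x. \<bar>s i x - f x\<bar> \<partial>lborel) \<longlonglongrightarrow> 0" by simp
  show ?case
  proof (rule L1_continuous_limit[OF lim(5)])
    fix e :: real assume "e > 0"
    then obtain i where "\<bar>\<integral>x. \<bar>s i x - f x\<bar> \<partial>lborel\<bar> < e"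
      using LIMSEQ_D[OF c, of e] by auto
    then show "\<exists>g. integrable lborel g \<and> L1_continuous g \<and> (\<integral>x. \<bar>g x - f x\<bar> \<partial>lborel) \<le> e"
      using lim(1,2) by (intro exI[of _ "s i"]) auto
  qed
qed

text \<open>After rescaling, the weight no longer depends on \<open>r\<close>; the radius enters
  only as the translation by \<open>r *\<^sub>R w\<close>.\<close>

lemma bump_mean_eq:
  fixes f :: "'a::euclidean_space \<Rightarrow> real"
  assumes f: "f \<in> borel_measurable borel" and r: "r > 0"
  shows "(\<integral>y. f y * bump x r y \<partial>lborel) / (\<integral>y. bump x r y \<partial>lborel)
    = (\<integral>w. f (r *\<^sub>R w + x) * bump 0 1 w \<partial>lborel) / (\<integral>w. bump (0::'a) 1 w \<partial>lborel)"
proof -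
  have b: "bump x r \<in> borel_measurable borel"
    by (rule borel_measurable_continuous_onI[OF Ck_on_imp_continuous_on[OF Ck_on_bump]])
  have "bump x r (x + r *\<^sub>R w) = bump 0 1 w" for w
    using r by (simp add: bump_def power_mult_distrib)
  then have "(\<integral>y. f y * bump x r y \<partial>lborel) = r ^ DIM('a) * (\<integral>w. f (r *\<^sub>R w + x) * bump 0 1 w \<partial>lborel)"
    using lborel_scale[OF _ r, of "\<lambda>y. f y * bump x r y" x] f b by (simp add: add.commute)
  then show ?thesis using integral_bump_scale[OF r, of x] r by simp
qed

text \<open>Minkowski's inequality through Tonelli: the L1 distance is at most the mean, with weight
  \<open>bump 0 1 w\<close>, of the L1 distances between \<open>f\<close> and its translates by
  \<open>r n *\<^sub>R w\<close>. These are bounded by twice the norm of \<open>f\<close> and tend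
  to 0. Stated with \<open>nn_integral\<close>, the claim does not presuppose integrability of
  \<open>M n\<close>.\<close>

lemma bump_mean_L1:
  fixes f :: "'a::euclidean_space \<Rightarrow> real" and r :: "nat \<Rightarrow> real"
  assumes f: "integrable lborel f" and r: "\<And>n. r n > 0" "r \<longlonglongrightarrow> 0"
  defines "M \<equiv> \<lambda>n x. (\<integral>y. f y * bump x (r n) y \<partial>lborel) / (\<integral>y. bump x (r n) y \<partial>lborel)"
  shows "M n \<in> borel_measurable borel"
    and "(\<lambda>n. \<integral>\<^sup>+x. ennreal \<bar>M n x - f x\<bar> \<partial>lborel) \<longlonglongrightarrow> 0"
proof -
  have [measurable]: "f \<in> borel_measurable borel" using borel_measurable_integrable[OF f] by simp
  have [measurable]: "(bump 0 1 :: 'a \<Rightarrow> real) \<in> borel_measurable borel"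
    by (rule borel_measurable_continuous_onI[OF Ck_on_imp_continuous_on[OF Ck_on_bump]])
  let ?b = "bump (0::'a) 1"
  define B where "B = (\<integral>w. ?b w \<partial>lborel)"
  have B: "B > 0" unfolding B_def by (rule integral_bump_pos) simp
  have M: "M n x = (\<integral>w. f (r n *\<^sub>R w + x) * ?b w \<partial>lborel) / B" for n x
    unfolding M_def B_def by (rule bump_mean_eq) (use r in auto)
  show "M n \<in> borel_measurable borel" unfolding M[abs_def] by measurable
  have b1: "\<bar>?b w\<bar> \<le> 1" for w by (auto simp: bump_def flat_def)
  have fi: "integrable lborel (\<lambda>w. f (r n *\<^sub>R w + x))" for n x
  proof -
    have "integrable (density (distr lborel borel (\<lambda>w. x + r n *\<^sub>R w)) (\<lambda>_. ennreal (\<bar>r n\<bar> ^ DIM('a)))) f"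
      using f lborel_affine[of "r n" x] r(1)[of n] by simp
    then have "integrable (distr lborel borel (\<lambda>w. x + r n *\<^sub>R w)) (\<lambda>y. (\<bar>r n\<bar> ^ DIM('a)) *\<^sub>R f y)"
      by (subst (asm) integrable_density) auto
    then have "integrable (distr lborel borel (\<lambda>w. x + r n *\<^sub>R w)) f"
      using r(1)[of n] by simp
    then show ?thesis by (subst (asm) integrable_distr_eq) (auto simp: add.commute)
  qed
  let ?T = "\<lambda>n w. \<integral>x. \<bar>f (r n *\<^sub>R w + x) - f x\<bar> \<partial>lborel"
  have fT: "integrable lborel (\<lambda>x. \<bar>f (y + x) - f x\<bar>)" for y using integrable_translation[OF f] f by auto
  have T: "(\<integral>\<^sup>+x. ennreal \<bar>f (y + x) - f x\<bar> \<partial>lborel) = ennreal (\<integral>x. \<bar>f (y + x) - f x\<bar> \<partial>lborel)" for y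
    by (rule nn_integral_eq_integral[OF fT]) auto
  have le: "(\<integral>\<^sup>+x. ennreal \<bar>M n x - f x\<bar> \<partial>lborel) \<le> (\<integral>\<^sup>+w. ennreal (?b w / B) * ennreal (?T n w) \<partial>lborel)" for n
  proof -
    have "ennreal \<bar>M n x - f x\<bar> \<le> (\<integral>\<^sup>+w. ennreal (?b w / B) * ennreal \<bar>f (r n *\<^sub>R w + x) - f x\<bar> \<partial>lborel)" for x
    proof -
      have i1: "integrable lborel (\<lambda>w. f (r n *\<^sub>R w + x) * ?b w)"
        by (rule integral_convolution_bound(1)[OF fi _ b1]) measurable
      have i2: "integrable lborel (\<lambda>w. f x * ?b w)" using integrable_bump[of 1 "0::'a"] by simp
      have "M n x - f x = (\<integral>w. f (r n *\<^sub>R w + x) * ?b w - f x * ?b w \<partial>lborel) / B"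
        using i1 i2 B by (simp add: M B_def[symmetric] diff_divide_distrib)
      also have "\<dots> = (\<integral>w. (f (r n *\<^sub>R w + x) * ?b w - f x * ?b w) / B \<partial>lborel)" by simp
      finally have "ennreal \<bar>M n x - f x\<bar> \<le> (\<integral>\<^sup>+w. ennreal (norm ((f (r n *\<^sub>R w + x) * ?b w - f x * ?b w) / B)) \<partial>lborel)"
        using integral_norm_bound_ennreal[of lborel "\<lambda>w. (f (r n *\<^sub>R w + x) * ?b w - f x * ?b w) / B"] i1 i2 by simp
      also have "\<dots> = (\<integral>\<^sup>+w. ennreal (?b w / B) * ennreal \<bar>f (r n *\<^sub>R w + x) - f x\<bar> \<partial>lborel)"
      proof (rule nn_integral_cong)
        fix w
        have "norm ((f (r n *\<^sub>R w + x) * ?b w - f x * ?b w) / B) = ?b w / B * \<bar>f (r n *\<^sub>R w + x) - f x\<bar>"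
          using B by (simp add: bump_nonneg abs_mult left_diff_distrib[symmetric])
        then show "ennreal (norm ((f (r n *\<^sub>R w + x) * ?b w - f x * ?b w) / B))
          = ennreal (?b w / B) * ennreal \<bar>f (r n *\<^sub>R w + x) - f x\<bar>"
          using B by (simp add: ennreal_mult'[symmetric] bump_nonneg)
      qed
      finally show ?thesis .
    qed
    then have "(\<integral>\<^sup>+x. ennreal \<bar>M n x - f x\<bar> \<partial>lborel)
      \<le> (\<integral>\<^sup>+x. \<integral>\<^sup>+w. ennreal (?b w / B) * ennreal \<bar>f (r n *\<^sub>R w + x) - f x\<bar> \<partial>lborel \<partial>lborel)"
      by (rule nn_integral_mono)
    also have "\<dots> = (\<integral>\<^sup>+w. \<integral>\<^sup>+x. ennreal (?b w / B) * ennreal \<bar>f (r n *\<^sub>R w + x) - f x\<bar> \<partial>lborel \<partial>lborel)"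
      by (rule lborel_pair.Fubini') measurable
    also have "\<dots> = (\<integral>\<^sup>+w. ennreal (?b w / B) * ennreal (?T n w) \<partial>lborel)"
      by (rule nn_integral_cong) (subst nn_integral_cmult, measurable, simp add: T)
    finally show ?thesis .
  qed
  let ?F = "\<integral>x. \<bar>f x\<bar> \<partial>lborel"
  have T2: "?T n w \<le> 2 * ?F" for n w
  proof -
    have "?T n w \<le> (\<integral>x. \<bar>f (r n *\<^sub>R w + x)\<bar> + \<bar>f x\<bar> \<partial>lborel)"
      using fT f integrable_translation[OF integrable_abs[OF f]] by (intro integral_mono) auto
    then show ?thesis using f integrable_translation[OF integrable_abs[OF f]] by simp
  qed
  have "(\<lambda>n. \<integral>w. ?b w / B * ?T n w \<partial>lborel) \<longlonglongrightarrow> (\<integral>w. (0::real) \<partial>(lborel :: 'a measure))"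
  proof (rule integral_dominated_convergence[where w="\<lambda>w. ?b w / B * (2 * ?F)"])
    show "AE w in lborel. (\<lambda>n. ?b w / B * ?T n w) \<longlonglongrightarrow> 0"
    proof (rule AE_I2)
      fix w :: 'a
      have "(\<lambda>n. r n *\<^sub>R w) \<longlonglongrightarrow> 0 *\<^sub>R w" by (intro tendsto_intros r)
      then have "(\<lambda>n. ?T n w) \<longlonglongrightarrow> 0"
        using L1_continuous_integrable[OF f] unfolding L1_continuous_def by simp
      then show "(\<lambda>n. ?b w / B * ?T n w) \<longlonglongrightarrow> 0" by (rule tendsto_mult_right_zero)
    qed
    show "AE w in lborel. norm (?b w / B * ?T n w) \<le> ?b w / B * (2 * ?F)" for n
    proof (rule AE_I2)
      fix w :: 'a
      have "norm (?b w / B * ?T n w) = ?b w / B * ?T n w" using B by (simp add: bump_nonneg)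
      also have "\<dots> \<le> ?b w / B * (2 * ?F)"
        using B by (intro mult_left_mono T2) (simp add: bump_nonneg)
      finally show "norm (?b w / B * ?T n w) \<le> ?b w / B * (2 * ?F)" .
    qed
    show "integrable lborel (\<lambda>w. ?b w / B * (2 * ?F))" using integrable_bump[of 1 "0::'a"] by simp
  qed measurable
  then have lim: "(\<lambda>n. ennreal (\<integral>w. ?b w / B * ?T n w \<partial>lborel)) \<longlonglongrightarrow> 0"
    using tendsto_ennrealI[of _ 0 sequentially] by simp
  have eq: "(\<integral>\<^sup>+w. ennreal (?b w / B) * ennreal (?T n w) \<partial>lborel) = ennreal (\<integral>w. ?b w / B * ?T n w \<partial>lborel)" for n
  proof -
    have "integrable lborel (\<lambda>w. ?b w / B * ?T n w)"
    proof (rule Bochner_Integration.integrable_bound)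
      show "integrable lborel (\<lambda>w. ?b w / B * (2 * ?F))" using integrable_bump[of 1 "0::'a"] by simp
      show "AE w in lborel. norm (?b w / B * ?T n w) \<le> norm (?b w / B * (2 * ?F))"
      proof (rule AE_I2)
        fix w :: 'a
        have "?b w / B * ?T n w \<le> ?b w / B * (2 * ?F)"
          using B by (intro mult_left_mono T2) (simp add: bump_nonneg)
        then show "norm (?b w / B * ?T n w) \<le> norm (?b w / B * (2 * ?F))"
          using B by (simp add: bump_nonneg abs_mult)
      qed
    qed measurable
    then have "(\<integral>\<^sup>+w. ennreal (?b w / B * ?T n w) \<partial>lborel) = ennreal (\<integral>w. ?b w / B * ?T n w \<partial>lborel)"
      using B by (intro nn_integral_eq_integral) (auto simp: bump_nonneg)
    moreover have "ennreal (?b w / B) * ennreal (?T n w) = ennreal (?b w / B * ?T n w)" for w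
      using B by (subst ennreal_mult) (auto simp: bump_nonneg)
    ultimately show ?thesis by simp
  qed
  show "(\<lambda>n. \<integral>\<^sup>+x. ennreal \<bar>M n x - f x\<bar> \<partial>lborel) \<longlonglongrightarrow> 0"
    by (rule tendsto_sandwich[OF _ _ tendsto_const lim]) (use le eq in auto)
qed

text \<open>By Fatou's lemma the integral over \<open>S\<close> of the liminf of
  \<open>\<bar>M n x - f x\<bar>\<close> is at most the limit 0 of the L1 distances, and at each
  point of \<open>S\<close> that liminf is \<open>\<bar>h x - f x\<bar>\<close>.\<close>

lemma bump_mean_limit:
  fixes f h :: "'a::euclidean_space \<Rightarrow> real" and r :: "nat \<Rightarrow> real"
  assumes f: "integrable lborel f" and r: "\<And>n. r n > 0" "r \<longlonglongrightarrow> 0" and S: "S \<in> sets borel"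
    and lim: "\<And>x. x \<in> S \<Longrightarrow>
      (\<lambda>n. (\<integral>y. f y * bump x (r n) y \<partial>lborel) / (\<integral>y. bump x (r n) y \<partial>lborel)) \<longlonglongrightarrow> h x"
  shows "AE x in lborel. x \<in> S \<longrightarrow> f x = h x"
proof -
  have [measurable]: "f \<in> borel_measurable borel" using borel_measurable_integrable[OF f] by simp
  note [measurable] = S
  define M where "M = (\<lambda>n x. (\<integral>y. f y * bump x (r n) y \<partial>lborel) / (\<integral>y. bump x (r n) y \<partial>lborel))"
  have [measurable]: "M n \<in> borel_measurable borel" for n
    unfolding M_def by (rule bump_mean_L1(1)[OF f r])
  have M2: "(\<lambda>n. \<integral>\<^sup>+x. ennreal \<bar>M n x - f x\<bar> \<partial>lborel) \<longlonglongrightarrow> 0"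
    unfolding M_def by (rule bump_mean_L1(2)[OF f r])
  let ?u = "\<lambda>n x. indicator S x * ennreal \<bar>M n x - f x\<bar>"
  have "(\<integral>\<^sup>+x. liminf (\<lambda>n. ?u n x) \<partial>lborel) \<le> liminf (\<lambda>n. \<integral>\<^sup>+x. ?u n x \<partial>lborel)"
    by (rule nn_integral_liminf) measurable
  also have "\<dots> \<le> liminf (\<lambda>n. \<integral>\<^sup>+x. ennreal \<bar>M n x - f x\<bar> \<partial>lborel)"
    by (intro Liminf_mono always_eventually allI nn_integral_mono) (auto simp: indicator_def)
  also have "\<dots> = 0" by (rule lim_imp_Liminf[OF _ M2]) simp
  finally have "(\<integral>\<^sup>+x. liminf (\<lambda>n. ?u n x) \<partial>lborel) = 0" by simp
  then have "AE x in lborel. liminf (\<lambda>n. ?u n x) = 0"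
    by (subst (asm) nn_integral_0_iff_AE) measurable
  then show ?thesis
  proof eventually_elim
    case (elim x)
    show ?case
    proof
      assume x: "x \<in> S"
      have "(\<lambda>n. ennreal \<bar>M n x - f x\<bar>) \<longlonglongrightarrow> ennreal \<bar>h x - f x\<bar>"
        using lim[OF x] unfolding M_def by (intro tendsto_intros)
      then have "liminf (\<lambda>n. ?u n x) = ennreal \<bar>h x - f x\<bar>"
        using x by (intro lim_imp_Liminf) auto
      then show "f x = h x" using elim by simp
    qed
  qed
qed

section \<open>The weak Helmholtz equation\<close>

text \<open>On a set of finite measure the bound
  \<open>\<bar>g x\<bar> \<le> 1 + \<bar>g x\<bar> powr p\<close> suffices.\<close>

lemma Lp_on_imp_integrable:
  fixes g :: "'a::euclidean_space \<Rightarrow> real"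
  assumes g: "Lp_on p U g" and p: "p \<ge> 1" and U: "U \<in> sets borel" "emeasure lborel U < \<infinity>"
  shows "integrable lebesgue (\<lambda>x. indicator U x * g x)"
proof (rule Bochner_Integration.integrable_bound)
  have "integrable lebesgue (indicator U :: 'a \<Rightarrow> real)"
    using U by (simp add: integrable_indicator_iff)
  moreover have "integrable lebesgue (\<lambda>x. indicator U x * \<bar>g x\<bar> powr p)"
    using g by (simp add: Lp_on_def set_integrable_def)
  ultimately show "integrable lebesgue (\<lambda>x. indicator U x + indicator U x * \<bar>g x\<bar> powr p)"
    by (rule Bochner_Integration.integrable_add)
  show "(\<lambda>x. indicator U x * g x) \<in> borel_measurable lebesgue"
    using g by (simp add: Lp_on_def set_borel_measurable_def)
  have "\<bar>g x\<bar> \<le> 1 + \<bar>g x\<bar> powr p" for x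
  proof (cases "\<bar>g x\<bar> \<le> 1")
    case True
    then show ?thesis using powr_ge_zero[of "\<bar>g x\<bar>" p] by linarith
  next
    case False
    then show ?thesis using powr_mono[OF p, of "\<bar>g x\<bar>"] by simp
  qed
  then show "AE x in lebesgue. norm (indicator U x * g x) \<le> norm (indicator U x + indicator U x * \<bar>g x\<bar> powr p)"
    by (intro AE_I2) (simp add: indicator_def)
qed

text \<open>\<open>G\<close> is the sum of the weak derivatives along \<open>[b, b]\<close>. These
  are merely Lebesgue measurable, so each is first cut off to \<open>U\<close> and replaced by an
  almost everywhere equal Borel function, after which all integrals can be taken over
  \<open>lborel\<close>.\<close>

lemma weak_laplacian:
  fixes u v :: "'a::euclidean_space \<Rightarrow> real"
  assumes D: "open D" and v: "Ck_on 1 D v" and uv: "AE x in lebesgue. x \<in> D \<longrightarrow> u x = v x"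
    and u: "u \<in> sobolev_loc k p D" and k: "k \<ge> 2" and p: "p \<ge> 1"
    and U: "open U" "compact (closure U)" "closure U \<subseteq> D"
  obtains G where "integrable lborel G"
    "\<And>\<phi>. test_function_on U \<phi> \<Longrightarrow> (\<integral>x. v x * laplacian \<phi> x \<partial>lborel) = (\<integral>x. G x * \<phi> x \<partial>lborel)"
proof -
  have us: "u \<in> sobolev k p U" using u U by (auto simp: sobolev_loc_def)
  have UB: "U \<in> sets borel" using U by simp
  have fU: "emeasure lborel U < \<infinity>"
    using emeasure_bounded_finite[of U] compact_imp_bounded[OF U(2)] bounded_subset closure_subset[of U] by blast
  have "\<forall>b\<in>Basis. \<exists>g. Lp_on p U g \<and> weak_deriv_on U [b, b] u g"
    using us k unfolding sobolev_def by auto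
  then obtain g where g: "\<And>b. b \<in> Basis \<Longrightarrow> Lp_on p U (g b)" "\<And>b. b \<in> Basis \<Longrightarrow> weak_deriv_on U [b, b] u (g b)"
    by metis
  have gi: "integrable lebesgue (\<lambda>x. indicator U x * g b x)" if "b \<in> Basis" for b
    by (rule Lp_on_imp_integrable[OF g(1)[OF that] p UB fU])
  have "\<forall>b\<in>Basis. \<exists>g'\<in>borel_measurable lborel. AE x in lborel. indicator U x * g b x = g' x"
    using completion_ex_borel_measurable_real[OF borel_measurable_integrable[OF gi]] by blast
  then obtain g' where g': "\<And>b. b \<in> Basis \<Longrightarrow> g' b \<in> borel_measurable lborel"
    "\<And>b. b \<in> Basis \<Longrightarrow> AE x in lborel. indicator U x * g b x = g' b x" by metis
  have ae: "AE x in lebesgue. indicator U x * g b x = g' b x" if "b \<in> Basis" for b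
    by (rule AE_completion[OF g'(2)[OF that]])
  have ml: "g' b \<in> borel_measurable lebesgue" if "b \<in> Basis" for b
    by (rule measurable_completion[OF g'(1)[OF that]])
  have g'i: "integrable lborel (g' b)" if "b \<in> Basis" for b
  proof -
    have "integrable lebesgue (g' b)"
      using integrable_cong_AE[OF _ ml[OF that] ae[OF that]] gi[OF that] by auto
    then show ?thesis using integrable_completion[OF g'(1)[OF that]] by simp
  qed
  let ?G = "\<lambda>x. \<Sum>b\<in>Basis. g' b x"
  have "(\<integral>x. v x * laplacian \<phi> x \<partial>lborel) = (\<integral>x. ?G x * \<phi> x \<partial>lborel)" if \<phi>: "test_function_on U \<phi>" for \<phi>
  proof -
    let ?K = "closure {x. \<phi> x \<noteq> 0}"
    have K: "compact ?K" "?K \<subseteq> U" and \<phi>k: "\<And>k. Ck_on k UNIV \<phi>" using \<phi> by (auto simp: test_function_on_def)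
    have \<phi>0: "\<phi> x = 0" if "x \<notin> ?K" for x using that closure_subset[of "{x. \<phi> x \<noteq> 0}"] by auto
    have KD: "?K \<subseteq> D" using K(2) U(3) closure_subset[of U] by blast
    note cl = compact_imp_closed[OF K(1)]
    have c\<phi>: "continuous_on UNIV \<phi>" by (rule Ck_on_imp_continuous_on[OF \<phi>k])
    obtain B where B: "\<And>y. \<bar>\<phi> y\<bar> \<le> B"
      using bounded_compact_support[OF c\<phi> K(1) \<phi>0] by blast
    have m\<phi>: "\<phi> \<in> borel_measurable borel" by (rule borel_measurable_continuous_onI[OF c\<phi>])
    have i1: "integrable lborel (\<lambda>x. g' b x * \<phi> x)" if "b \<in> Basis" for b
      by (rule integral_convolution_bound(1)[OF g'i[OF that] m\<phi> B])
    let ?\<psi> = "\<lambda>b. partial_deriv b (partial_deriv b \<phi>)"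
    have \<psi>0: "?\<psi> b x = 0" if "x \<notin> ?K" for b x
      by (rule partial_deriv_eq_0[OF cl partial_deriv_eq_0[OF cl \<phi>0] that])
    have \<psi>c: "Ck_on 0 UNIV (?\<psi> b)" if "b \<in> Basis" for b
      using \<phi>k[of 2] that by (simp add: numeral_2_eq_2)
    have v\<psi>: "continuous_on UNIV (\<lambda>x. v x * ?\<psi> b x)" if "b \<in> Basis" for b
      using Ck_on_mult_compact_support[OF D Ck_on_le[OF v] \<psi>c[OF that] cl KD \<psi>0] by simp
    have i2: "integrable lborel (\<lambda>x. v x * ?\<psi> b x)" if "b \<in> Basis" for b
      by (rule integrable_compact_support[OF v\<psi>[OF that] K(1)]) (simp add: \<psi>0)
    have eq: "(\<integral>x. v x * ?\<psi> b x \<partial>lborel) = (\<integral>x. g' b x * \<phi> x \<partial>lborel)" if b: "b \<in> Basis" for b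
    proof -
      have mv: "(\<lambda>x. v x * ?\<psi> b x) \<in> borel_measurable lborel"
        using borel_measurable_continuous_onI[OF v\<psi>[OF b]] by simp
      have m\<psi>: "?\<psi> b \<in> borel_measurable lebesgue"
        using \<psi>c[OF b] by (intro measurable_completion) (auto intro: borel_measurable_continuous_onI)
      have mu: "(\<lambda>x. indicator U x * u x) \<in> borel_measurable lebesgue"
        using us by (simp add: sobolev_def Lp_on_def set_borel_measurable_def)
      have "(\<integral>x. v x * ?\<psi> b x \<partial>lborel) = (\<integral>x. v x * ?\<psi> b x \<partial>lebesgue)"
        by (rule integral_completion[OF mv, symmetric])
      \<comment> \<open>Here the representative \<open>v\<close> is exchanged for \<open>u\<close>;
        the indicator is harmless because the derivatives of \<open>\<phi>\<close> vanish outside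
        \<open>?K\<close>, a subset of \<open>U\<close>.\<close>
      also have "\<dots> = (\<integral>x. (indicator U x * u x) * ?\<psi> b x \<partial>lebesgue)"
      proof (rule Bochner_Integration.integral_cong_AE)
        show "(\<lambda>x. v x * ?\<psi> b x) \<in> borel_measurable lebesgue" by (rule measurable_completion[OF mv])
        show "(\<lambda>x. (indicator U x * u x) * ?\<psi> b x) \<in> borel_measurable lebesgue"
          by (rule borel_measurable_times[OF mu m\<psi>])
        show "AE x in lebesgue. v x * ?\<psi> b x = (indicator U x * u x) * ?\<psi> b x"
          using uv
        proof eventually_elim
          fix x assume x: "x \<in> D \<longrightarrow> u x = v x"
          show "v x * ?\<psi> b x = (indicator U x * u x) * ?\<psi> b x"
            using x \<psi>0[of x b] K(2) KD by (cases "x \<in> ?K") auto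
        qed
      qed
      also have "\<dots> = (LINT x:U|lebesgue. u x * iter_partial [b, b] \<phi> x)"
        unfolding set_lebesgue_integral_def iter_partial_def by (simp add: mult.assoc)
      also have "\<dots> = (LINT x:U|lebesgue. g b x * \<phi> x)"
        using g(2)[OF b] \<phi> by (simp add: weak_deriv_on_def)
      also have "\<dots> = (\<integral>x. (indicator U x * g b x) * \<phi> x \<partial>lebesgue)"
        unfolding set_lebesgue_integral_def by (simp add: mult.assoc)
      also have "\<dots> = (\<integral>x. g' b x * \<phi> x \<partial>lebesgue)"
      proof (rule Bochner_Integration.integral_cong_AE)
        have "\<phi> \<in> borel_measurable lebesgue" by (rule measurable_completion) (use m\<phi> in simp)
        then show "(\<lambda>x. (indicator U x * g b x) * \<phi> x) \<in> borel_measurable lebesgue"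
          "(\<lambda>x. g' b x * \<phi> x) \<in> borel_measurable lebesgue"
          using borel_measurable_integrable[OF gi[OF b]] ml[OF b] by (auto intro!: borel_measurable_times)
        show "AE x in lebesgue. (indicator U x * g b x) * \<phi> x = g' b x * \<phi> x"
          using ae[OF b] by eventually_elim simp
      qed
      also have "\<dots> = (\<integral>x. g' b x * \<phi> x \<partial>lborel)"
        by (rule integral_completion) (use g'(1)[OF b] m\<phi> in auto)
      finally show ?thesis .
    qed
    have "(\<integral>x. v x * laplacian \<phi> x \<partial>lborel) = (\<Sum>b\<in>Basis. \<integral>x. v x * ?\<psi> b x \<partial>lborel)"
      unfolding laplacian_def sum_distrib_left using i2 by simp
    also have "\<dots> = (\<Sum>b\<in>Basis. \<integral>x. g' b x * \<phi> x \<partial>lborel)" using eq by simp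
    also have "\<dots> = (\<integral>x. ?G x * \<phi> x \<partial>lborel)" unfolding sum_distrib_right using i1 by simp
    finally show ?thesis .
  qed
  moreover have "integrable lborel ?G" using g'i by simp
  ultimately show ?thesis using that by blast
qed

text \<open>The bump means of the weak Laplacian \<open>G\<close> are the quotients of
  \<open>flux_limit\<close>, so they tend to \<open>- \<mu>\<^sup>2 * v x\<close> at every point of
  \<open>U\<close>; this forces \<open>G\<close> to equal \<open>- \<mu>\<^sup>2 * v\<close> almost
  everywhere on \<open>U\<close>, which contains the support of \<open>\<phi>\<close>.\<close>

lemma weak_helmholtz:
  fixes u v :: "'a::euclidean_space \<Rightarrow> real"
  assumes D: "open D" and v: "Ck_on 1 D v" and uv: "AE x in lebesgue. x \<in> D \<longrightarrow> u x = v x"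
    and u: "u \<in> sobolev_loc k p D" and k: "k \<ge> 2" and p: "p \<ge> 1"
    and flux: "\<And>x. x \<in> D \<Longrightarrow> ((\<lambda>s. mean_flux v x s / s) \<longlongrightarrow> - (\<mu>\<^sup>2 / DIM('a)) * v x) (at_right 0)"
    and U: "open U" "compact (closure U)" "closure U \<subseteq> D" and \<phi>: "test_function_on U \<phi>"
  shows "(\<integral>x. v x * laplacian \<phi> x \<partial>lborel) = - \<mu>\<^sup>2 * (\<integral>x. v x * \<phi> x \<partial>lborel)"
proof -
  obtain G where G: "integrable lborel G"
    "\<And>\<phi>. test_function_on U \<phi> \<Longrightarrow> (\<integral>x. v x * laplacian \<phi> x \<partial>lborel) = (\<integral>x. G x * \<phi> x \<partial>lborel)"
    using weak_laplacian[OF D v uv u k p U] by blast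
  let ?r = "\<lambda>n. inverse (real (Suc n))"
  have r: "filterlim ?r (at_right 0) sequentially"
    by (rule tendsto_imp_filterlim_at_right[OF LIMSEQ_inverse_real_of_nat]) (auto intro: always_eventually)
  have ae: "AE x in lborel. x \<in> U \<longrightarrow> G x = - \<mu>\<^sup>2 * v x"
  proof (rule bump_mean_limit[OF G(1), of ?r])
    fix x assume x: "x \<in> U"
    then have xD: "x \<in> D" using U(3) closure_subset[of U] by blast
    obtain e where e: "e > 0" "cball x e \<subseteq> U" using U(1) x open_contains_cball by blast
    have "((\<lambda>n. (\<integral>y. v y * laplacian (bump x (?r n)) y \<partial>lborel) / (\<integral>y. bump x (?r n) y \<partial>lborel))
        \<longlonglongrightarrow> DIM('a) * (- (\<mu>\<^sup>2 / DIM('a)) * v x))"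
      by (rule filterlim_compose[OF flux_limit[OF D v xD flux[OF xD]] r])
    \<comment> \<open>The bump is admissible as a test function on \<open>U\<close> only once its
      radius is below \<open>e\<close>, which depends on \<open>x\<close>; eventual equality is
      enough.\<close>
    moreover have "\<forall>\<^sub>F n in sequentially. (\<integral>y. v y * laplacian (bump x (?r n)) y \<partial>lborel) / (\<integral>y. bump x (?r n) y \<partial>lborel)
        = (\<integral>y. G y * bump x (?r n) y \<partial>lborel) / (\<integral>y. bump x (?r n) y \<partial>lborel)"
      using order_tendstoD(2)[OF LIMSEQ_inverse_real_of_nat e(1)]
    proof eventually_elim
      case (elim n)
      then have "cball x (?r n) \<subseteq> U" using e(2) by (meson less_imp_le order.trans subset_cball)
      then show ?case using G(2)[OF test_function_on_bump[of "?r n" x U]] by simp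
    qed
    ultimately show "(\<lambda>n. (\<integral>y. G y * bump x (?r n) y \<partial>lborel) / (\<integral>y. bump x (?r n) y \<partial>lborel)) \<longlonglongrightarrow> - \<mu>\<^sup>2 * v x"
      using Lim_transform_eventually by fastforce
  qed (use U LIMSEQ_inverse_real_of_nat in auto)
  let ?K = "closure {x. \<phi> x \<noteq> 0}"
  have K: "compact ?K" "?K \<subseteq> U" and \<phi>k: "\<And>k. Ck_on k UNIV \<phi>" using \<phi> by (auto simp: test_function_on_def)
  have \<phi>0: "\<phi> x = 0" if "x \<notin> ?K" for x using that closure_subset[of "{x. \<phi> x \<noteq> 0}"] by auto
  have KD: "?K \<subseteq> D" using K(2) U(3) closure_subset[of U] by blast
  have "continuous_on UNIV (\<lambda>x. v x * \<phi> x)"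
    using Ck_on_mult_compact_support[OF D Ck_on_le[OF v] \<phi>k[of 0] compact_imp_closed[OF K(1)] KD \<phi>0] by simp
  then have m: "(\<lambda>x. v x * \<phi> x) \<in> borel_measurable lborel" by (simp add: borel_measurable_continuous_onI)
  have "(\<integral>x. v x * laplacian \<phi> x \<partial>lborel) = (\<integral>x. G x * \<phi> x \<partial>lborel)" by (rule G(2)[OF \<phi>])
  also have "\<dots> = (\<integral>x. - \<mu>\<^sup>2 * (v x * \<phi> x) \<partial>lborel)"
  proof (rule Bochner_Integration.integral_cong_AE)
    show "AE x in lborel. G x * \<phi> x = - \<mu>\<^sup>2 * (v x * \<phi> x)"
      using ae
    proof eventually_elim
      fix x assume "x \<in> U \<longrightarrow> G x = - \<mu>\<^sup>2 * v x"
      then show "G x * \<phi> x = - \<mu>\<^sup>2 * (v x * \<phi> x)"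
        using \<phi>0[of x] K(2) by (cases "x \<in> ?K") auto
    qed
    have "\<phi> \<in> borel_measurable borel"
      by (rule borel_measurable_continuous_onI[OF Ck_on_imp_continuous_on[OF \<phi>k]])
    then show "(\<lambda>x. G x * \<phi> x) \<in> borel_measurable lborel"
      using borel_measurable_integrable[OF G(1)] by simp
  qed (use m in auto)
  finally show ?thesis by simp
qed

text \<open>For continuous \<open>g\<close> the means converge at every point. Applied to the
  classical Laplacian at the very end, this gives the equation everywhere rather than almost
  everywhere.\<close>

lemma bump_mean_continuous:
  fixes g :: "'a::euclidean_space \<Rightarrow> real"
  assumes D: "open D" "x \<in> D" and g: "continuous_on D g"
    and int: "\<And>r. r > 0 \<Longrightarrow> cball x r \<subseteq> D \<Longrightarrow> integrable lborel (\<lambda>y. g y * bump x r y)"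
  shows "((\<lambda>r. (\<integral>y. g y * bump x r y \<partial>lborel) / (\<integral>y. bump x r y \<partial>lborel)) \<longlongrightarrow> g x) (at_right 0)"
proof (rule tendstoI)
  fix e :: real assume e: "e > 0"
  obtain R where R: "R > 0" "cball x R \<subseteq> D" using D open_contains_cball by blast
  have "isCont g x" using g D continuous_on_eq_continuous_at by blast
  then obtain d where d: "d > 0" "\<And>y. dist y x < d \<Longrightarrow> dist (g y) (g x) < e / 2"
    unfolding continuous_at_eps_delta using e half_gt_zero by metis
  show "\<forall>\<^sub>F r in at_right 0. dist ((\<integral>y. g y * bump x r y \<partial>lborel) / (\<integral>y. bump x r y \<partial>lborel)) (g x) < e"
  proof (rule eventually_at_rightI[of 0 "min d R"])
    fix r assume "r \<in> {0<..<min d R}"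
    then have r: "r > 0" "r < d" "r < R" by auto
    then have "cball x r \<subseteq> D" using R by auto
    note i = int[OF r(1) this]
    let ?I = "\<integral>y. bump x r y \<partial>lborel"
    have I: "?I > 0" by (rule integral_bump_pos[OF r(1)])
    note ib = integrable_bump[OF r(1), of x]
    have "\<bar>(\<integral>y. g y * bump x r y \<partial>lborel) - g x * ?I\<bar> = \<bar>\<integral>y. g y * bump x r y - g x * bump x r y \<partial>lborel\<bar>"
      using i ib by simp
    also have "\<dots> \<le> (\<integral>y. \<bar>g y * bump x r y - g x * bump x r y\<bar> \<partial>lborel)" by (rule integral_abs_bound)
    also have "\<dots> \<le> (\<integral>y. e / 2 * bump x r y \<partial>lborel)"
    proof (rule integral_mono)
      fix y
      show "\<bar>g y * bump x r y - g x * bump x r y\<bar> \<le> e / 2 * bump x r y"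
      proof (cases "dist y x < r")
        case True
        then have "\<bar>g y - g x\<bar> \<le> e / 2" using d(2)[of y] r by (simp add: dist_real_def)
        from mult_right_mono[OF this bump_nonneg[of x r y]] show ?thesis
          by (simp only: left_diff_distrib[symmetric] abs_mult abs_of_nonneg[OF bump_nonneg])
      next
        case False
        then have "bump x r y = 0" using r by (intro bump_eq_0) (auto simp: dist_norm)
        then show ?thesis by simp
      qed
    qed (use i ib in auto)
    also have "\<dots> = e / 2 * ?I" by simp
    finally have "\<bar>(\<integral>y. g y * bump x r y \<partial>lborel) - g x * ?I\<bar> / ?I \<le> e / 2"
      using I by (simp add: pos_divide_le_eq)
    moreover have "((\<integral>y. g y * bump x r y \<partial>lborel) - g x * ?I) / ?I = (\<integral>y. g y * bump x r y \<partial>lborel) / ?I - g x"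
      using I by (simp add: diff_divide_distrib)
    then have "\<bar>(\<integral>y. g y * bump x r y \<partial>lborel) - g x * ?I\<bar> / ?I = dist ((\<integral>y. g y * bump x r y \<partial>lborel) / ?I) (g x)"
      using I abs_divide[of "(\<integral>y. g y * bump x r y \<partial>lborel) - g x * ?I" ?I] by (simp add: dist_real_def)
    ultimately show "dist ((\<integral>y. g y * bump x r y \<partial>lborel) / ?I) (g x) < e" using e by linarith
  qed (use d R in auto)
qed

section \<open>Interior regularity\<close>

text \<open>The antiderivative is normalised at \<open>b\<close>, minus the integral from
  \<open>t\<close> to \<open>b\<close>, since \<open>f\<close> may be singular at the left end
  \<open>c\<close>.\<close>

lemma antiderivative_zero_right:
  fixes f :: "real \<Rightarrow> real"
  assumes f: "continuous_on {c<..} f" and zero: "\<And>t. t \<ge> b \<Longrightarrow> f t = 0" and c: "c < b"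
  obtains F where "\<And>t. t > c \<Longrightarrow> (F has_real_derivative f t) (at t)" "\<And>t. t \<ge> b \<Longrightarrow> F t = 0"
proof -
  define F where "F t = - integral {t..b} f" for t
  have "(F has_real_derivative f t) (at t)" if t: "t > c" for t
  proof -
    \<comment> \<open>A compact interval inside the domain with \<open>t\<close> and
      \<open>b\<close> in its interior; on it \<open>F\<close> differs from the integral starting at
      \<open>p\<close> by a constant.\<close>
    define p where "p = (c + min t b) / 2"
    define q where "q = max t b + 1"
    have pq: "c < p" "p < t" "p < b" "t < q" "b < q" using t c by (auto simp: p_def q_def min_def)
    have cont: "continuous_on {p..q} f" using pq by (intro continuous_on_subset[OF f]) auto
    have int: "f integrable_on {x..y}" if "p \<le> x" "y \<le> q" for x y
      using that by (intro integrable_continuous_real continuous_on_subset[OF cont]) auto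
    have "((\<lambda>x. integral {p..x} f) has_real_derivative f t) (at t within {p..q})"
      using pq by (intro integral_has_real_derivative[OF cont]) auto
    then have "((\<lambda>x. integral {p..x} f) has_real_derivative f t) (at t)"
      using pq at_within_Icc_at[of p t q] by simp
    then have d: "((\<lambda>x. integral {p..x} f - integral {p..b} f) has_real_derivative f t) (at t)"
      by (auto intro!: derivative_eq_intros)
    have eq: "integral {p..x} f - integral {p..b} f = F x" if x: "p < x" "x < q" for x
    proof (cases "x \<le> b")
      case True
      then have "integral {p..x} f + integral {x..b} f = integral {p..b} f"
        using x pq int[of p b] by (intro Henstock_Kurzweil_Integration.integral_combine) auto
      then show ?thesis by (simp add: F_def)
    next
      \<comment> \<open>To the right of \<open>b\<close> the interval in the definition of
        \<open>F\<close> is empty, so \<open>F x = 0\<close> by default; this is the right value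
        because \<open>f\<close> vanishes there.\<close>
      case False
      then have "integral {p..b} f + integral {b..x} f = integral {p..x} f"
        using x pq int[of p x] by (intro Henstock_Kurzweil_Integration.integral_combine) auto
      moreover have "integral {b..x} f = integral {b..x} (\<lambda>_. 0)"
        by (rule Henstock_Kurzweil_Integration.integral_cong) (use zero in auto)
      ultimately show ?thesis using False by (simp add: F_def)
    qed
    show ?thesis
      by (rule has_field_derivative_transform_within_open[OF d, of "{p<..<q}"]) (use pq eq in auto)
  qed
  moreover have "F t = 0" if "t \<ge> b" for t using that by (cases "t = b") (auto simp: F_def)
  ultimately show ?thesis using that by blast
qed

text \<open>The denominator may vanish from \<open>d\<close> on, but there the numerator is already
  0 and so is the quotient. The ranges \<open>t < d\<close> and \<open>t > b\<close> overlap and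
  cover \<open>T\<close>.\<close>

lemma Ck_on_cutoff_quotient:
  fixes Z j :: "real \<Rightarrow> real"
  assumes T: "open T" and Z: "Ck_on k T Z" and j: "Ck_on k T j"
    and j0: "\<And>t. t \<in> T \<Longrightarrow> t < d \<Longrightarrow> j t \<noteq> 0" and zero: "\<And>t. t \<ge> b \<Longrightarrow> Z t = 0" and bd: "b < d"
  shows "Ck_on k T (\<lambda>t. Z t / j t)"
proof (rule Ck_on_local)
  fix t assume t: "t \<in> T"
  show "\<exists>S. open S \<and> t \<in> S \<and> Ck_on k S (\<lambda>t. Z t / j t)"
  proof (cases "t < d")
    case True
    have "Ck_on k (T \<inter> {..<d}) (\<lambda>t. Z t / j t)"
      by (intro Ck_on_divide Ck_on_subset[OF Z] Ck_on_subset[OF j]) (use T j0 in auto)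
    then show ?thesis using True t T by (intro exI[of _ "T \<inter> {..<d}"]) auto
  next
    case False
    have "Ck_on k {b<..} (\<lambda>t. Z t / j t)"
      by (rule Ck_on_cong[OF _ _ Ck_on_const[of _ k 0]]) (auto simp: zero)
    then show ?thesis using False bd by (intro exI[of _ "{b<..}"]) auto
  qed
qed

lemma Ck_on_shift_powr: "Ck_on k {-e<..} (\<lambda>t::real. (t + e) powr a)"
proof (rule Ck_on_compose[OF _ Ck_on_powr])
  show "Ck_on k {-e<..} (\<lambda>t. t + e)"
    by (intro Ck_on_add Ck_on_const Ck_on_bounded_linear[OF _ bounded_linear_ident]) auto
qed auto

text \<open>With \<open>E = j P\<close> and \<open>P' = q / j\<^sup>2\<close>, where \<open>j\<close> is the entire radial solution of the Helmholtz
  equation, the radial Helmholtz operator applied to \<open>E\<close> is \<open>(4 t q' + 2 m q) / j\<close>, without any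
  remainder of lower order. The choice \<open>q = (t + e)\<^bsup>-m/2\<^esup> X\<close> produces an approximate
  identity plus a term supported where \<open>X' \<noteq> 0\<close>.\<close>

lemma parametrix_profile:
  fixes \<mu> b d e :: real and m :: nat and X h :: "real \<Rightarrow> real"
  defines "\<nu> \<equiv> real m / 2 - 1"
  defines "j \<equiv> \<lambda>t. bessel_entire \<nu> (\<mu>\<^sup>2 / 4 * t)"
  assumes m: "m \<ge> 2" and jpos: "\<And>t. \<bar>t\<bar> < d \<Longrightarrow> j t > 0" and b: "0 < b" "b < d"
    and X: "\<And>k. Ck_on k UNIV X" and X': "\<And>t. (X has_real_derivative - h t) (at t)"
    and X0: "\<And>t. t \<ge> b \<Longrightarrow> X t = 0" and h0: "\<And>t. t \<ge> b \<Longrightarrow> h t = 0" and e: "e > 0"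
  obtains T and E E1 E2 :: "real \<Rightarrow> real" where "open T" "{0..} \<subseteq> T" "\<And>k. Ck_on k T E"
    "\<And>t. t \<in> T \<Longrightarrow> (E has_real_derivative E1 t) (at t)"
    "\<And>t. t \<in> T \<Longrightarrow> (E1 has_real_derivative E2 t) (at t)"
    "\<And>t. t \<ge> b \<Longrightarrow> E t = 0"
    "\<And>t. t \<ge> 0 \<Longrightarrow> 4 * t * E2 t + 2 * real m * E1 t + \<mu>\<^sup>2 * E t
      = 2 * real m * e * (t + e) powr (- real m / 2 - 1) * X t / j t - 4 * t * h t * (t + e) powr (- real m / 2) / j t"
proof -
  have \<nu>: "\<nu> \<ge> 0" using m by (simp add: \<nu>_def)
  define c where "c = \<mu>\<^sup>2 / 4"
  define j1 where "j1 = (\<lambda>t. - c * bessel_entire (\<nu> + 1) (c * t))"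
  define j2 where "j2 = (\<lambda>t. c\<^sup>2 * bessel_entire (\<nu> + 2) (c * t))"
  have lin: "((\<lambda>t. c * t) has_real_derivative c) (at t)" for t
    by (auto intro!: derivative_eq_intros)
  have dj: "(j has_real_derivative j1 t) (at t)" for t
    using DERIV_chain2[OF bessel_entire_has_derivative[OF \<nu>] lin, of t]
    unfolding j_def j1_def c_def by (simp add: mult.commute)
  have dj1: "(j1 has_real_derivative j2 t) (at t)" for t
  proof -
    have "((\<lambda>t. bessel_entire (\<nu> + 1) (c * t)) has_real_derivative - bessel_entire (\<nu> + 1 + 1) (c * t) * c) (at t)"
      by (rule DERIV_chain2[OF bessel_entire_has_derivative lin]) (use \<nu> in simp)
    from DERIV_cmult[OF this, of "- c"] show ?thesis
      unfolding j1_def j2_def by (simp add: power2_eq_square mult_ac add.assoc)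
  qed
  have ode: "4 * t * j2 t + 2 * real m * j1 t + \<mu>\<^sup>2 * j t = 0" for t
  proof -
    have "4 * t * j2 t + 2 * real m * j1 t + \<mu>\<^sup>2 * j t
      = 4 * c * ((c * t) * bessel_entire (\<nu> + 2) (c * t) - (\<nu> + 1) * bessel_entire (\<nu> + 1) (c * t) + bessel_entire \<nu> (c * t))"
      unfolding j1_def j2_def j_def c_def[symmetric] by (simp add: \<nu>_def c_def power2_eq_square algebra_simps)
    then show ?thesis using bessel_entire_recurrence[OF \<nu>] by simp
  qed
  have Ckj: "Ck_on k UNIV j" for k
    unfolding j_def by (rule Ck_on_compose[OF open_UNIV Ck_on_bessel_entire[OF \<nu>]
        Ck_on_bounded_linear[OF open_UNIV bounded_linear_mult_right]]) simp
  \<comment> \<open>To the right of \<open>- e\<close> the base \<open>t + e\<close> is positive,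
    and to the right of \<open>- d\<close> negative arguments stay where \<open>j\<close> is
    positive.\<close>
  define T where "T = {- min e d<..}"
  have T: "open T" "{0..} \<subseteq> T" "T \<subseteq> {-e<..}" using e b by (auto simp: T_def)
  have jT: "j t > 0" if "t \<in> T" "t < d" for t using that by (intro jpos) (auto simp: T_def)
  have jT0: "j t \<noteq> 0" if "t \<in> T" "t < d" for t using jT[OF that] by simp
  define A where "A = (\<lambda>t. (t + e) powr (- real m / 2 - 1))"
  define q where "q = (\<lambda>t. (t + e) powr (- real m / 2) * X t)"
  define q1 where "q1 = (\<lambda>t. (- real m / 2) * A t * X t - (t + e) powr (- real m / 2) * h t)"
  define Q where "Q = (\<lambda>t. q t / (j t)\<^sup>2)"
  \<comment> \<open>From \<open>d\<close> on \<open>j\<close> may have zeros; \<open>Q\<close>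
    vanishes identically there, so its derivative is set to 0.\<close>
  define Q1 where "Q1 = (\<lambda>t. if t < d then q1 t / (j t)\<^sup>2 - 2 * q t * j1 t / (j t) ^ 3 else 0)"
  have CkQ: "Ck_on k T Q" for k
    unfolding Q_def
  proof (rule Ck_on_cutoff_quotient[OF T(1) _ _ _ _ b(2)])
    show "Ck_on k T q" unfolding q_def
      by (intro Ck_on_mult T Ck_on_subset[OF X] Ck_on_subset[OF Ck_on_shift_powr[of _ e]]) (use T in auto)
    show "Ck_on k T (\<lambda>t. (j t)\<^sup>2)" unfolding power2_eq_square
      by (intro Ck_on_mult T Ck_on_subset[OF Ckj]) auto
  qed (use jT0 X0 in \<open>auto simp: q_def\<close>)
  have dq: "(q has_real_derivative q1 t) (at t)" if "t \<in> T" for t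
  proof -
    have "t + e > 0" using that T(3) by auto
    then have "((\<lambda>t. (t + e) powr (- real m / 2)) has_real_derivative (- real m / 2) * A t) (at t)"
      unfolding A_def by (auto intro!: derivative_eq_intros)
    from DERIV_mult[OF this X'[of t]] show ?thesis
      unfolding q_def q1_def by (simp add: mult_ac)
  qed
  have dQ: "(Q has_real_derivative Q1 t) (at t)" if t: "t \<in> T" for t
  proof (cases "t < d")
    case True
    then have j: "j t > 0" using jT t by blast
    have "(Q has_real_derivative (q1 t * (j t)\<^sup>2 - q t * (2 * j t * j1 t)) / ((j t)\<^sup>2 * (j t)\<^sup>2)) (at t)"
      unfolding Q_def by (rule DERIV_divide[OF dq[OF t]]) (use j in \<open>auto intro!: derivative_eq_intros dj\<close>)
    also have "(q1 t * (j t)\<^sup>2 - q t * (2 * j t * j1 t)) / ((j t)\<^sup>2 * (j t)\<^sup>2) = Q1 t"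
      using j True by (simp add: Q1_def field_simps power2_eq_square power3_eq_cube)
    finally show ?thesis .
  next
    case False
    then have "t > b" using b by simp
    have "((\<lambda>_. 0) has_real_derivative Q1 t) (at t)" using False by (simp add: Q1_def)
    then show ?thesis
      by (rule has_field_derivative_transform_within_open[of _ _ _ "{b<..}"])
        (use \<open>t > b\<close> in \<open>auto simp: Q_def q_def X0\<close>)
  qed
  have "continuous_on {- min e d<..} Q" using Ck_on_imp_continuous_on[OF CkQ[of 0]] by (simp add: T_def)
  then obtain P where P: "\<And>t. t > - min e d \<Longrightarrow> (P has_real_derivative Q t) (at t)" "\<And>t. t \<ge> b \<Longrightarrow> P t = 0"
    by (rule antiderivative_zero_right[of "- min e d" Q b]) (use X0 b e in \<open>auto simp: Q_def q_def\<close>)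
  have dP: "(P has_real_derivative Q t) (at t)" if "t \<in> T" for t using P(1) that by (simp add: T_def)
  have CkP: "Ck_on k T P" for k
    by (rule Ck_on_SucD) (rule Ck_on_SucI_real[OF T(1) dP CkQ])
  define E where "E = (\<lambda>t. j t * P t)"
  define E1 where "E1 = (\<lambda>t. j t * Q t + j1 t * P t)"
  define E2 where "E2 = (\<lambda>t. j t * Q1 t + j1 t * Q t + (j1 t * Q t + j2 t * P t))"
  show ?thesis
  proof (rule that[of T E E1 E2])
    show "Ck_on k T E" for k unfolding E_def by (intro Ck_on_mult T CkP Ck_on_subset[OF Ckj]) auto
    show "(E has_real_derivative E1 t) (at t)" if "t \<in> T" for t
      unfolding E_def E1_def using DERIV_mult'[OF dj dP[OF that]] by (simp add: mult.commute)
    show "(E1 has_real_derivative E2 t) (at t)" if "t \<in> T" for t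
      unfolding E1_def E2_def
      using DERIV_add[OF DERIV_mult'[OF dj dQ[OF that]] DERIV_mult'[OF dj1 dP[OF that]]] by (simp add: mult.commute)
    show "E t = 0" if "t \<ge> b" for t using P(2)[OF that] by (simp add: E_def)
    show "4 * t * E2 t + 2 * real m * E1 t + \<mu>\<^sup>2 * E t
      = 2 * real m * e * (t + e) powr (- real m / 2 - 1) * X t / j t - 4 * t * h t * (t + e) powr (- real m / 2) / j t"
      if t: "t \<ge> 0" for t
    proof (cases "t < d")
      case False
      then have "t \<ge> b" using b by simp
      then show ?thesis
        using False P(2)[of t] X0[of t] h0[of t] by (simp add: E_def E1_def E2_def Q_def Q1_def q_def)
    next
      case True
      then have j: "j t > 0" using jT t T(2) by auto
      have pw: "(t + e) powr (- real m / 2) = (t + e) * A t"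
        using t e powr_add[of "t + e" 1 "- real m / 2 - 1"] by (simp add: A_def)
      \<comment> \<open>Reduction of order: the terms containing \<open>P\<close> collect into the
        equation for \<open>j\<close> and drop out.\<close>
      have "4 * t * E2 t + 2 * real m * E1 t + \<mu>\<^sup>2 * E t
        = P t * (4 * t * j2 t + 2 * real m * j1 t + \<mu>\<^sup>2 * j t) + (8 * t * j1 t * Q t + 4 * t * j t * Q1 t + 2 * real m * j t * Q t)"
        by (simp add: E_def E1_def E2_def algebra_simps)
      also have "\<dots> = 8 * t * j1 t * Q t + 4 * t * j t * Q1 t + 2 * real m * j t * Q t" unfolding ode by simp
      \<comment> \<open>Dividing \<open>q\<close> by the square of \<open>j\<close> makes the two
        terms with \<open>j1\<close> cancel.\<close>
      also have "\<dots> = (4 * t * q1 t + 2 * real m * q t) / j t"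
        using j True by (simp add: Q_def Q1_def field_simps power2_eq_square power3_eq_cube)
      \<comment> \<open>The exponent -m/2 pays off: \<open>- 2 m t A X\<close> from
        \<open>q1\<close> and \<open>2 m (t + e) A X\<close> from \<open>q\<close> leave
        \<open>2 m e A X\<close>. For \<open>e = 0\<close> and constant \<open>X\<close> nothing
        would remain, as for a genuine fundamental solution away from its pole.\<close>
      also have "4 * t * q1 t + 2 * real m * q t = 2 * real m * e * A t * X t - 4 * t * h t * ((t + e) * A t)"
        unfolding q1_def q_def pw by (simp add: algebra_simps)
      finally show ?thesis unfolding pw by (simp add: diff_divide_distrib A_def)
    qed
  qed (use T in auto)
qed

text \<open>\<open>h\<close> is a smooth bump between \<open>a\<close> and \<open>b\<close>, and
  \<open>X\<close> integrates it from \<open>t\<close> to \<open>b\<close>; hence \<open>X\<close>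
  is constant to the left of \<open>a\<close> and 0 beyond \<open>b\<close>. It is not normalised, a
  positive value at 0 is enough.\<close>

lemma cutoff_profile:
  fixes a b :: real
  assumes ab: "0 < a" "a < b"
  obtains X h where "\<And>k. Ck_on k UNIV X" "\<And>k. Ck_on k UNIV h" "\<And>t. (X has_real_derivative - h t) (at t)"
    "\<And>t. t \<ge> b \<Longrightarrow> X t = 0" "\<And>t. t \<ge> b \<Longrightarrow> h t = 0" "\<And>t. t \<le> a \<Longrightarrow> h t = 0" "X 0 > 0"
proof -
  define h where "h t = flat 0 (t - a) * flat 0 (b - t)" for t
  have sh: "Ck_on k UNIV (\<lambda>t. t - a)" "Ck_on k UNIV (\<lambda>t. b - t)" for k
    by (intro Ck_on_diff Ck_on_const Ck_on_bounded_linear[OF _ bounded_linear_ident] open_UNIV)+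
  have Ckh: "Ck_on k UNIV h" for k
    unfolding h_def[abs_def]
    by (intro Ck_on_mult Ck_on_compose[OF open_UNIV Ck_on_flat sh(1)] Ck_on_compose[OF open_UNIV Ck_on_flat sh(2)]) auto
  have h0: "h t = 0" if "t \<ge> b \<or> t \<le> a" for t using that by (auto simp: h_def flat_eq_0)
  have hn: "h t \<ge> 0" for t by (simp add: h_def flat_nonneg)
  have hp: "h t > 0" if "a < t" "t < b" for t using that by (simp add: h_def flat_pos)
  have "\<exists>X. (\<forall>t > c. (X has_real_derivative - h t) (at t)) \<and> (\<forall>t\<ge>b. X t = 0)" if "c < b" for c
  proof -
    have "continuous_on {c<..} (\<lambda>t. - h t)"
      by (intro continuous_on_minus continuous_on_subset[OF Ck_on_imp_continuous_on[OF Ckh]]) auto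
    from antiderivative_zero_right[OF this _ that] h0 show ?thesis by (metis (no_types, lifting) add.inverse_neutral)
  qed
  then obtain X1 where X1: "\<And>t. t > - 1 \<Longrightarrow> (X1 has_real_derivative - h t) (at t)" "\<And>t. t \<ge> b \<Longrightarrow> X1 t = 0"
    using ab by (metis less_trans neg_less_0_iff_less zero_less_one)
  \<comment> \<open>The antiderivative \<open>X1\<close> is controlled only to the right of -1; its
    constant value between 0 and \<open>a\<close> extends it to the whole line.\<close>
  define X where "X t = (if t < a then X1 0 else X1 t)" for t
  have const: "X1 t = X1 0" if "0 \<le> t" "t \<le> a" for t
  proof (rule DERIV_isconst2[of 0 a X1 t])
    show "continuous_on {0..a} X1"
      by (rule DERIV_continuous_on) (rule has_field_derivative_at_within[OF X1(1)], auto)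
    show "(X1 has_real_derivative 0) (at x)" if "0 < x" "x < a" for x
      using X1(1)[of x] h0[of x] that by simp
  qed (use that ab in auto)
  have dX: "(X has_real_derivative - h t) (at t)" for t
  proof (cases "t < a")
    case True
    have "((\<lambda>_. X1 0) has_real_derivative - h t) (at t)" using True h0[of t] by simp
    then show ?thesis
      by (rule has_field_derivative_transform_within_open[of _ _ _ "{..<a}"]) (use True in \<open>auto simp: X_def\<close>)
  next
    case False
    show ?thesis
    proof (rule has_field_derivative_transform_within_open[OF X1(1), of _ "{0<..}"])
      show "X1 x = X x" if "x \<in> {0<..}" for x
        using const[of x] that by (simp add: X_def)
    qed (use False ab in auto)
  qed
  have "X1 b < X1 a"
  proof (rule DERIV_neg_imp_decreasing_open[OF ab(2)])
    show "\<exists>y. (X1 has_real_derivative y) (at x) \<and> y < 0" if "a < x" "x < b" for x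
      using X1(1)[of x] hp[OF that] that ab by (intro exI[of _ "- h x"]) auto
    show "continuous_on {a..b} X1"
      by (rule DERIV_continuous_on) (rule has_field_derivative_at_within[OF X1(1)], use ab in auto)
  qed
  then have "X 0 > 0" using X1(2)[of b] const[of a] ab by (simp add: X_def)
  moreover have "Ck_on k UNIV X" for k
  proof -
    have "Ck_on k UNIV (\<lambda>t. (-1) * h t)" by (intro Ck_on_mult Ck_on_const Ckh) auto
    then show ?thesis by (intro Ck_on_SucD[OF Ck_on_SucI_real[OF open_UNIV dX]]) simp
  qed
  moreover have "X t = 0" if "t \<ge> b" for t using that ab X1(2)[OF that] by (simp add: X_def)
  ultimately show ?thesis using Ckh dX h0 by (intro that[of X h]) auto
qed

text \<open>The profile of the approximate identity contained in the first term of
  \<open>parametrix_profile\<close>. In polar coordinates the radial integrand is at most a constant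
  times (s^2 + 1)^(-3/2), hence a constant times the derivative of \<open>arctan\<close>.\<close>

lemma integrable_poisson_profile:
  defines "\<kappa> \<equiv> \<lambda>w::'a::euclidean_space. ((norm w)\<^sup>2 + 1) powr (- real DIM('a) / 2 - 1)"
  shows "integrable lborel \<kappa>" and "(\<integral>w. \<kappa> w \<partial>lborel) > 0"
proof -
  let ?m = "real DIM('a)"
  have cont: "continuous_on UNIV \<kappa>" unfolding \<kappa>_def
    by (intro continuous_intros) (auto simp: add_nonneg_eq_0_iff)
  have [measurable]: "\<kappa> \<in> borel_measurable borel" by (rule borel_measurable_continuous_onI[OF cont])
  have [measurable]: "ball (0::'a) 1 \<in> sets borel" by simp
  have pos: "\<kappa> w > 0" for w by (auto simp: \<kappa>_def add_nonneg_eq_0_iff)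
  have bd: "?m * s ^ (DIM('a) - 1) * (s\<^sup>2 + 1) powr (- ?m / 2 - 1) \<le> ?m * inverse (1 + s\<^sup>2)" if s: "s \<ge> 0" for s
  proof -
    have p: "s\<^sup>2 + 1 > 0" "s\<^sup>2 + 1 \<ge> 1" using zero_le_power2[of s] by linarith+
    have "s ^ (DIM('a) - 1) \<le> sqrt (s\<^sup>2 + 1) ^ (DIM('a) - 1)"
      by (rule power_mono[OF _ s]) (use real_sqrt_le_mono[of "s\<^sup>2" "s\<^sup>2 + 1"] s in simp)
    also have "\<dots> = (s\<^sup>2 + 1) powr ((?m - 1) / 2)"
    proof -
      have "sqrt y ^ n = (y powr (1 / 2)) powr real n" if "y > 0" for y :: real and n
        using that by (subst powr_realpow) (auto simp: powr_half_sqrt)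
      from this[OF p(1)] show ?thesis by (simp add: powr_powr of_nat_diff Suc_le_eq)
    qed
    finally have "s ^ (DIM('a) - 1) * (s\<^sup>2 + 1) powr (- ?m / 2 - 1) \<le> (s\<^sup>2 + 1) powr ((?m - 1) / 2) * (s\<^sup>2 + 1) powr (- ?m / 2 - 1)"
      by (rule mult_right_mono) simp
    also have "\<dots> = (s\<^sup>2 + 1) powr (- 3 / 2)" by (simp add: powr_add[symmetric] field_simps)
    also have "\<dots> \<le> (s\<^sup>2 + 1) powr (- 1)" by (rule powr_mono) (use p in auto)
    also have "\<dots> = inverse (1 + s\<^sup>2)" using p by (simp add: powr_minus add.commute)
    finally show ?thesis by (simp add: mult.assoc mult_left_mono)
  qed
  have "(\<integral>\<^sup>+w. ennreal (\<kappa> w) \<partial>lborel) = (\<integral>\<^sup>+s. \<integral>\<^sup>+w. indicator {0<..} s * indicator (ball 0 1) w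
      * ennreal (?m * s ^ (DIM('a) - 1)) * ennreal (\<kappa> (s *\<^sub>R sgn (w::'a))) \<partial>lborel \<partial>lborel)"
    by (rule nn_integral_polar) measurable
  also have "\<dots> \<le> (\<integral>\<^sup>+s. \<integral>\<^sup>+w. indicator (ball (0::'a) 1) w * (ennreal (?m * inverse (1 + s\<^sup>2)) * indicator {0..} s) \<partial>lborel \<partial>lborel)"
  proof (intro nn_integral_mono nn_integral_mono_AE, rule AE_mp[OF AE_lborel_singleton[of 0]], intro AE_I2 impI)
    fix s :: real and w :: 'a assume w: "w \<noteq> 0"
    show "indicator {0<..} s * indicator (ball 0 1) w * ennreal (?m * s ^ (DIM('a) - 1)) * ennreal (\<kappa> (s *\<^sub>R sgn w))
      \<le> indicator (ball (0::'a) 1) w * (ennreal (?m * inverse (1 + s\<^sup>2)) * indicator {0..} s)"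
    proof (cases "s > 0 \<and> w \<in> ball 0 1")
      case True
      then have "ennreal (?m * s ^ (DIM('a) - 1)) * ennreal (\<kappa> (s *\<^sub>R sgn w)) \<le> ennreal (?m * inverse (1 + s\<^sup>2))"
        using bd[of s] w pos[of "s *\<^sub>R sgn w"] unfolding \<kappa>_def
        by (subst ennreal_mult[symmetric]) (auto simp: norm_sgn power_mult_distrib intro!: ennreal_leI)
      then show ?thesis using True by simp
    qed auto
  qed
  also have "\<dots> = (\<integral>\<^sup>+s. emeasure lborel (ball (0::'a) 1) * (ennreal (?m * inverse (1 + s\<^sup>2)) * indicator {0..} s) \<partial>lborel)"
    by (intro nn_integral_cong) (simp add: nn_integral_multc)
  also have "\<dots> = emeasure lborel (ball (0::'a) 1) * (\<integral>\<^sup>+s. ennreal (?m * inverse (1 + s\<^sup>2)) * indicator {0..} s \<partial>lborel)"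
    by (rule nn_integral_cmult) measurable
  also have "(\<integral>\<^sup>+s. ennreal (?m * inverse (1 + s\<^sup>2)) * indicator {0..} s \<partial>lborel) = ennreal (?m * (pi / 2) - ?m * arctan 0)"
  proof (rule nn_integral_FTC_atLeast)
    show "((\<lambda>s. ?m * arctan s) has_real_derivative ?m * inverse (1 + s\<^sup>2)) (at s)" for s
      by (auto intro!: derivative_eq_intros)
    show "((\<lambda>s. ?m * arctan s) \<longlongrightarrow> ?m * (pi / 2)) at_top"
      by (intro tendsto_intros tendsto_arctan_at_top)
  qed (auto simp: add_nonneg_nonneg)
  also have "emeasure lborel (ball (0::'a) 1) * \<dots> < \<infinity>"
    using emeasure_lborel_ball_finite[of "0::'a" 1] by (simp add: ennreal_mult_less_top)
  finally have "(\<integral>\<^sup>+w. ennreal (norm (\<kappa> w)) \<partial>lborel) < \<infinity>" using pos by (simp add: less_imp_le)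
  then show i: "integrable lborel \<kappa>" by (intro integrableI_bounded) auto
  have "(\<integral>w. \<kappa> w \<partial>lborel) \<noteq> 0"
  proof
    assume "(\<integral>w. \<kappa> w \<partial>lborel) = 0"
    then have "AE w in lborel. \<kappa> w = 0"
      by (subst (asm) integral_nonneg_eq_0_iff_AE[OF i]) (auto intro: less_imp_le pos)
    then have "AE w in lborel. w \<in> ({} :: 'a set)" by eventually_elim (use pos in \<open>simp add: less_imp_neq\<close>, metis less_irrefl pos)
    then have "AE w in lebesgue. w \<in> ({} :: 'a set)" by (rule AE_completion)
    then show False using mem_closed_if_AE_lebesgue[of "{} :: 'a set"] by blast
  qed
  moreover have "(\<integral>w. \<kappa> w \<partial>lborel) \<ge> 0" by (intro integral_nonneg_AE AE_I2 less_imp_le pos)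
  ultimately show "(\<integral>w. \<kappa> w \<partial>lborel) > 0" by simp
qed

lemma Ck_on_radial_cutoff_quotient:
  fixes x :: "'a::euclidean_space" and Z j :: "real \<Rightarrow> real"
  assumes c: "c < 0" and Z: "Ck_on k {c<..} Z" and j: "Ck_on k {c<..} j"
    and j0: "\<And>t. c < t \<Longrightarrow> t < d \<Longrightarrow> j t \<noteq> 0" and zero: "\<And>t. t \<ge> b \<Longrightarrow> Z t = 0" and bd: "b < d"
  shows "Ck_on k UNIV (\<lambda>y. Z ((norm (y - x))\<^sup>2) / j ((norm (y - x))\<^sup>2))"
proof (rule Ck_on_compose[OF open_UNIV _ Ck_on_norm_square])
  show "Ck_on k {c<..} (\<lambda>t. Z t / j t)"
    by (rule Ck_on_cutoff_quotient[OF _ Z j j0 zero bd]) auto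
  show "range (\<lambda>y. (norm (y - x))\<^sup>2) \<subseteq> {c<..}"
    using c by (auto intro: less_le_trans)
qed

lemma tendsto_mollified:
  fixes A \<kappa> :: "'a::euclidean_space \<Rightarrow> real"
  assumes A: "continuous_on UNIV A" and bd: "\<And>z. \<bar>A z\<bar> \<le> M" and \<kappa>: "integrable lborel \<kappa>"
    and \<epsilon>: "\<epsilon> \<longlonglongrightarrow> 0"
  shows "(\<lambda>n. \<integral>w. A (\<epsilon> n *\<^sub>R w) * \<kappa> w \<partial>lborel) \<longlonglongrightarrow> A 0 * (\<integral>w. \<kappa> w \<partial>lborel)"
proof -
  have [measurable]: "A \<in> borel_measurable borel" by (rule borel_measurable_continuous_onI[OF A])
  note [measurable] = borel_measurable_integrable[OF \<kappa>]
  have "(\<lambda>n. \<integral>w. A (\<epsilon> n *\<^sub>R w) * \<kappa> w \<partial>lborel) \<longlonglongrightarrow> (\<integral>w. A 0 * \<kappa> w \<partial>lborel)"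
  proof (rule integral_dominated_convergence[where w="\<lambda>w. M * \<bar>\<kappa> w\<bar>"])
    show "AE w in lborel. (\<lambda>n. A (\<epsilon> n *\<^sub>R w) * \<kappa> w) \<longlonglongrightarrow> A 0 * \<kappa> w"
    proof (rule AE_I2)
      fix w :: 'a
      have "(\<lambda>n. \<epsilon> n *\<^sub>R w) \<longlonglongrightarrow> 0 *\<^sub>R w" by (intro tendsto_intros \<epsilon>)
      then have "(\<lambda>n. A (\<epsilon> n *\<^sub>R w)) \<longlonglongrightarrow> A 0"
        using A continuous_on_tendsto_compose[of UNIV A "\<lambda>n. \<epsilon> n *\<^sub>R w" 0 sequentially] by simp
      then show "(\<lambda>n. A (\<epsilon> n *\<^sub>R w) * \<kappa> w) \<longlonglongrightarrow> A 0 * \<kappa> w" by (intro tendsto_intros)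
    qed
    show "AE w in lborel. norm (A (\<epsilon> n *\<^sub>R w) * \<kappa> w) \<le> M * \<bar>\<kappa> w\<bar>" for n
      using bd by (intro AE_I2) (simp add: abs_mult mult_right_mono)
  qed (use \<kappa> in \<open>auto intro!: integrable_mult_right integrable_abs\<close>)
  then show ?thesis by simp
qed

text \<open>Testing with the profile of \<open>parametrix_profile\<close> balances two terms. As its
  parameter tends to 0, the first concentrates at \<open>x\<close> and yields
  \<open>C * v x\<close>; the second lives on a shell around \<open>x\<close> and converges to the
  integral against \<open>K\<close>. Since \<open>r\<close>, \<open>C\<close> and \<open>K\<close>
  are chosen before \<open>D\<close>, \<open>v\<close> and \<open>x\<close>, one kernel serves all
  centres.\<close>

lemma helmholtz_representation:
  fixes \<mu> r0 :: real
  assumes dim: "DIM('a::euclidean_space) \<ge> 2" and r0: "r0 > 0"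
  obtains r C and K :: "'a::euclidean_space \<Rightarrow> real" where "0 < r" "r < r0" "C \<noteq> 0"
    "\<And>k. Ck_on k UNIV K" "\<And>z. z \<notin> cball 0 r \<Longrightarrow> K z = 0"
    "\<And>D v x. \<lbrakk>open D; continuous_on D v; cball x r \<subseteq> D;
      \<And>\<phi>. test_function_on (ball x (2 * r)) \<phi> \<Longrightarrow>
        (\<integral>y. v y * laplacian \<phi> y \<partial>lborel) = - \<mu>\<^sup>2 * (\<integral>y. v y * \<phi> y \<partial>lborel)\<rbrakk>
      \<Longrightarrow> C * v x = (\<integral>y. v y * K (y - x) \<partial>lborel)"
proof -
  let ?m = "real DIM('a)"
  define \<nu> where "\<nu> = ?m / 2 - 1"
  define j where "j = (\<lambda>t. bessel_entire \<nu> (\<mu>\<^sup>2 / 4 * t))"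
  have \<nu>: "\<nu> \<ge> 0" using dim by (simp add: \<nu>_def)
  have Ckj: "Ck_on k UNIV j" for k
    unfolding j_def by (rule Ck_on_compose[OF open_UNIV Ck_on_bessel_entire[OF \<nu>]
        Ck_on_bounded_linear[OF open_UNIV bounded_linear_mult_right]]) simp
  have j0: "j 0 > 0"
  proof -
    have "Gamma (\<nu> + 1) > 0" by (rule Gamma_real_pos) (use \<nu> in simp)
    then show ?thesis by (simp add: j_def bessel_entire_0 rGamma_inverse_Gamma)
  qed
  have "isCont j 0"
    using Ck_on_imp_continuous_on[OF Ckj[of 0]] by (simp add: continuous_on_eq_continuous_at)
  then obtain d where d: "d > 0" "\<And>t. dist t 0 < d \<Longrightarrow> dist (j t) (j 0) < j 0"
    using j0 unfolding continuous_at_eps_delta by blast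
  have jpos: "j t > 0" if "\<bar>t\<bar> < d" for t
    using d(2)[of t] that by (auto simp: dist_real_def abs_if split: if_splits)
  have jne: "j t \<noteq> 0" if "- d < t" "t < d" for t using jpos[of t] that by (cases "t \<ge> 0") auto
  \<comment> \<open>The bound by \<open>sqrt d / 2\<close> gives \<open>r\<^sup>2 < d\<close>, so
    the cutoff ends before \<open>j\<close> can vanish.\<close>
  define r where "r = min (r0 / 2) (sqrt d / 2)"
  have r: "r > 0" "r < r0" using r0 d(1) by (auto simp: r_def)
  have rd: "r\<^sup>2 < d"
  proof -
    have "r\<^sup>2 \<le> (sqrt d / 2)\<^sup>2" using r by (intro power_mono) (auto simp: r_def)
    then show ?thesis using d(1) by (simp add: power_divide)
  qed
  have r2: "0 < r\<^sup>2" using r by simp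
  have a: "0 < r\<^sup>2 / 2" "r\<^sup>2 / 2 < r\<^sup>2" using r by auto
  obtain X h where X: "\<And>k. Ck_on k UNIV X" "\<And>t. (X has_real_derivative - h t) (at t)"
      "\<And>t. t \<ge> r\<^sup>2 \<Longrightarrow> X t = 0" "X 0 > 0"
    and h: "\<And>k. Ck_on k UNIV h" "\<And>t. t \<ge> r\<^sup>2 \<Longrightarrow> h t = 0" "\<And>t. t \<le> r\<^sup>2 / 2 \<Longrightarrow> h t = 0"
    by (rule cutoff_profile[OF a]) blast
  define \<kappa> where "\<kappa> = (\<lambda>w::'a. ((norm w)\<^sup>2 + 1) powr (- ?m / 2 - 1))"
  note \<kappa> = integrable_poisson_profile[where 'a='a, folded \<kappa>_def]
  define C where "C = X 0 / j 0 * (2 * ?m * (\<integral>w. \<kappa> w \<partial>lborel))"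
  define Z where "Z t = 4 * t * h t" for t
  have CkZ: "Ck_on k UNIV Z" for k
    unfolding Z_def[abs_def]
    by (intro Ck_on_mult h open_UNIV Ck_on_const Ck_on_bounded_linear bounded_linear_ident)
  have Z0: "Z t = 0" if "t \<ge> r\<^sup>2 \<or> t \<le> r\<^sup>2 / 2" for t using h that by (auto simp: Z_def)
  \<comment> \<open>The limit of the shell term as its parameter tends to 0. The negative power
    causes no singularity, since \<open>Z\<close> vanishes up to
    \<open>r\<^sup>2 / 2\<close>.\<close>
  define K where "K z = Z ((norm z)\<^sup>2) / j ((norm z)\<^sup>2) * ((norm z)\<^sup>2) powr (- ?m / 2)" for z :: 'a
  show ?thesis
  proof (rule that[OF r])
    show "C \<noteq> 0" using X(4) j0 \<kappa>(2) by (simp add: C_def)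
    show "K z = 0" if "z \<notin> cball 0 r" for z
    proof -
      have "(norm z)\<^sup>2 \<ge> r\<^sup>2" using that r by (intro power_mono) auto
      then show ?thesis using Z0 by (simp add: K_def)
    qed
    show "Ck_on k UNIV K" for k
    proof -
      have "Ck_on k UNIV (\<lambda>t. Z t / j t * t powr (- ?m / 2))"
      proof (rule Ck_on_local)
        fix t :: real
        have q: "Ck_on k {-d<..} (\<lambda>t. Z t / j t)"
          by (rule Ck_on_cutoff_quotient[OF _ Ck_on_subset[OF CkZ] Ck_on_subset[OF Ckj] jne _ rd])
            (use Z0 in auto)
        have "Ck_on k {0<..} (\<lambda>t. Z t / j t * t powr (- ?m / 2))"
          using d(1) by (intro Ck_on_mult Ck_on_subset[OF q] Ck_on_powr) auto
        moreover have "Ck_on k {..<r\<^sup>2 / 2} (\<lambda>t. Z t / j t * t powr (- ?m / 2))"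
          by (rule Ck_on_cong[OF _ _ Ck_on_const[of _ k 0]]) (use Z0 in auto)
        ultimately show "\<exists>S. open S \<and> t \<in> S \<and> Ck_on k S (\<lambda>t. Z t / j t * t powr (- ?m / 2))"
          using a(1) by (cases "t > 0") (metis open_greaterThan greaterThan_iff, metis open_lessThan lessThan_iff linorder_not_less le_less_trans)
      qed
      from Ck_on_compose[OF open_UNIV this Ck_on_norm_square[where x=0]] show ?thesis
        by (simp add: K_def[abs_def])
    qed
    fix D :: "'a set" and v :: "'a \<Rightarrow> real" and x :: 'a
    assume D: "open D" and v: "continuous_on D v" and sub: "cball x r \<subseteq> D"
      and weak: "\<And>\<phi>. test_function_on (ball x (2 * r)) \<phi> \<Longrightarrow>
        (\<integral>y. v y * laplacian \<phi> y \<partial>lborel) = - \<mu>\<^sup>2 * (\<integral>y. v y * \<phi> y \<partial>lborel)"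
    let ?t = "\<lambda>y. (norm (y - x))\<^sup>2"
    have t0: "?t y \<ge> r\<^sup>2" if "y \<notin> cball x r" for y
      using that r by (intro power_mono) (auto simp: dist_norm norm_minus_commute)
    have cont: "continuous_on UNIV (\<lambda>y. v y * (Y (?t y) / j (?t y)))"
      if "c < 0" "- d \<le> c" "Ck_on 0 {c<..} Y" "\<And>t. t \<ge> r\<^sup>2 \<Longrightarrow> Y t = 0" for Y c
    proof -
      have "Ck_on 0 UNIV (\<lambda>y. Y (?t y) / j (?t y))"
        by (rule Ck_on_radial_cutoff_quotient[OF that(1,3) Ck_on_subset[OF Ckj] jne that(4) rd]) (use that in auto)
      then have "Ck_on 0 UNIV (\<lambda>y. v y * (Y (?t y) / j (?t y)))"
        using v that(4) t0 by (intro Ck_on_mult_compact_support[OF D _ _ closed_cball sub]) auto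
      then show ?thesis by simp
    qed
    have int: "integrable lborel (\<lambda>y. v y * (Y (?t y) / j (?t y)))"
      if "c < 0" "- d \<le> c" "Ck_on 0 {c<..} Y" "\<And>t. t \<ge> r\<^sup>2 \<Longrightarrow> Y t = 0" for Y c
      by (rule integrable_compact_support[OF cont[OF that] compact_cball[of x r]]) (use that(4) t0 in auto)
    let ?L1 = "\<lambda>e t. 2 * ?m * e * (t + e) powr (- ?m / 2 - 1) * X t"
    let ?L2 = "\<lambda>e t. 4 * t * h t * (t + e) powr (- ?m / 2)"
    have id: "integrable lborel (\<lambda>y. v y * (?L1 e (?t y) / j (?t y)))"
      "(\<integral>y. v y * (?L1 e (?t y) / j (?t y)) \<partial>lborel) = (\<integral>y. v y * (?L2 e (?t y) / j (?t y)) \<partial>lborel)"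
      if e: "e > 0" for e
    proof -
      let ?c = "- min e d"
      have c: "?c < 0" "- d \<le> ?c" "{?c<..} \<subseteq> {-e<..}" using e d(1) by auto
      have L1: "Ck_on 0 {?c<..} (?L1 e)"
        by (intro Ck_on_mult Ck_on_const Ck_on_subset[OF X(1)] Ck_on_subset[OF Ck_on_shift_powr c(3)]) auto
      have L2: "Ck_on 0 {?c<..} (?L2 e)"
        by (intro Ck_on_mult Ck_on_const Ck_on_bounded_linear[OF _ bounded_linear_ident]
            Ck_on_subset[OF h(1)] Ck_on_subset[OF Ck_on_shift_powr c(3)]) auto
      show i1: "integrable lborel (\<lambda>y. v y * (?L1 e (?t y) / j (?t y)))"
        by (rule int[OF c(1,2) L1]) (use X in simp)
      have i2: "integrable lborel (\<lambda>y. v y * (?L2 e (?t y) / j (?t y)))"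
        by (rule int[OF c(1,2) L2]) (use h in simp)
      obtain T E E1 E2 where E: "open T" "{0..} \<subseteq> T" "\<And>k. Ck_on k T E"
        "\<And>t. t \<in> T \<Longrightarrow> (E has_real_derivative E1 t) (at t)"
        "\<And>t. t \<in> T \<Longrightarrow> (E1 has_real_derivative E2 t) (at t)"
        "\<And>t. t \<ge> r\<^sup>2 \<Longrightarrow> E t = 0"
        "\<And>t. t \<ge> 0 \<Longrightarrow> 4 * t * E2 t + 2 * ?m * E1 t + \<mu>\<^sup>2 * E t = ?L1 e t / j t - ?L2 e t / j t"
      proof (rule parametrix_profile[OF dim jpos[unfolded j_def \<nu>_def] r2 rd X(1,2,3) h(2) e])
        fix T E E1 E2
        assume *: "open T" "{0..} \<subseteq> T" "\<And>k. Ck_on k T E"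
        "\<And>t. t \<in> T \<Longrightarrow> (E has_real_derivative E1 t) (at t)"
        "\<And>t. t \<in> T \<Longrightarrow> (E1 has_real_derivative E2 t) (at t)"
        "\<And>t. t \<ge> r\<^sup>2 \<Longrightarrow> E t = 0"
        "\<And>t. t \<ge> 0 \<Longrightarrow> 4 * t * E2 t + 2 * ?m * E1 t + \<mu>\<^sup>2 * E t
          = ?L1 e t / bessel_entire (?m / 2 - 1) (\<mu>\<^sup>2 / 4 * t) - ?L2 e t / bessel_entire (?m / 2 - 1) (\<mu>\<^sup>2 / 4 * t)"
        show thesis
        proof (rule that[of T E E1 E2])
          show "Ck_on k T E" for k by fact
        qed (use * in \<open>auto simp: j_def \<nu>_def\<close>)
      qed
      let ?\<phi> = "\<lambda>y. E (?t y)"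
      have \<phi>: "test_function_on (ball x (2 * r)) ?\<phi>"
        by (rule test_function_on_radial[OF E(1,2,3,6) r(1)]) (use r in auto)
      then have c\<phi>: "continuous_on UNIV ?\<phi>"
        unfolding test_function_on_def using Ck_on_imp_continuous_on by blast
      have "continuous_on UNIV (\<lambda>y. v y * ?\<phi> y)"
        using Ck_on_mult_compact_support[OF D, of 0 v ?\<phi> "cball x r"] v c\<phi> sub E(6) t0 by auto
      then have i3: "integrable lborel (\<lambda>y. v y * ?\<phi> y)"
        by (rule integrable_compact_support[OF _ compact_cball[of x r]]) (use E(6) t0 in auto)
      have lap: "v y * laplacian ?\<phi> y = v y * (?L1 e (?t y) / j (?t y)) - v y * (?L2 e (?t y) / j (?t y)) - \<mu>\<^sup>2 * (v y * ?\<phi> y)" for y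
      proof -
        have "laplacian ?\<phi> y = ?L1 e (?t y) / j (?t y) - ?L2 e (?t y) / j (?t y) - \<mu>\<^sup>2 * ?\<phi> y"
          using laplacian_radial[OF E(1,2,4,5), of x y] E(7)[of "?t y"] by simp
        then show ?thesis by (simp add: right_diff_distrib mult_ac)
      qed
      \<comment> \<open>Computing the left side of the weak equation by the profile identity makes
        the terms with \<open>\<mu>\<^sup>2\<close> cancel; what remains equates the two terms of
        the parametrix.\<close>
      have "- \<mu>\<^sup>2 * (\<integral>y. v y * ?\<phi> y \<partial>lborel) = (\<integral>y. v y * laplacian ?\<phi> y \<partial>lborel)"
        using weak[OF \<phi>] by simp
      also have "\<dots> = (\<integral>y. v y * (?L1 e (?t y) / j (?t y)) \<partial>lborel) - (\<integral>y. v y * (?L2 e (?t y) / j (?t y)) \<partial>lborel)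
          - \<mu>\<^sup>2 * (\<integral>y. v y * ?\<phi> y \<partial>lborel)"
        unfolding lap using i1 i2 i3 by simp
      finally show "(\<integral>y. v y * (?L1 e (?t y) / j (?t y)) \<partial>lborel) = (\<integral>y. v y * (?L2 e (?t y) / j (?t y)) \<partial>lborel)"
        by simp
    qed
    let ?\<epsilon> = "\<lambda>n. inverse (real (Suc n))"
    have \<epsilon>: "?\<epsilon> \<longlonglongrightarrow> 0" by (rule LIMSEQ_inverse_real_of_nat)
    define A where "A z = v (x + z) * (X ((norm z)\<^sup>2) / j ((norm z)\<^sup>2))" for z
    have cA: "continuous_on UNIV A"
    proof -
      have "continuous_on UNIV (\<lambda>y. v y * (X (?t y) / j (?t y)))"
        by (rule cont[of "-d"]) (use d(1) X Ck_on_subset[OF X(1)] in auto)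
      moreover have "continuous_on UNIV (\<lambda>z. x + z)" by (intro continuous_intros)
      ultimately have "continuous_on UNIV (\<lambda>z. v (x + z) * (X (?t (x + z)) / j (?t (x + z))))"
        by (rule continuous_on_compose2) simp
      then show ?thesis by (simp add: A_def[abs_def])
    qed
    have A0: "A z = 0" if "z \<notin> cball 0 r" for z
    proof -
      have "(norm z)\<^sup>2 \<ge> r\<^sup>2" using that r by (intro power_mono) auto
      then show ?thesis using X by (simp add: A_def)
    qed
    obtain M where M: "\<And>z. \<bar>A z\<bar> \<le> M"
      using bounded_compact_support[OF cA compact_cball A0] by blast
    \<comment> \<open>Parameter \<open>e\<^sup>2\<close> and length scale \<open>e\<close> match:
      the Jacobian \<open>e ^ DIM('a)\<close>, the factor \<open>e\<^sup>2\<close> and the power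
      \<open>(e\<^sup>2) powr (- ?m / 2 - 1)\<close> multiply to 1, leaving \<open>\<kappa>\<close>
      without any \<open>e\<close>.\<close>
    have lhs: "(\<integral>y. v y * (?L1 (e\<^sup>2) (?t y) / j (?t y)) \<partial>lborel) = (\<integral>w. A (e *\<^sub>R w) * (2 * ?m * \<kappa> w) \<partial>lborel)"
      if e: "e > 0" for e
    proof -
      have "(\<lambda>y. v y * (?L1 (e\<^sup>2) (?t y) / j (?t y))) \<in> borel_measurable borel"
        using borel_measurable_integrable[OF id(1)[of "e\<^sup>2"]] e by simp
      from lborel_scale[OF this e, of x]
      have "(\<integral>y. v y * (?L1 (e\<^sup>2) (?t y) / j (?t y)) \<partial>lborel)
        = (\<integral>w. e ^ DIM('a) * (v (x + e *\<^sub>R w) * (?L1 (e\<^sup>2) ((norm (e *\<^sub>R w))\<^sup>2) / j ((norm (e *\<^sub>R w))\<^sup>2))) \<partial>lborel)"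
        by (subst Bochner_Integration.integral_mult_right_zero) simp
      also have "\<dots> = (\<integral>w. A (e *\<^sub>R w) * (2 * ?m * \<kappa> w) \<partial>lborel)"
      proof (rule Bochner_Integration.integral_cong[OF refl])
        fix w :: 'a
        have "((norm (e *\<^sub>R w))\<^sup>2 + e\<^sup>2) powr (- ?m / 2 - 1) = (e\<^sup>2) powr (- ?m / 2 - 1) * \<kappa> w"
        proof -
          have "(norm (e *\<^sub>R w))\<^sup>2 + e\<^sup>2 = e\<^sup>2 * ((norm w)\<^sup>2 + 1)"
            by (simp add: power_mult_distrib algebra_simps)
          then show ?thesis unfolding \<kappa>_def by (simp add: powr_mult)
        qed
        moreover have "e ^ DIM('a) * e\<^sup>2 * (e\<^sup>2) powr (- ?m / 2 - 1) = 1"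
        proof -
          have "e ^ DIM('a) * e\<^sup>2 = e powr (?m + 2)"
            using e powr_realpow[OF e, of "DIM('a)"] powr_realpow[OF e, of 2] by (simp add: powr_add)
          moreover have "(e\<^sup>2) powr (- ?m / 2 - 1) = e powr (2 * (- ?m / 2 - 1))"
            using e powr_realpow[OF e, of 2] powr_powr[of e 2 "- ?m / 2 - 1"] by simp
          moreover have "(?m + 2) + 2 * (- ?m / 2 - 1) = 0" by simp
          ultimately show ?thesis using e by (metis powr_add powr_zero_eq_one less_irrefl)
        qed
        ultimately have p: "e ^ DIM('a) * (e\<^sup>2 * ((norm (e *\<^sub>R w))\<^sup>2 + e\<^sup>2) powr (- ?m / 2 - 1)) = \<kappa> w"
          by (simp add: mult.assoc[symmetric])
        have "e ^ DIM('a) * (v (x + e *\<^sub>R w) * (?L1 (e\<^sup>2) ((norm (e *\<^sub>R w))\<^sup>2) / j ((norm (e *\<^sub>R w))\<^sup>2)))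
          = A (e *\<^sub>R w) * (2 * ?m * (e ^ DIM('a) * (e\<^sup>2 * ((norm (e *\<^sub>R w))\<^sup>2 + e\<^sup>2) powr (- ?m / 2 - 1))))"
          unfolding A_def by (simp add: mult_ac)
        then show "e ^ DIM('a) * (v (x + e *\<^sub>R w) * (?L1 (e\<^sup>2) ((norm (e *\<^sub>R w))\<^sup>2) / j ((norm (e *\<^sub>R w))\<^sup>2)))
          = A (e *\<^sub>R w) * (2 * ?m * \<kappa> w)" unfolding p .
      qed
      finally show ?thesis .
    qed
    have "(\<lambda>n. \<integral>w. A (?\<epsilon> n *\<^sub>R w) * (2 * ?m * \<kappa> w) \<partial>lborel) \<longlonglongrightarrow> A 0 * (\<integral>w. 2 * ?m * \<kappa> w \<partial>lborel)"
      by (rule tendsto_mollified[OF cA M _ \<epsilon>]) (use \<kappa>(1) in simp)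
    also have "A 0 * (\<integral>w. 2 * ?m * \<kappa> w \<partial>lborel) = C * v x" by (simp add: A_def C_def)
    finally have lim1: "(\<lambda>n. \<integral>y. v y * (?L1 ((?\<epsilon> n)\<^sup>2) (?t y) / j (?t y)) \<partial>lborel) \<longlonglongrightarrow> C * v x"
      by (simp only: lhs positive_imp_inverse_positive of_nat_0_less_iff zero_less_Suc)
    have iB: "integrable lborel (\<lambda>y. v y * (Z (?t y) / j (?t y)))"
      by (rule int[of "-d"]) (use d(1) Z0 Ck_on_subset[OF CkZ] in auto)
    note [measurable] = borel_measurable_integrable[OF iB]
    have "(\<lambda>n. \<integral>y. v y * (Z (?t y) / j (?t y)) * (?t y + (?\<epsilon> n)\<^sup>2) powr (- ?m / 2) \<partial>lborel)
      \<longlonglongrightarrow> (\<integral>y. v y * (Z (?t y) / j (?t y)) * ?t y powr (- ?m / 2) \<partial>lborel)"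
    \<comment> \<open>\<open>Z\<close> vanishes where \<open>?t y\<close> is at most
      \<open>r\<^sup>2 / 2\<close>; elsewhere the negative power is at most its value at
      \<open>r\<^sup>2 / 2\<close>, uniformly in \<open>n\<close>.\<close>
    proof (rule integral_dominated_convergence[where w="\<lambda>y. \<bar>v y * (Z (?t y) / j (?t y))\<bar> * (r\<^sup>2 / 2) powr (- ?m / 2)"])
      show "AE y in lborel. (\<lambda>n. v y * (Z (?t y) / j (?t y)) * (?t y + (?\<epsilon> n)\<^sup>2) powr (- ?m / 2))
        \<longlonglongrightarrow> v y * (Z (?t y) / j (?t y)) * ?t y powr (- ?m / 2)"
      proof (rule AE_I2)
        fix y
        show "(\<lambda>n. v y * (Z (?t y) / j (?t y)) * (?t y + (?\<epsilon> n)\<^sup>2) powr (- ?m / 2))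
          \<longlonglongrightarrow> v y * (Z (?t y) / j (?t y)) * ?t y powr (- ?m / 2)"
        proof (cases "?t y = 0")
          case False
          have "(\<lambda>n. ?t y + (?\<epsilon> n)\<^sup>2) \<longlonglongrightarrow> ?t y + 0\<^sup>2" by (intro tendsto_intros \<epsilon>)
          then have "(\<lambda>n. (?t y + (?\<epsilon> n)\<^sup>2) powr (- ?m / 2)) \<longlonglongrightarrow> ?t y powr (- ?m / 2)"
            using False by (intro tendsto_powr tendsto_const) simp_all
          then show ?thesis by (intro tendsto_mult tendsto_const)
        next
          case True
          then have "Z (?t y) = 0" using a by (intro Z0) simp
          then show ?thesis by simp
        qed
      qed
      show "AE y in lborel. norm (v y * (Z (?t y) / j (?t y)) * (?t y + (?\<epsilon> n)\<^sup>2) powr (- ?m / 2))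
        \<le> \<bar>v y * (Z (?t y) / j (?t y))\<bar> * (r\<^sup>2 / 2) powr (- ?m / 2)" for n
      proof (rule AE_I2)
        fix y
        show "norm (v y * (Z (?t y) / j (?t y)) * (?t y + (?\<epsilon> n)\<^sup>2) powr (- ?m / 2))
          \<le> \<bar>v y * (Z (?t y) / j (?t y))\<bar> * (r\<^sup>2 / 2) powr (- ?m / 2)"
        proof (cases "?t y \<le> r\<^sup>2 / 2")
          case True
          then have "Z (?t y) = 0" by (intro Z0) simp
          then show ?thesis by simp
        next
          case False
          moreover have "?t y \<le> ?t y + (?\<epsilon> n)\<^sup>2" by simp
          ultimately have "(?t y + (?\<epsilon> n)\<^sup>2) powr (- ?m / 2) \<le> (r\<^sup>2 / 2) powr (- ?m / 2)"
            using a by (intro powr_mono2') linarith+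
          from mult_left_mono[OF this abs_ge_zero[of "v y * (Z (?t y) / j (?t y))"]] show ?thesis
            by (simp only: real_norm_def abs_mult abs_of_nonneg[OF powr_ge_zero])
        qed
      qed
      show "integrable lborel (\<lambda>y. \<bar>v y * (Z (?t y) / j (?t y))\<bar> * (r\<^sup>2 / 2) powr (- ?m / 2))"
        using iB by (intro integrable_mult_left integrable_abs)
    qed measurable
    moreover have "v y * (Z (?t y) / j (?t y)) * (?t y + e) powr (- ?m / 2) = v y * (?L2 e (?t y) / j (?t y))" for y e
      by (simp add: Z_def mult_ac)
    moreover have "v y * (Z (?t y) / j (?t y)) * ?t y powr (- ?m / 2) = v y * K (y - x)" for y
      by (simp add: K_def mult.assoc)
    ultimately have "(\<lambda>n. \<integral>y. v y * (?L2 ((?\<epsilon> n)\<^sup>2) (?t y) / j (?t y)) \<partial>lborel) \<longlonglongrightarrow> (\<integral>y. v y * K (y - x) \<partial>lborel)"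
      by (simp only:)
    moreover have "(\<integral>y. v y * (?L2 ((?\<epsilon> n)\<^sup>2) (?t y) / j (?t y)) \<partial>lborel) = (\<integral>y. v y * (?L1 ((?\<epsilon> n)\<^sup>2) (?t y) / j (?t y)) \<partial>lborel)" for n
      by (rule id(2)[symmetric]) (simp only: zero_less_power positive_imp_inverse_positive of_nat_0_less_iff zero_less_Suc)
    ultimately have "(\<lambda>n. \<integral>y. v y * (?L1 ((?\<epsilon> n)\<^sup>2) (?t y) / j (?t y)) \<partial>lborel) \<longlonglongrightarrow> (\<integral>y. v y * K (y - x) \<partial>lborel)"
      by (simp only:)
    then show "C * v x = (\<integral>y. v y * K (y - x) \<partial>lborel)" by (rule LIMSEQ_unique[OF lim1])
  qed
qed

text \<open>Near each point \<open>v\<close> equals a constant multiple of an integrable function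
  convolved with a smooth compactly supported kernel, and all derivatives can be put on the
  kernel.\<close>

lemma weak_helmholtz_smooth:
  fixes v :: "'a::euclidean_space \<Rightarrow> real"
  assumes dim: "DIM('a) \<ge> 2" and D: "open D" and v: "continuous_on D v"
    and weak: "\<And>U \<phi>. \<lbrakk>open U; compact (closure U); closure U \<subseteq> D; test_function_on U \<phi>\<rbrakk> \<Longrightarrow>
      (\<integral>y. v y * laplacian \<phi> y \<partial>lborel) = - \<mu>\<^sup>2 * (\<integral>y. v y * \<phi> y \<partial>lborel)"
  shows "Ck_on k D v"
proof (rule Ck_on_local)
  fix x0 assume "x0 \<in> D"
  then obtain R where R: "R > 0" "cball x0 R \<subseteq> D" using D open_contains_cball by blast
  from R have "R / 3 > 0" by simp
  then show "\<exists>T. open T \<and> x0 \<in> T \<and> Ck_on k T v"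
  proof (rule helmholtz_representation[OF dim, where \<mu>=\<mu>])
    fix r C and K :: "'a \<Rightarrow> real" assume r: "0 < r" "r < R / 3" and C: "C \<noteq> 0"
      and K: "\<And>k. Ck_on k UNIV K" "\<And>z. z \<notin> cball 0 r \<Longrightarrow> K z = 0"
      and rep: "\<And>D v x. \<lbrakk>open D; continuous_on D v; cball x r \<subseteq> D;
        \<And>\<phi>. test_function_on (ball x (2 * r)) \<phi> \<Longrightarrow>
          (\<integral>y. v y * laplacian \<phi> y \<partial>lborel) = - \<mu>\<^sup>2 * (\<integral>y. v y * \<phi> y \<partial>lborel)\<rbrakk>
        \<Longrightarrow> C * v x = (\<integral>y. v y * K (y - x) \<partial>lborel)"
    \<comment> \<open>The cut-off makes \<open>v\<close> integrable without affecting the formula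
      near \<open>x0\<close>: since \<open>r < R / 3\<close>, for \<open>x\<close> in
      \<open>ball x0 r\<close> even \<open>cball x (2 * r)\<close> lies in
      \<open>cball x0 R\<close>.\<close>
    let ?f = "\<lambda>y. indicator (cball x0 R) y *\<^sub>R v y"
    have f: "integrable lborel ?f"
      using R by (intro borel_integrable_compact compact_cball continuous_on_subset[OF v])
    have "Ck_on k UNIV (\<lambda>x. (1 / C) * (\<integral>y. ?f y * K (y - x) \<partial>lborel))"
      by (intro Ck_on_mult Ck_on_const open_UNIV Ck_on_convolution[OF f K(1) compact_cball K(2)])
    moreover have "(1 / C) * (\<integral>y. ?f y * K (y - x) \<partial>lborel) = v x" if x: "x \<in> ball x0 r" for x
    proof -
      have near: "cball x (2 * r) \<subseteq> cball x0 R"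
      proof
        fix y assume "y \<in> cball x (2 * r)"
        then show "y \<in> cball x0 R" using x r dist_triangle[of x0 y x] by simp
      qed
      have "C * v x = (\<integral>y. v y * K (y - x) \<partial>lborel)"
      proof (rule rep[OF D v])
        show "cball x r \<subseteq> D" using near R r subset_cball[of r "2 * r" x] by auto
        show "(\<integral>y. v y * laplacian \<phi> y \<partial>lborel) = - \<mu>\<^sup>2 * (\<integral>y. v y * \<phi> y \<partial>lborel)"
          if "test_function_on (ball x (2 * r)) \<phi>" for \<phi>
          by (rule weak[OF open_ball _ _ that]) (use near R r in auto)
      qed
      also have "\<dots> = (\<integral>y. ?f y * K (y - x) \<partial>lborel)"
      proof (rule Bochner_Integration.integral_cong[OF refl])
        fix y
        show "v y * K (y - x) = ?f y * K (y - x)"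
        proof (cases "y \<in> cball x r")
          case True
          then have "y \<in> cball x (2 * r)" using r by simp
          then have "y \<in> cball x0 R" using near by blast
          then show ?thesis by simp
        next
          case False
          then have "K (y - x) = 0" by (intro K(2)) (simp add: dist_norm norm_minus_commute)
          then show ?thesis by simp
        qed
      qed
      finally show ?thesis using C by (metis divide_inverse mult.commute nonzero_mult_div_cancel_left times_divide_eq_left mult_1)
  qed
    ultimately have "Ck_on k (ball x0 r) v"
      by (intro Ck_on_cong[OF open_ball _ Ck_on_subset[OF _ subset_UNIV]])
    then show ?thesis using r by (intro exI[of _ "ball x0 r"]) auto
  qed
qed

theorem theorem3:
  fixes D :: "'a::euclidean_space set" and u v :: "'a \<Rightarrow> real"
    and k :: nat and p \<mu> :: real and \<rho> :: "'a \<Rightarrow> real"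
  assumes dim: "DIM('a) \<ge> 2"
    and domain: "open D" "connected D" "bounded D"
    and exponents: "p \<ge> 1" "k \<ge> 2" "1 < real k - real DIM('a) / p"
    and sobolev: "u \<in> sobolev_loc k p D"
    \<comment> \<open>\<open>v\<close> is the \<open>C\<^sup>1\<close> function on \<open>D\<close> with which \<open>u\<close> is identified\<close>
    and representative: "Ck_on 1 D v" "AE x in lebesgue. x \<in> D \<longrightarrow> u x = v x"
    and pos: "\<mu> > 0"
    and admissible: "\<And>x. x \<in> D \<Longrightarrow> \<rho> x > 0 \<and> closure (ball x (\<rho> x)) \<subseteq> D"
    and flux: "\<And>x r. x \<in> D \<Longrightarrow> 0 < r \<Longrightarrow> r < \<rho> x \<Longrightarrow>
      mean_flux v x r =
        - \<mu> * Gamma (real DIM('a) / 2) *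
          (bessel_J (real DIM('a) / 2) (\<mu> * r) / (\<mu> * r / 2) powr ((real DIM('a) - 2) / 2)) * v x"
  shows "metaharmonic_on \<mu> D v"
proof -
  let ?m = "real DIM('a)"
  note D = domain(1)
  \<comment> \<open>The identity is used at one fixed \<open>x\<close> with radii tending to 0, so
    how \<open>\<rho> x\<close> varies with \<open>x\<close> does not matter.\<close>
  have lim: "((\<lambda>s. mean_flux v x s / s) \<longlongrightarrow> - (\<mu>\<^sup>2 / ?m) * v x) (at_right 0)" if x: "x \<in> D" for x
  proof (rule Lim_transform_eventually)
    show "((\<lambda>s. (- \<mu> * Gamma (?m / 2) * (bessel_J (?m / 2) (\<mu> * s) / (\<mu> * s / 2) powr ((?m - 2) / 2)) / s) * v x)
      \<longlongrightarrow> - (\<mu>\<^sup>2 / ?m) * v x) (at_right 0)"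
      by (rule tendsto_mult[OF flux_factor_asymptotics[OF _ pos] tendsto_const]) simp
    show "\<forall>\<^sub>F s in at_right 0. (- \<mu> * Gamma (?m / 2) * (bessel_J (?m / 2) (\<mu> * s) / (\<mu> * s / 2) powr ((?m - 2) / 2)) / s) * v x
      = mean_flux v x s / s"
      by (rule eventually_at_rightI[of 0 "\<rho> x"]) (use x flux admissible in auto)
  qed
  have smooth: "Ck_on 2 D v"
    by (rule weak_helmholtz_smooth[OF dim D Ck_on_imp_continuous_on[OF representative(1)]
          weak_helmholtz[OF D representative sobolev exponents(2,1) lim]])
  \<comment> \<open>The same bump means have two limits: the classical Laplacian, by continuity and
    the second Green identity, and the value dictated by the fluxes.\<close>
  have "laplacian v x + \<mu>\<^sup>2 * v x = 0" if x: "x \<in> D" for x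
  proof -
    have c: "continuous_on D (laplacian v)"
      using smooth unfolding laplacian_def[abs_def] by (auto simp: numeral_2_eq_2 intro!: continuous_on_sum)
    note green = green_second[OF D smooth Ck_on_bump compact_cball _ bump_eq_0']
    have "((\<lambda>r. (\<integral>y. laplacian v y * bump x r y \<partial>lborel) / (\<integral>y. bump x r y \<partial>lborel)) \<longlongrightarrow> laplacian v x) (at_right 0)"
      by (rule bump_mean_continuous[OF D x c]) (rule green(1))
    moreover obtain R where R: "R > 0" "cball x R \<subseteq> D" using D x open_contains_cball by blast
    have "\<forall>\<^sub>F r in at_right 0. (\<integral>y. laplacian v y * bump x r y \<partial>lborel) / (\<integral>y. bump x r y \<partial>lborel)
      = (\<integral>y. v y * laplacian (bump x r) y \<partial>lborel) / (\<integral>y. bump x r y \<partial>lborel)"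
    proof (rule eventually_at_rightI[OF _ R(1)])
      fix r assume "r \<in> {0<..<R}"
      then have "r > 0" "cball x r \<subseteq> D" using R by auto
      then show "(\<integral>y. laplacian v y * bump x r y \<partial>lborel) / (\<integral>y. bump x r y \<partial>lborel)
        = (\<integral>y. v y * laplacian (bump x r) y \<partial>lborel) / (\<integral>y. bump x r y \<partial>lborel)"
        using green(2)[of x r] by simp
    qed
    ultimately have "((\<lambda>r. (\<integral>y. v y * laplacian (bump x r) y \<partial>lborel) / (\<integral>y. bump x r y \<partial>lborel)) \<longlongrightarrow> laplacian v x) (at_right 0)"
      by (rule Lim_transform_eventually)
    \<comment> \<open>The factor \<open>?m\<close> from \<open>flux_limit\<close> cancels the
      \<open>1 / ?m\<close> in the asymptotics of the flux.\<close>
    then have "laplacian v x = ?m * (- (\<mu>\<^sup>2 / ?m) * v x)"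
      using tendsto_unique[OF _ _ flux_limit[OF D representative(1) x lim[OF x]]] by (simp add: trivial_limit_at_right_real)
    then show ?thesis by simp
  qed
  then show ?thesis using smooth by (simp add: metaharmonic_on_def)
qed

end
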